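(* Let $\Omega\subset\mathbb{H}^n$ be open, let $\Sigma$ be a $p$-dimensional $C^1$ submanifold of $\Omega$, let $B_1$ be the open unit ball centered at the unit element for a homogeneous distance $\rho$ on $\mathbb{H}^n$, and let $\tilde g$ be a left invariant Riemannian metric on $\mathbb{H}^n$ such that $\tilde g_{|H\mathbb{H}^n}=g_{|H\mathbb{H}^n}$. Then $$\frac{1}{\widetilde{\mathrm{vol}}_{2n+1}(B_1)}\int_\Sigma|\tilde\tau_{\Sigma,\mathcal V}(x)|\,d\widetilde{\mathrm{vol}}_p(x)=\frac{1}{\mathrm{vol}_{2n+1}(B_1)}\int_\Sigma|\tau_{\Sigma,\mathcal V}(x)|\,d\mathrm{vol}_p(x),$$ where $\widetilde{\mathrm{vol}}_m$, $\tilde\tau_{\Sigma,\mathcal V}$ and its norm are defined with respect to $\tilde g$, and $\mathrm{vol}_m$, $\tau_{\Sigma,\mathcal V}$ and its norm with respect to $g$.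
   Context: Heisenberg group: $\mathbb{H}^n$ is the simply connected Lie group of dimension $2n+1$ whose Lie algebra $\mathfrak h^n$ (identified with left invariant vector fields) has a basis $(X_1,\dots,X_{2n},Z)$ whose only nontrivial brackets are $[X_k,X_{k+n}]=2Z$, $k=1,\dots,n$. The exponential map gives standard coordinates $F:\mathbb{R}^{2n+1}\to\mathbb{H}^n$, $F(y)=\exp\big(y_{2n+1}Z+\sum_{j=1}^{2n}y_jX_j\big)$, in which dilations are $\delta_r(x)=(rx_1,\dots,rx_{2n},r^2x_{2n+1})$, $r>0$. The horizontal space is $H_x\mathbb{H}^n=\mathrm{span}\{X_1(x),\dots,X_{2n}(x)\}$ and $H\mathbb{H}^n$ is the subbundle they form. The Riemannian metric $g$ is the left invariant one making $(X_1,\dots,X_{2n},Z)$ orthonormal. A homogeneous distance $\rho$ on $\mathbb{H}^n$ is a distance that is continuous for the topology of $\mathbb{H}^n$, left invariant and satisfies $\rho(\delta_ry,\delta_rz)=r\rho(y,z)$ for all $r>0$. For a left invariant Riemannian metric $h$ ($h=g$ or $h=\tilde g$), the $m$-dimensional Riemannian (Hausdorff) measure of $h$ is written $\mathrm{vol}_m$ (resp. $\widetilde{\mathrm{vol}}_m$). The space $\Lambda_p(T_x\mathbb{H}^n)$ carries the scalar product $\langle v_1\wedge\dots\wedge v_p,w_1\wedge\dots\wedge w_p\rangle=\det\big(h(x)(v_i,w_j)\big)$; the space of vertical $p$-vectors (with respect to $h$) is the $h$-orthogonal complement of $\Lambda_p(H_x\mathbb{H}^n)$ in $\Lambda_p(T_x\mathbb{H}^n)$,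 and the vertical projection is the $h$-orthogonal projection onto it. For $x\in\Sigma$, a tangent $p$-vector is $t_1\wedge\dots\wedge t_p$ with $(t_1,\dots,t_p)$ an $h$-orthonormal basis of $T_x\Sigma$ (defined up to sign); its vertical projection is the vertical tangent $p$-vector, denoted $\tau_{\Sigma,\mathcal V}(x)$ for $h=g$ and $\tilde\tau_{\Sigma,\mathcal V}(x)$ for $h=\tilde g$. *)

theory Defs
  imports "HOL-Analysis.Analysis"
begin

section \<open>Heisenberg group\<close>

text \<open>
  The group of dimension \<open>2 * CARD('n) + 1\<close> in the exponential coordinates of the basis
  \<open>X_1, ..., X_2n, Z\<close>: the coordinates of \<open>X_k\<close>, \<open>X_(k+n)\<close> and \<open>Z\<close> are indexed by \<open>Inl k\<close>,
  \<open>Inr (Inl k)\<close> and \<open>Inr (Inr ())\<close>.  Since all brackets of length three vanish, the product is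
  \<open>exp a exp b = exp (a + b + [a, b] / 2)\<close> with \<open>[X_k, X_(k+n)] = 2 Z\<close>.  The unit is \<open>0\<close>
  and the inverse of \<open>x\<close> is \<open>- x\<close>.
\<close>

type_synonym 'n heis = "real ^ ('n + 'n + unit)"

abbreviation vert_idx :: "'n + 'n + unit" where
  "vert_idx \<equiv> Inr (Inr ())"

definition heis_prod :: "'n::finite heis \<Rightarrow> 'n heis \<Rightarrow> 'n heis" where
  "heis_prod x y = (\<chi> i. x $ i + y $ i +
     (if i = vert_idx
      then \<Sum>k\<in>UNIV. x $ Inl k * y $ Inr (Inl k) - x $ Inr (Inl k) * y $ Inl k
      else 0))"

definition heis_dil :: "real \<Rightarrow> 'n::finite heis \<Rightarrow> 'n heis" where
  "heis_dil r x = (\<chi> i. (if i = vert_idx then r\<^sup>2 else r) * x $ i)"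

definition heis_dL :: "'n::finite heis \<Rightarrow> 'n heis \<Rightarrow> 'n heis \<Rightarrow> 'n heis" where
  "heis_dL x y = frechet_derivative (heis_prod x) (at y)"

definition heis_frame :: "'n + 'n + unit \<Rightarrow> 'n::finite heis \<Rightarrow> 'n heis" where
  "heis_frame i x = heis_dL x 0 (axis i 1)"

definition horizontal :: "'n::finite heis \<Rightarrow> 'n heis set" where
  "horizontal x = span {heis_frame i x | i. i \<noteq> vert_idx}"

text \<open>
  A left invariant Riemannian metric, as a family of scalar products on the tangent spaces, all
  of which are identified with the coordinate space.  Smoothness in the base point is a
  consequence of left invariance.
\<close>

definition left_invariant_metric :: "('n::finite heis \<Rightarrow> 'n heis \<Rightarrow> 'n heis \<Rightarrow> real) \<Rightarrow> bool" where
  "left_invariant_metric h \<longleftrightarrow>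
     (\<forall>x. bilinear (h x) \<and> (\<forall>v w. h x v w = h x w v) \<and> (\<forall>v. v \<noteq> 0 \<longrightarrow> h x v v > 0)) \<and>
     (\<forall>x y v w. h (heis_prod x y) (heis_dL x y v) (heis_dL x y w) = h y v w)"

text \<open>
  The left invariant metric with orthonormal frame \<open>X_1, ..., X_2n, Z\<close>; see the lemmas
  \<open>left_invariant_heis_metric\<close> and \<open>heis_metric_frame\<close> below.
\<close>

definition heis_metric :: "'n::finite heis \<Rightarrow> 'n heis \<Rightarrow> 'n heis \<Rightarrow> real" where
  "heis_metric x v w = heis_dL (- x) x v \<bullet> heis_dL (- x) x w"

definition homogeneous_distance :: "('n::finite heis \<Rightarrow> 'n heis \<Rightarrow> real) \<Rightarrow> bool" where
  "homogeneous_distance \<rho> \<longleftrightarrow>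
     Metric_space UNIV \<rho> \<and>
     continuous_on UNIV (\<lambda>z. \<rho> (fst z) (snd z)) \<and>
     (\<forall>x y z. \<rho> (heis_prod x y) (heis_prod x z) = \<rho> y z) \<and>
     (\<forall>r>0. \<forall>y z. \<rho> (heis_dil r y) (heis_dil r z) = r * \<rho> y z)"


section \<open>Riemannian distance and Hausdorff measure\<close>

text \<open>
  Lengths are Lebesgue integrals with values in \<open>[0, \<infinity>]\<close>, so that a path of infinite length does
  not get the default value \<open>0\<close> of a divergent real integral.  At the finitely many parameters
  where a \<open>valid_path\<close> (that is, a piecewise \<open>C^1\<close> path on \<open>[0, 1]\<close>) is not differentiable the
  value of the integrand is irrelevant.
\<close>

definition riem_length :: "('a::real_normed_vector \<Rightarrow> 'a \<Rightarrow> 'a \<Rightarrow> real) \<Rightarrow> (real \<Rightarrow> 'a) \<Rightarrow> ennreal" where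
  "riem_length h \<gamma> =
     (\<integral>\<^sup>+ t \<in> {0..1}. ennreal (sqrt (h (\<gamma> t) (vector_derivative \<gamma> (at t)) (vector_derivative \<gamma> (at t)))) \<partial>lborel)"

definition riem_dist :: "('a::real_normed_vector \<Rightarrow> 'a \<Rightarrow> 'a \<Rightarrow> real) \<Rightarrow> 'a \<Rightarrow> 'a \<Rightarrow> ennreal" where
  "riem_dist h x y =
     (INF \<gamma> \<in> {\<gamma>. valid_path \<gamma> \<and> pathstart \<gamma> = x \<and> pathfinish \<gamma> = y}. riem_length h \<gamma>)"

definition ediam :: "('a \<Rightarrow> 'a \<Rightarrow> ennreal) \<Rightarrow> 'a set \<Rightarrow> ennreal" where
  "ediam d A = (SUP x\<in>A. SUP y\<in>A. d x y)"

text \<open>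
  The factor \<open>unit_ball_vol m / 2 ^ m\<close> is the normalization for which the \<open>m\<close>-dimensional
  Hausdorff measure of a Riemannian distance is the Riemannian volume on \<open>m\<close>-dimensional
  submanifolds.  The empty set is treated separately because of \<open>0 ^ 0 = 1\<close>.
\<close>

definition hausdorff_premeasure ::
    "('a \<Rightarrow> 'a \<Rightarrow> ennreal) \<Rightarrow> nat \<Rightarrow> ennreal \<Rightarrow> 'a set \<Rightarrow> ennreal" where
  "hausdorff_premeasure d m \<delta> A =
     (INF C \<in> {C :: nat \<Rightarrow> 'a set. A \<subseteq> (\<Union>i. C i) \<and> (\<forall>i. ediam d (C i) \<le> \<delta>)}.
        \<Sum>i. if C i = {} then 0 else ennreal (unit_ball_vol (real m) / 2 ^ m) * ediam d (C i) ^ m)"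

definition hausdorff_outer :: "('a \<Rightarrow> 'a \<Rightarrow> ennreal) \<Rightarrow> nat \<Rightarrow> 'a set \<Rightarrow> ennreal" where
  "hausdorff_outer d m A = (SUP \<delta> \<in> {0<..}. hausdorff_premeasure d m \<delta> A)"

definition riem_vol :: "('a::real_normed_vector \<Rightarrow> 'a \<Rightarrow> 'a \<Rightarrow> real) \<Rightarrow> nat \<Rightarrow> 'a measure" where
  "riem_vol h m = measure_of UNIV (sets borel) (hausdorff_outer (riem_dist h) m)"


section \<open>Submanifolds\<close>

text \<open>
  Embedded \<open>C^1\<close> submanifolds of dimension \<open>CARD('p)\<close>, by local parametrizations that are
  \<open>C^1\<close> immersions and homeomorphisms onto relatively open subsets.
\<close>

definition C1_submanifold ::
    "'p::finite itself \<Rightarrow> 'a::real_normed_vector set \<Rightarrow> 'a set \<Rightarrow> bool" where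
  "C1_submanifold _ \<Omega> S \<longleftrightarrow> S \<subseteq> \<Omega> \<and>
     (\<forall>x\<in>S. \<exists>U W (\<phi> :: real ^ 'p \<Rightarrow> 'a) \<psi> \<phi>'.
        open U \<and> x \<in> U \<and> open W \<and> homeomorphism W (S \<inter> U) \<phi> \<psi> \<and>
        (\<forall>u\<in>W. (\<phi> has_derivative blinfun_apply (\<phi>' u)) (at u) \<and> inj (blinfun_apply (\<phi>' u))) \<and>
        continuous_on W \<phi>')"

definition tangent_space :: "'a::real_normed_vector set \<Rightarrow> 'a \<Rightarrow> 'a set" where
  "tangent_space S x =
     {v. \<exists>\<gamma> e. e > 0 \<and> \<gamma> ` {-e<..<e} \<subseteq> S \<and> \<gamma> C1_differentiable_on {-e<..<e} \<and>
          \<gamma> 0 = x \<and> (\<gamma> has_vector_derivative v) (at 0)}"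


section \<open>Multivectors\<close>

text \<open>
  \<open>\<Lambda>_p(V)\<close> for \<open>V = real ^ 'i\<close> and \<open>p = CARD('p)\<close> is realized as the space of antisymmetric
  tensors inside the \<open>p\<close>-fold tensor power of \<open>V\<close>; the coordinates of a tensor are indexed by
  the multi-indices \<open>I :: 'i ^ 'p\<close>, and \<open>v_1 \<and> ... \<and> v_p\<close> is the sum of
  \<open>sign \<sigma> v_(\<sigma> 1) \<otimes> ... \<otimes> v_(\<sigma> p)\<close> over all permutations \<open>\<sigma>\<close>.
\<close>

type_synonym ('i, 'p) pvec = "real ^ ('i ^ 'p)"

definition wedge :: "real ^ 'i::finite ^ 'p::finite \<Rightarrow> ('i, 'p) pvec" where
  "wedge v = (\<chi> I. det (\<chi> a b. v $ a $ (I $ b)))"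

definition pvectors :: "(real ^ 'i::finite) set \<Rightarrow> ('i, 'p::finite) pvec set" where
  "pvectors W = span {wedge v | v. \<forall>a. v $ a \<in> W}"

text \<open>
  The condition determines the scalar product on \<open>pvectors UNIV\<close>, the span of all wedge products;
  it is satisfiable by lemma \<open>pvec_inner\<close> below.
\<close>

definition pvec_inner ::
    "(real ^ 'i::finite \<Rightarrow> real ^ 'i \<Rightarrow> real) \<Rightarrow> ('i, 'p::finite) pvec \<Rightarrow> ('i, 'p) pvec \<Rightarrow> real" where
  "pvec_inner h = (SOME B. bilinear B \<and>
     (\<forall>v w. B (wedge v) (wedge w) = det (\<chi> a b. h (v $ a) (w $ b))))"

definition pvec_norm :: "(real ^ 'i::finite \<Rightarrow> real ^ 'i \<Rightarrow> real) \<Rightarrow> ('i, 'p::finite) pvec \<Rightarrow> real" where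
  "pvec_norm h \<xi> = sqrt (pvec_inner h \<xi> \<xi>)"

definition vertical_pvectors ::
    "(real ^ 'i::finite \<Rightarrow> real ^ 'i \<Rightarrow> real) \<Rightarrow> (real ^ 'i) set \<Rightarrow> ('i, 'p::finite) pvec set" where
  "vertical_pvectors h H = {\<xi> \<in> pvectors UNIV. \<forall>\<eta>\<in>pvectors H. pvec_inner h \<xi> \<eta> = 0}"

definition vertical_projection ::
    "(real ^ 'i::finite \<Rightarrow> real ^ 'i \<Rightarrow> real) \<Rightarrow> (real ^ 'i) set \<Rightarrow> ('i, 'p::finite) pvec \<Rightarrow> ('i, 'p) pvec" where
  "vertical_projection h H \<xi> =
     (THE \<zeta>. \<zeta> \<in> vertical_pvectors h H \<and> (\<forall>\<eta>\<in>vertical_pvectors h H. pvec_inner h (\<xi> - \<zeta>) \<eta> = 0))"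

text \<open>
  The tangent \<open>p\<close>-vector is determined up to sign; the choice of the orthonormal basis
  does not affect the norm of its vertical projection.
\<close>

definition tangent_pvector ::
    "(real ^ 'i::finite \<Rightarrow> real ^ 'i \<Rightarrow> real ^ 'i \<Rightarrow> real) \<Rightarrow> (real ^ 'i) set \<Rightarrow> real ^ 'i \<Rightarrow>
     ('i, 'p::finite) pvec" where
  "tangent_pvector h S x = wedge (SOME t :: real ^ 'i ^ 'p.
     (\<forall>a b. h x (t $ a) (t $ b) = (if a = b then 1 else 0)) \<and>
     span (range (\<lambda>a. t $ a)) = tangent_space S x)"

definition vertical_tangent ::
    "('n::finite heis \<Rightarrow> 'n heis \<Rightarrow> 'n heis \<Rightarrow> real) \<Rightarrow> 'n heis set \<Rightarrow> 'n heis \<Rightarrow>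
     ('n + 'n + unit, 'p::finite) pvec" where
  "vertical_tangent h S x = vertical_projection (h x) (horizontal x) (tangent_pvector h S x)"


section \<open>Checks of the definitions\<close>

lemma heis_dL_eq:
  "heis_dL x y v = (\<chi> i. v $ i +
     (if i = vert_idx
      then \<Sum>k\<in>UNIV. x $ Inl k * v $ Inr (Inl k) - x $ Inr (Inl k) * v $ Inl k
      else 0))" (is "_ = ?D v")
proof -
  have "bounded_linear ?D"
    by (intro linear_conv_bounded_linear[THEN iffD1] linearI)
       (auto simp: vec_eq_iff algebra_simps sum.distrib sum_subtractf sum_distrib_left)
  moreover have "heis_prod x = (\<lambda>y. x + ?D y)"
    by (auto simp: heis_prod_def vec_eq_iff fun_eq_iff)
  ultimately have "(heis_prod x has_derivative ?D) (at y)"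
    by (auto intro!: derivative_eq_intros bounded_linear_imp_has_derivative)
  then show ?thesis
    unfolding heis_dL_def by (simp only: frechet_derivative_at[symmetric])
qed

lemma heis_one_parameter_subgroup: "heis_prod (s *\<^sub>R y) (t *\<^sub>R y) = (s + t) *\<^sub>R y"
  by (auto simp: heis_prod_def vec_eq_iff algebra_simps)

lemma heis_idx_cases:
  fixes i :: "'n + 'n + unit"
  obtains k where "i = Inl k" | k where "i = Inr (Inl k)" | "i = vert_idx"
proof (cases i)
  case (Inr r)
  then show ?thesis using that by (cases r) auto
qed (use that in auto)

lemma heis_frame_eq:
  fixes x :: "'n::finite heis"
  shows "heis_frame i x = axis i 1 +
     (case i of Inl k \<Rightarrow> - x $ Inr (Inl k) | Inr (Inl k) \<Rightarrow> x $ Inl k | Inr (Inr _) \<Rightarrow> 0) *\<^sub>R axis vert_idx 1"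
proof -
  have d: "(\<Sum>k\<in>UNIV. a k * (if k = l then 1 else 0)) = a l" for a :: "'n \<Rightarrow> real" and l
  proof -
    have "(\<Sum>k\<in>UNIV. a k * (if k = l then 1 else 0)) = (\<Sum>k\<in>UNIV. if k = l then a k else 0)"
      by (intro sum.cong) auto
    then show ?thesis by simp
  qed
  show ?thesis
    by (cases i rule: heis_idx_cases) (auto simp: heis_frame_def heis_dL_eq vec_eq_iff axis_def d sum_negf)
qed

lemma heis_frame_bracket:
  fixes x :: "'n::finite heis"
  shows "frechet_derivative (heis_frame j) (at x) (heis_frame i x) -
   frechet_derivative (heis_frame i) (at x) (heis_frame j x) =
   (case (i, j) of
      (Inl k, Inr (Inl l)) \<Rightarrow> if k = l then 2 else 0
    | (Inr (Inl k), Inl l) \<Rightarrow> if k = l then - 2 else 0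
    | _ \<Rightarrow> 0) *\<^sub>R heis_frame vert_idx x"
proof -
  have eq: "heis_frame i = (\<lambda>y. axis i 1 +
      (case i of Inl k \<Rightarrow> - y $ Inr (Inl k) | Inr (Inl k) \<Rightarrow> y $ Inl k | Inr (Inr _) \<Rightarrow> 0) *\<^sub>R axis vert_idx 1)"
    for i :: "'n + 'n + unit"
    by (rule ext, rule heis_frame_eq)
  have "(heis_frame i has_derivative (\<lambda>v.
     (case i of Inl k \<Rightarrow> - v $ Inr (Inl k) | Inr (Inl k) \<Rightarrow> v $ Inl k | Inr (Inr _) \<Rightarrow> 0) *\<^sub>R axis vert_idx 1)) (at x)"
    for i :: "'n + 'n + unit"
    by (subst eq, cases i rule: heis_idx_cases)
       (auto intro!: derivative_eq_intros bounded_linear_imp_has_derivative bounded_linear_vec_nth)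
  then have D: "frechet_derivative (heis_frame i) (at x) = (\<lambda>v.
     (case i of Inl k \<Rightarrow> - v $ Inr (Inl k) | Inr (Inl k) \<Rightarrow> v $ Inl k | Inr (Inr _) \<Rightarrow> 0) *\<^sub>R axis vert_idx 1)"
    for i :: "'n + 'n + unit"
    by (rule frechet_derivative_at[symmetric])
  show ?thesis
    unfolding D
    by (cases i rule: heis_idx_cases; cases j rule: heis_idx_cases)
       (simp_all add: heis_frame_eq axis_def vec_eq_iff)
qed

lemma left_invariant_heis_metric:
  "left_invariant_metric (heis_metric :: 'n::finite heis \<Rightarrow> 'n heis \<Rightarrow> 'n heis \<Rightarrow> real)"
proof -
  have lin: "linear (heis_dL x y)" for x y :: "'n heis"
    by (rule linearI)
       (auto simp: heis_dL_eq vec_eq_iff algebra_simps sum.distrib sum_subtractf sum_distrib_left)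
  have chain: "heis_dL (- heis_prod x y) (heis_prod x y) (heis_dL x y v) = heis_dL (- y) y v"
    for x y v :: "'n heis"
    by (auto simp: heis_dL_eq heis_prod_def vec_eq_iff algebra_simps sum.distrib sum_subtractf)
  have inj0: "v = 0" if "heis_dL x y v = 0" for x y v :: "'n heis"
  proof -
    have c: "v $ i = 0" if "i \<noteq> vert_idx" for i
      using arg_cong[OF \<open>heis_dL x y v = 0\<close>, of "\<lambda>u. u $ i"] that by (simp add: heis_dL_eq)
    have "v $ vert_idx = 0"
      using arg_cong[OF \<open>heis_dL x y v = 0\<close>, of "\<lambda>u. u $ vert_idx"] by (simp add: heis_dL_eq c)
    then show ?thesis using c by (metis vec_eq_iff zero_index)
  qed
  show ?thesis
    unfolding left_invariant_metric_def
  proof (intro conjI allI impI)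
    fix x v w :: "'n heis"
    show "bilinear (heis_metric x)"
      unfolding bilinear_def heis_metric_def
      by (intro conjI allI linearI)
         (simp_all add: linear_add[OF lin] linear_cmul[OF lin] inner_add_left inner_add_right)
    show "heis_metric x v w = heis_metric x w v"
      by (simp add: heis_metric_def inner_commute)
  next
    fix x v :: "'n heis" assume "v \<noteq> 0"
    then show "heis_metric x v v > 0"
      using inj0 by (auto simp: heis_metric_def)
  next
    fix x y v w :: "'n heis"
    show "heis_metric (heis_prod x y) (heis_dL x y v) (heis_dL x y w) = heis_metric y v w"
      by (simp add: heis_metric_def chain)
  qed
qed

lemma heis_metric_frame: "heis_metric x (heis_frame i x) (heis_frame j x) = (if i = j then 1 else 0)"
proof -
  have "heis_dL (- x) x (heis_frame i x) = axis i 1" for i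
    unfolding heis_frame_def
    by (auto simp: heis_dL_eq vec_eq_iff algebra_simps sum.distrib sum_subtractf)
  then show ?thesis
    by (simp add: heis_metric_def inner_axis_axis)
qed

lemma sum_vec_prod:
  fixes f :: "'p::finite \<Rightarrow> 'i::finite \<Rightarrow> real"
  shows "(\<Sum>I\<in>(UNIV :: ('i ^ 'p) set). \<Prod>b\<in>UNIV. f b (I $ b)) = (\<Prod>b\<in>UNIV. \<Sum>i\<in>UNIV. f b i)"
proof -
  have "(\<Prod>b\<in>UNIV. \<Sum>i\<in>UNIV. f b i) = (\<Sum>g\<in>PiE UNIV (\<lambda>_. UNIV). \<Prod>b\<in>UNIV. f b (g b))"
    by (rule prod_sum_PiE) auto
  also have "\<dots> = (\<Sum>I\<in>(UNIV :: ('i ^ 'p) set). \<Prod>b\<in>UNIV. f b (I $ b))"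
    by (rule sum.reindex_bij_witness[where i = "\<lambda>I b. I $ b" and j = vec_lambda]) auto
  finally show ?thesis by simp
qed

lemma wedge_nth: "wedge v $ I = (\<Sum>\<sigma> | \<sigma> permutes UNIV. of_int (sign \<sigma>) * (\<Prod>b\<in>UNIV. v $ \<sigma> b $ (I $ b)))"
proof -
  have "wedge v $ I = det (transpose (\<chi> a b. v $ a $ (I $ b)))"
    by (simp add: wedge_def det_transpose)
  then show ?thesis
    by (simp add: det_def transpose_def)
qed

lemma pvec_inner:
  fixes h :: "real ^ 'i::finite \<Rightarrow> real ^ 'i \<Rightarrow> real"
  assumes h: "bilinear h"
  shows bilinear_pvec_inner: "bilinear (pvec_inner h :: ('i, 'p::finite) pvec \<Rightarrow> _)"
    and pvec_inner_wedge:
      "pvec_inner h (wedge v) (wedge w) = det (\<chi> a (b :: 'p). h (v $ a) (w $ b))"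
proof -
  define B :: "('i, 'p) pvec \<Rightarrow> ('i, 'p) pvec \<Rightarrow> real" where
    "B \<xi> \<eta> = (\<Sum>I\<in>UNIV. \<Sum>J\<in>UNIV. \<xi> $ I * \<eta> $ J *
        (\<Prod>b\<in>UNIV. h (axis (I $ b) 1) (axis (J $ b) 1))) / fact CARD('p)" for \<xi> \<eta>
  let ?P = "{\<sigma> :: 'p \<Rightarrow> 'p. \<sigma> permutes UNIV}"
  have bil: "bilinear B"
    unfolding bilinear_def B_def
    by (intro conjI allI linearI)
       (simp_all add: algebra_simps sum.distrib add_divide_distrib sum_distrib_left sum_divide_distrib)
  have hexp: "h x y = (\<Sum>i\<in>UNIV. \<Sum>j\<in>UNIV. x $ i * y $ j * h (axis i 1) (axis j 1))" for x y
  proof -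
    have e: "z = (\<Sum>i\<in>UNIV. z $ i *\<^sub>R axis i 1)" for z :: "real ^ 'i"
      using basis_expansion[of z] by (simp add: scalar_mult_eq_scaleR)
    have "h x y = h (\<Sum>i\<in>UNIV. x $ i *\<^sub>R axis i 1) (\<Sum>i\<in>UNIV. y $ i *\<^sub>R axis i 1)"
      using e by metis
    also have "\<dots> = (\<Sum>(i, j)\<in>UNIV \<times> UNIV. h (x $ i *\<^sub>R axis i 1) (y $ j *\<^sub>R axis j 1))"
      by (rule bilinear_sum[OF h])
    also have "\<dots> = (\<Sum>i\<in>UNIV. \<Sum>j\<in>UNIV. x $ i * y $ j * h (axis i 1) (axis j 1))"
      by (simp add: sum.cartesian_product bilinear_lmul[OF h] bilinear_rmul[OF h] algebra_simps)
    finally show ?thesis .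
  qed
  have key: "(\<Sum>I\<in>UNIV. \<Sum>J\<in>UNIV. (\<Prod>b\<in>UNIV. v $ \<tau> b $ (I $ b)) * (\<Prod>b\<in>UNIV. w $ \<sigma> b $ (J $ b)) *
        (\<Prod>b\<in>UNIV. h (axis (I $ b) 1) (axis (J $ b) 1))) = (\<Prod>b\<in>UNIV. h (v $ \<tau> b) (w $ \<sigma> b))"
    for v w :: "real ^ 'i ^ 'p" and \<sigma> \<tau> :: "'p \<Rightarrow> 'p"
  proof -
    have "(\<Sum>J\<in>UNIV. (\<Prod>b\<in>UNIV. v $ \<tau> b $ (I $ b)) * (\<Prod>b\<in>UNIV. w $ \<sigma> b $ (J $ b)) *
        (\<Prod>b\<in>UNIV. h (axis (I $ b) 1) (axis (J $ b) 1))) =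
      (\<Prod>b\<in>UNIV. \<Sum>j\<in>UNIV. v $ \<tau> b $ (I $ b) * w $ \<sigma> b $ j * h (axis (I $ b) 1) (axis j 1))"
      for I :: "'i ^ 'p"
      by (simp add: prod.distrib
           flip: sum_vec_prod[where f = "\<lambda>b j. v $ \<tau> b $ (I $ b) * w $ \<sigma> b $ j * h (axis (I $ b) 1) (axis j 1)"])
    then show ?thesis
      by (simp add: hexp[of "v $ _"]
            sum_vec_prod[where f = "\<lambda>b i. \<Sum>j\<in>UNIV. v $ \<tau> b $ i * w $ \<sigma> b $ j * h (axis i 1) (axis j 1)"])
  qed
  have wed: "B (wedge v) (wedge w) = det (\<chi> a b. h (v $ a) (w $ b))" for v w :: "real ^ 'i ^ 'p"
  proof -
    let ?M = "\<chi> a b. h (v $ a) (w $ b)"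
    let ?c = "\<lambda>I J :: 'i ^ 'p. \<Prod>b\<in>UNIV. h (axis (I $ b) 1) (axis (J $ b) 1)"
    let ?s = "\<lambda>\<sigma> :: 'p \<Rightarrow> 'p. of_int (sign \<sigma>) :: real"
    have "fact CARD('p) * B (wedge v) (wedge w) =
       (\<Sum>I\<in>UNIV. \<Sum>J\<in>UNIV. \<Sum>\<tau>\<in>?P. \<Sum>\<sigma>\<in>?P. ?s \<tau> * ?s \<sigma> *
          ((\<Prod>b\<in>UNIV. v $ \<tau> b $ (I $ b)) * (\<Prod>b\<in>UNIV. w $ \<sigma> b $ (J $ b)) * ?c I J))"
    proof -
      have "(\<Sum>\<tau>\<in>?P. ?s \<tau> * f \<tau>) * (\<Sum>\<sigma>\<in>?P. ?s \<sigma> * g \<sigma>) * c =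
          (\<Sum>\<tau>\<in>?P. \<Sum>\<sigma>\<in>?P. ?s \<tau> * ?s \<sigma> * (f \<tau> * g \<sigma> * c))" for f g c
        unfolding sum_product by (simp only: sum_distrib_right) (simp add: mult_ac)
      then show ?thesis
        by (simp add: B_def wedge_nth)
    qed
    also have "\<dots> = (\<Sum>I\<in>UNIV. \<Sum>\<tau>\<in>?P. \<Sum>J\<in>UNIV. \<Sum>\<sigma>\<in>?P. ?s \<tau> * ?s \<sigma> *
          ((\<Prod>b\<in>UNIV. v $ \<tau> b $ (I $ b)) * (\<Prod>b\<in>UNIV. w $ \<sigma> b $ (J $ b)) * ?c I J))"
      by (intro sum.cong refl sum.swap)
    also have "\<dots> = (\<Sum>\<tau>\<in>?P. \<Sum>I\<in>UNIV. \<Sum>J\<in>UNIV. \<Sum>\<sigma>\<in>?P. ?s \<tau> * ?s \<sigma> *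
          ((\<Prod>b\<in>UNIV. v $ \<tau> b $ (I $ b)) * (\<Prod>b\<in>UNIV. w $ \<sigma> b $ (J $ b)) * ?c I J))"
      by (rule sum.swap)
    also have "\<dots> = (\<Sum>\<tau>\<in>?P. \<Sum>I\<in>UNIV. \<Sum>\<sigma>\<in>?P. \<Sum>J\<in>UNIV. ?s \<tau> * ?s \<sigma> *
          ((\<Prod>b\<in>UNIV. v $ \<tau> b $ (I $ b)) * (\<Prod>b\<in>UNIV. w $ \<sigma> b $ (J $ b)) * ?c I J))"
      by (intro sum.cong refl sum.swap)
    also have "\<dots> = (\<Sum>\<tau>\<in>?P. \<Sum>\<sigma>\<in>?P. \<Sum>I\<in>UNIV. \<Sum>J\<in>UNIV. ?s \<tau> * ?s \<sigma> *
          ((\<Prod>b\<in>UNIV. v $ \<tau> b $ (I $ b)) * (\<Prod>b\<in>UNIV. w $ \<sigma> b $ (J $ b)) * ?c I J))"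
      by (intro sum.cong refl sum.swap)
    also have "\<dots> = (\<Sum>\<tau>\<in>?P. \<Sum>\<sigma>\<in>?P. ?s \<tau> * ?s \<sigma> * (\<Prod>b\<in>UNIV. h (v $ \<tau> b) (w $ \<sigma> b)))"
      by (simp only: key flip: sum_distrib_left)
    also have "\<dots> = (\<Sum>\<tau>\<in>?P. ?s \<tau> * det (\<chi> b. ?M $ \<tau> b))"
      by (simp add: det_def sum_distrib_left mult_ac)
    also have "\<dots> = (\<Sum>\<tau>\<in>?P. ?s \<tau> * (?s \<tau> * det ?M))"
      by (intro sum.cong refl arg_cong2[where f = "(*)"] det_permute_rows) simp
    also have "\<dots> = (\<Sum>\<tau>\<in>?P. det ?M)"
      by (intro sum.cong refl) (simp add: sign_def)
    also have "\<dots> = fact CARD('p) * det ?M"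
      by (simp add: card_permutations)
    finally show ?thesis by simp
  qed
  have "bilinear (pvec_inner h :: ('i, 'p) pvec \<Rightarrow> _) \<and>
     (\<forall>v w. (pvec_inner h :: ('i, 'p) pvec \<Rightarrow> _) (wedge v) (wedge w) = det (\<chi> a b. h (v $ a) (w $ b)))"
    unfolding pvec_inner_def by (rule someI[where x = B]) (use bil wed in auto)
  then show "bilinear (pvec_inner h :: ('i, 'p) pvec \<Rightarrow> _)"
    and "pvec_inner h (wedge v) (wedge w) = det (\<chi> a (b :: 'p). h (v $ a) (w $ b))"
    by auto
qed

end

theory Submission
  imports Defs
begin

text \<open>
  Let \<open>\<tau>\<close> be the unit tangent \<open>p\<close>-vector of \<open>S\<close> at \<open>x\<close>.  Both sides integrate the norm of its
  vertical part against surface measure, and the proof shows that the passage from \<open>g = heis_metric\<close>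
  to \<open>gt\<close> multiplies the integral and the volume of every Borel set by one and the same constant
  \<open>c\<close>, so that \<open>c\<close> cancels in the quotient.

  The constant.  Each scalar product \<open>h x\<close> has a unit normal \<open>e x\<close> of the hyperplane
  \<open>horizontal x\<close>, and \<open>h x v (e x)\<close> is a multiple of the contact form, which has the same kernel.
  By left invariance the factor does not depend on \<open>x\<close> (\<open>left_invariant_unit_normal\<close>); \<open>c\<close> is the
  quotient of the factors of \<open>gt\<close> and \<open>g\<close>.

  The integrand.  If some \<open>t_k\<close> is not horizontal, row operations bring \<open>t_1 \<and> ... \<and> t_p\<close> into a form
  in which all \<open>t_a\<close> but \<open>t_k\<close> are horizontal.  The vertical part then replaces \<open>t_k\<close> by its component
  along the normal, and its norm is the length of that component times the volume spanned by the
  horizontal \<open>t_a\<close>.  If all \<open>t_a\<close> are horizontal, the vertical part vanishes.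
  The metrics agree on horizontal vectors and the normal components differ by the factor \<open>c\<close>, hence
  so do the norms of the vertical parts of the same \<open>p\<close>-vector (\<open>vertical_norm_ratio\<close>).

  The measure.  Replacing \<open>g\<close> by \<open>gt\<close> multiplies the surface measure by the \<open>gt\<close>-norm of the
  \<open>g\<close>-unit tangent \<open>p\<close>-vector (\<open>nn_integral_riem_vol_change_metric\<close>), which is exactly what is lost
  when the tangent \<open>p\<close>-vector is normalized with respect to \<open>gt\<close> instead of \<open>g\<close>.  So the integrals
  differ by the factor \<open>c\<close>.  Applied to the whole group, where every top-dimensional multivector is
  vertical, the same formula shows that the volumes differ by \<open>c\<close> as well (\<open>riem_vol_top_ratio\<close>).

  The change of measure is where analysis enters, since Riemannian measures are defined here as
  Hausdorff measures of path distances.  Near a point of \<open>S\<close> the Riemannian distance is, up to a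
  factor close to \<open>1\<close>, the Euclidean distance given by the scalar product at that point, and a chart
  is almost a linear map; so the Hausdorff measure of a small piece of \<open>S\<close> is close to that of a
  linear image of its parameter domain (\<open>chart_hausdorff\<close>).  The \<open>p\<close>-dimensional Hausdorff measure
  of \<open>real ^ 'p\<close> is a constant times Lebesgue measure, because both are translation invariant, and
  hence scales by determinants.  When two metrics are compared the constant cancels and a quotient of
  Gram determinants remains.  The local estimates are glued by Lindelof's theorem.
\<close>


section \<open>Hausdorff outer measures and Borel sets\<close>

definition hausdorff_weight :: "('a \<Rightarrow> 'a \<Rightarrow> ennreal) \<Rightarrow> nat \<Rightarrow> 'a set \<Rightarrow> ennreal" where
  "hausdorff_weight d m C = (if C = {} then 0 else ennreal (unit_ball_vol (real m) / 2 ^ m) * ediam d C ^ m)"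

lemma hausdorff_weight_empty [simp]: "hausdorff_weight d m {} = 0"
  by (simp add: hausdorff_weight_def)

lemma ediam_empty [simp]: "ediam d {} = 0"
  by (simp add: ediam_def bot_ennreal)

lemma le_ediam: "x \<in> A \<Longrightarrow> y \<in> A \<Longrightarrow> d x y \<le> ediam d A"
  unfolding ediam_def by (meson SUP_upper SUP_upper2)

lemma ediam_least: "(\<And>x y. x \<in> A \<Longrightarrow> y \<in> A \<Longrightarrow> d x y \<le> c) \<Longrightarrow> ediam d A \<le> c"
  unfolding ediam_def by (intro SUP_least) auto

lemma hausdorff_premeasure_le:
  assumes "A \<subseteq> (\<Union>i. C i)" "\<And>i. ediam d (C i) \<le> \<delta>"
  shows "hausdorff_premeasure d m \<delta> A \<le> (\<Sum>i. hausdorff_weight d m (C i))"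
  unfolding hausdorff_premeasure_def hausdorff_weight_def[symmetric] using assms by (intro INF_lower) auto

lemma hausdorff_premeasure_less:
  assumes "hausdorff_premeasure d m \<delta> A < e"
  obtains C where "A \<subseteq> (\<Union>i. C i)" "\<And>i. ediam d (C i) \<le> \<delta>" "(\<Sum>i. hausdorff_weight d m (C i)) < e"
  using assms unfolding hausdorff_premeasure_def hausdorff_weight_def[symmetric] INF_less_iff by auto

lemma hausdorff_premeasure_greatest:
  assumes "\<And>C. A \<subseteq> (\<Union>i. C i) \<Longrightarrow> (\<And>i. ediam d (C i) \<le> \<delta>) \<Longrightarrow>
     e \<le> (\<Sum>i. hausdorff_weight d m (C i))"
  shows "e \<le> hausdorff_premeasure d m \<delta> A"
  unfolding hausdorff_premeasure_def hausdorff_weight_def[symmetric] using assms by (intro INF_greatest) auto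

lemma hausdorff_premeasure_empty [simp]: "hausdorff_premeasure d m \<delta> {} = 0"
proof -
  have "hausdorff_premeasure d m \<delta> {} \<le> (\<Sum>i. hausdorff_weight d m ((\<lambda>_::nat. {}) i))"
    by (rule hausdorff_premeasure_le) auto
  then show ?thesis by simp
qed

lemma hausdorff_premeasure_mono: "A \<subseteq> B \<Longrightarrow> hausdorff_premeasure d m \<delta> A \<le> hausdorff_premeasure d m \<delta> B"
  by (rule hausdorff_premeasure_greatest, rule hausdorff_premeasure_le) auto

lemma hausdorff_premeasure_antimono:
  "\<delta> \<le> \<delta>' \<Longrightarrow> hausdorff_premeasure d m \<delta>' A \<le> hausdorff_premeasure d m \<delta> A"
  by (rule hausdorff_premeasure_greatest, rule hausdorff_premeasure_le) (auto intro: order_trans)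

text \<open>
  Choose covers of the \<open>A n\<close> that are optimal up to \<open>e / 2 ^ Suc n\<close> and enumerate all their sets as
  one sequence.
\<close>

lemma hausdorff_premeasure_UN:
  "hausdorff_premeasure d m \<delta> (\<Union>n. A n) \<le> (\<Sum>n. hausdorff_premeasure d m \<delta> (A n))"
proof (rule ennreal_le_epsilon)
  let ?P = "hausdorff_premeasure d m \<delta>"
  fix e :: real assume "0 < e" "(\<Sum>n. ?P (A n)) < top"
  then have *: "?P (A n) < ?P (A n) + e * (1/2)^Suc n" for n
    by (auto simp add: less_top dest!: ennreal_suminf_lessD)
  have "\<exists>C. A n \<subseteq> (\<Union>i. C i) \<and> (\<forall>i. ediam d (C i) \<le> \<delta>) \<and>
      (\<Sum>i. hausdorff_weight d m (C i)) \<le> ?P (A n) + e * (1/2)^Suc n" for n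
  proof -
    obtain C where "A n \<subseteq> (\<Union>i. C i)" "\<And>i. ediam d (C i) \<le> \<delta>"
        "(\<Sum>i. hausdorff_weight d m (C i)) < ?P (A n) + e * (1/2)^Suc n"
      using hausdorff_premeasure_less[OF *[of n]] by metis
    then show ?thesis by (intro exI[of _ C]) auto
  qed
  then obtain C where C: "\<And>n. A n \<subseteq> (\<Union>i. C n i)" "\<And>n i. ediam d (C n i) \<le> \<delta>"
      "\<And>n. (\<Sum>i. hausdorff_weight d m (C n i)) \<le> ?P (A n) + e * (1/2)^Suc n"
    by metis
  define D where "D k = (case prod_decode k of (n, i) \<Rightarrow> C n i)" for k
  have "(\<Union>n. A n) \<subseteq> (\<Union>k. D k)"
  proof
    fix x assume "x \<in> (\<Union>n. A n)"
    then obtain n i where "x \<in> C n i" using C(1) by blast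
    then have "x \<in> D (prod_encode (n, i))" by (simp add: D_def)
    then show "x \<in> (\<Union>k. D k)" by blast
  qed
  then have "?P (\<Union>n. A n) \<le> (\<Sum>k. hausdorff_weight d m (D k))"
    by (rule hausdorff_premeasure_le) (auto simp: D_def C(2) split: prod.split)
  also have "\<dots> = (\<Sum>k. (\<lambda>(n, i). hausdorff_weight d m (C n i)) (prod_decode k))"
    by (intro arg_cong[where f = suminf]) (auto simp: D_def fun_eq_iff split: prod.split)
  also have "\<dots> = (\<Sum>n. \<Sum>i. hausdorff_weight d m (C n i))"
    by (rule suminf_ennreal_2dimen) auto
  also have "\<dots> \<le> (\<Sum>n. ?P (A n) + e * (1/2) ^ Suc n)"
    by (intro suminf_le C(3)) auto
  also have "\<dots> = (\<Sum>n. ?P (A n)) + (\<Sum>n. ennreal e * ennreal ((1/2) ^ Suc n))"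
    using \<open>0 < e\<close> by (subst suminf_add[symmetric])
                     (auto simp del: ennreal_suminf_cmult simp add: ennreal_mult[symmetric])
  also have "\<dots> = (\<Sum>n. ?P (A n)) + e"
    unfolding ennreal_suminf_cmult
    by (subst suminf_ennreal_eq[OF zero_le_power power_half_series]) auto
  finally show "?P (\<Union>n. A n) \<le> (\<Sum>n. ?P (A n)) + e" .
qed

lemma hausdorff_outer_empty [simp]: "hausdorff_outer d m {} = 0"
  by (simp add: hausdorff_outer_def SUP_constant bot_ennreal)

lemma premeasure_le_hausdorff_outer: "0 < \<delta> \<Longrightarrow> hausdorff_premeasure d m \<delta> A \<le> hausdorff_outer d m A"
  unfolding hausdorff_outer_def by (intro SUP_upper) auto

lemma hausdorff_outer_least:
  "(\<And>\<delta>. 0 < \<delta> \<Longrightarrow> hausdorff_premeasure d m \<delta> A \<le> c) \<Longrightarrow> hausdorff_outer d m A \<le> c"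
  unfolding hausdorff_outer_def by (intro SUP_least) auto

lemma hausdorff_outer_mono: "A \<subseteq> B \<Longrightarrow> hausdorff_outer d m A \<le> hausdorff_outer d m B"
  by (intro hausdorff_outer_least order_trans[OF hausdorff_premeasure_mono premeasure_le_hausdorff_outer])

lemma hausdorff_outer_UN: "hausdorff_outer d m (\<Union>n. A n) \<le> (\<Sum>n. hausdorff_outer d m (A n))"
proof (rule hausdorff_outer_least)
  fix \<delta> :: ennreal assume "0 < \<delta>"
  have "hausdorff_premeasure d m \<delta> (\<Union>n. A n) \<le> (\<Sum>n. hausdorff_premeasure d m \<delta> (A n))"
    by (rule hausdorff_premeasure_UN)
  also have "\<dots> \<le> (\<Sum>n. hausdorff_outer d m (A n))"
    using \<open>0 < \<delta>\<close> by (intro suminf_le premeasure_le_hausdorff_outer) auto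
  finally show "hausdorff_premeasure d m \<delta> (\<Union>n. A n) \<le> (\<Sum>n. hausdorff_outer d m (A n))" .
qed

lemma hausdorff_outer_Un: "hausdorff_outer d m (A \<union> B) \<le> hausdorff_outer d m A + hausdorff_outer d m B"
proof -
  have "(\<Sum>n. hausdorff_outer d m (binaryset A B n)) = hausdorff_outer d m A + hausdorff_outer d m B"
    by (rule suminf_binaryset_eq) (rule hausdorff_outer_empty)
  then show ?thesis
    using hausdorff_outer_UN[of d m "binaryset A B"] unfolding UN_binaryset_eq by (rule ord_le_eq_trans[rotated])
qed

lemma outer_measure_space_hausdorff: "outer_measure_space (Pow UNIV) (hausdorff_outer d m)"
  unfolding outer_measure_space_def positive_def increasing_def countably_subadditive_def
  by (intro conjI ballI allI impI hausdorff_outer_empty hausdorff_outer_mono hausdorff_outer_UN)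

text \<open>
  A set of diameter less than \<open>c\<close> cannot meet both \<open>A\<close> and \<open>B\<close>, so every fine cover of the union
  splits into a cover of \<open>A\<close> and a cover of \<open>B\<close>.
\<close>

lemma hausdorff_outer_Un_separated:
  assumes c: "0 < c" and sep: "\<And>x y. x \<in> A \<Longrightarrow> y \<in> B \<Longrightarrow> c \<le> d x y"
  shows "hausdorff_outer d m A + hausdorff_outer d m B \<le> hausdorff_outer d m (A \<union> B)"
proof -
  let ?P = "hausdorff_premeasure d m"
  have small: "?P \<delta> A + ?P \<delta> B \<le> ?P \<delta> (A \<union> B)" if \<delta>: "\<delta> < c" for \<delta>
  proof (rule hausdorff_premeasure_greatest)
    fix C assume C: "A \<union> B \<subseteq> (\<Union>i. C i)" "\<And>i::nat. ediam d (C i) \<le> \<delta>"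
    define part where "part X i = (if C i \<inter> X = {} then {} else C i)" for X i
    have "?P \<delta> X \<le> (\<Sum>i. hausdorff_weight d m (part X i))" if X: "X \<subseteq> A \<union> B" for X
    proof (rule hausdorff_premeasure_le)
      show "X \<subseteq> (\<Union>i. part X i)"
      proof
        fix x assume "x \<in> X"
        then obtain i where "x \<in> C i" using X C(1) by blast
        then have "x \<in> part X i" using \<open>x \<in> X\<close> by (auto simp: part_def)
        then show "x \<in> (\<Union>i. part X i)" by blast
      qed
      show "ediam d (part X i) \<le> \<delta>" for i using C(2)[of i] by (simp add: part_def)
    qed
    then have "?P \<delta> A + ?P \<delta> B \<le> (\<Sum>i. hausdorff_weight d m (part A i)) + (\<Sum>i. hausdorff_weight d m (part B i))"
      by (intro add_mono) auto
    also have "\<dots> = (\<Sum>i. hausdorff_weight d m (part A i) + hausdorff_weight d m (part B i))"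
      by (rule suminf_add[OF summableI summableI])
    also have "\<dots> \<le> (\<Sum>i. hausdorff_weight d m (C i))"
    proof (intro suminf_le summableI)
      fix i
      have "C i \<inter> A = {} \<or> C i \<inter> B = {}"
      proof (rule ccontr)
        assume "\<not> ?thesis"
        then obtain x y where "x \<in> C i" "x \<in> A" "y \<in> C i" "y \<in> B" by auto
        then have "c \<le> ediam d (C i)" using sep le_ediam order_trans by metis
        then show False using C(2)[of i] \<delta> by auto
      qed
      then show "hausdorff_weight d m (part A i) + hausdorff_weight d m (part B i) \<le> hausdorff_weight d m (C i)"
        by (auto simp: part_def)
    qed
    finally show "?P \<delta> A + ?P \<delta> B \<le> (\<Sum>i. hausdorff_weight d m (C i))" .
  qed
  have "hausdorff_outer d m A + hausdorff_outer d m B = (SUP \<delta>\<in>{0<..}. ?P \<delta> A + ?P \<delta> B)"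
    unfolding hausdorff_outer_def
  proof (rule SUP_add_directed_ennreal[symmetric])
    fix i j :: ennreal assume "i \<in> {0<..}" "j \<in> {0<..}"
    then show "\<exists>k\<in>{0<..}. ?P i A + ?P j B \<le> ?P k A + ?P k B"
      by (intro bexI[of _ "min i j"] add_mono hausdorff_premeasure_antimono) auto
  qed
  also have "\<dots> \<le> hausdorff_outer d m (A \<union> B)"
  proof (rule SUP_least)
    fix \<delta> :: ennreal assume "\<delta> \<in> {0<..}"
    then have "0 < min \<delta> c" using c by auto
    then obtain \<delta>' where \<delta>': "0 < \<delta>'" "\<delta>' < min \<delta> c" using dense by blast
    have "?P \<delta> A + ?P \<delta> B \<le> ?P \<delta>' A + ?P \<delta>' B"
      using \<delta>' by (intro add_mono hausdorff_premeasure_antimono) auto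
    also have "\<dots> \<le> ?P \<delta>' (A \<union> B)" using \<delta>' by (intro small) auto
    also have "\<dots> \<le> hausdorff_outer d m (A \<union> B)" using \<delta>' by (intro premeasure_le_hausdorff_outer)
    finally show "?P \<delta> A + ?P \<delta> B \<le> hausdorff_outer d m (A \<union> B)" .
  qed
  finally show ?thesis .
qed

text \<open>
  The link between \<open>d\<close> and the topology in Caratheodory's criterion: sets at positive Euclidean
  distance, one of which is bounded, are also at positive \<open>d\<close>-distance.  The bound is local in \<open>x\<close>,
  since the path distances below need not be uniformly comparable with the Euclidean distance.
\<close>

definition compactly_separating :: "('a::metric_space \<Rightarrow> 'a \<Rightarrow> ennreal) \<Rightarrow> bool" where
  "compactly_separating d \<longleftrightarrow>
     (\<forall>K \<epsilon>. compact K \<longrightarrow> \<epsilon> > 0 \<longrightarrow> (\<exists>c>0. \<forall>x\<in>K. \<forall>y. \<epsilon> \<le> dist x y \<longrightarrow> c \<le> d x y))"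

lemma hausdorff_outer_Un_dist:
  fixes A B :: "'a::metric_space set"
  assumes d: "compactly_separating d" and K: "compact K" "A \<subseteq> K"
    and e: "\<epsilon> > 0" "\<And>x y. x \<in> A \<Longrightarrow> y \<in> B \<Longrightarrow> \<epsilon> \<le> dist x y"
  shows "hausdorff_outer d m A + hausdorff_outer d m B \<le> hausdorff_outer d m (A \<union> B)"
proof -
  obtain c where "c > 0" "\<And>x y. x \<in> K \<Longrightarrow> \<epsilon> \<le> dist x y \<Longrightarrow> c \<le> d x y"
    using d K e(1) unfolding compactly_separating_def by metis
  then show ?thesis using K e(2) by (intro hausdorff_outer_Un_separated[of c]) auto
qed

text \<open>
  Caratheodory's argument.  The part \<open>T n\<close> of \<open>A\<close> at distance at least \<open>1 / (n + 1)\<close> from \<open>F\<close> is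
  separated from \<open>F\<close>, so it remains to see that \<open>T n\<close> exhausts \<open>A - F\<close> in measure.  What is missing is
  covered by the shells \<open>R k\<close> with \<open>k \<ge> n\<close>.  Shells whose indices differ by \<open>2\<close> are separated, hence
  the measures of all shells have a finite sum and its tails vanish.
\<close>

lemma hausdorff_outer_compact_split:
  fixes F A :: "'a::euclidean_space set"
  assumes d: "compactly_separating d" and F: "compact F"
  shows "hausdorff_outer d m (A \<inter> F) + hausdorff_outer d m (A - F) \<le> hausdorff_outer d m A"
proof (cases "F = {} \<or> hausdorff_outer d m A = \<infinity>")
  case True
  then show ?thesis by auto
next
  case False
  let ?H = "hausdorff_outer d m" and ?r = "\<lambda>n. 1 / (real n + 1)"
  define T where "T n = {x \<in> A. ?r n \<le> infdist x F}" for n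
  define R where "R n = {x \<in> A. ?r (Suc n) \<le> infdist x F \<and> infdist x F < ?r n}" for n
  define K where "K = {x. infdist x F \<le> 1}"
  have K: "compact K" using F False unfolding K_def by (intro compact_infdist_le) auto
  have RK: "R n \<subseteq> K" for n
  proof -
    have "?r n \<le> 1" by simp
    then show ?thesis unfolding R_def K_def by (auto intro: order_trans less_imp_le)
  qed
  have r_mono: "?r n \<le> ?r k" if "k \<le> n" for k n using that by (simp add: frac_le)
  have r_gap: "0 < ?r n - ?r (Suc n)" for n by (simp add: frac_less2)
  have far: "?H (A \<inter> F) + ?H (T n) \<le> ?H A" for n
  proof -
    have "?H (A \<inter> F) + ?H (T n) \<le> ?H ((A \<inter> F) \<union> T n)"
    proof (rule hausdorff_outer_Un_dist[OF d F])
      show "?r n \<le> dist x y" if "x \<in> A \<inter> F" "y \<in> T n" for x y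
        using that infdist_le[of x F y] by (auto simp: T_def dist_commute)
    qed auto
    also have "\<dots> \<le> ?H A" by (intro hausdorff_outer_mono) (auto simp: T_def)
    finally show ?thesis .
  qed
  have alt: "(\<Sum>k<N. ?H (R (2 * k + j))) \<le> ?H (\<Union>k<N. R (2 * k + j))" for N j
  proof (induction N)
    case (Suc N)
    have "?H (R (2 * N + j)) + ?H (\<Union>k<N. R (2 * k + j)) \<le> ?H (R (2 * N + j) \<union> (\<Union>k<N. R (2 * k + j)))"
    proof (cases N)
      case (Suc M)
      let ?s = "Suc (2 * M + j)"
      show ?thesis
      proof (rule hausdorff_outer_Un_dist[OF d K RK r_gap[of ?s]])
        fix x y assume x: "x \<in> R (2 * N + j)" and "y \<in> (\<Union>k<N. R (2 * k + j))"
        then obtain k where k: "k < N" and y: "y \<in> R (2 * k + j)" by auto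
        have "?r ?s \<le> ?r (Suc (2 * k + j))" using k Suc by (intro r_mono) auto
        also have "\<dots> \<le> infdist y F" using y by (auto simp: R_def)
        also have "\<dots> \<le> infdist x F + dist y x" by (rule infdist_triangle)
        finally have "?r ?s \<le> infdist x F + dist y x" .
        moreover have "infdist x F \<le> ?r (2 * N + j)" using x by (auto simp: R_def)
        moreover have "2 * N + j = Suc ?s" using Suc by simp
        ultimately show "?r ?s - ?r (Suc ?s) \<le> dist x y"
          by (simp add: dist_commute)
      qed
    qed simp
    also have "R (2 * N + j) \<union> (\<Union>k<N. R (2 * k + j)) = (\<Union>k<Suc N. R (2 * k + j))"
      by (auto simp: lessThan_Suc)
    finally have "?H (R (2 * N + j)) + (\<Sum>k<N. ?H (R (2 * k + j))) \<le> ?H (\<Union>k<Suc N. R (2 * k + j))"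
      using Suc.IH add_left_mono order_trans by blast
    then show ?case by (simp add: add.commute)
  qed simp
  have RA: "?H (\<Union>k<N. R (2 * k + j)) \<le> ?H A" for N j
    by (intro hausdorff_outer_mono) (auto simp: R_def)
  have fin: "(\<Sum>k. ?H (R (2 * k + j))) \<le> ?H A" for j
    by (intro suminf_le_const summableI) (use alt RA order_trans in blast)
  have "(\<Sum>k<N. ?H (R k)) \<le> ?H A + ?H A" for N
  proof -
    have "(\<Sum>k<N. ?H (R k)) \<le> (\<Sum>k<2*N. ?H (R k))" by (intro sum_mono2) auto
    also have "\<dots> = (\<Sum>k<N. ?H (R (2 * k + 0))) + (\<Sum>k<N. ?H (R (2 * k + 1)))"
      by (induction N) (auto simp: algebra_simps)
    also have "\<dots> \<le> ?H A + ?H A" by (intro add_mono order_trans[OF alt RA])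
    finally show ?thesis .
  qed
  then have "(\<Sum>k. ?H (R k)) \<le> ?H A + ?H A"
    by (intro suminf_le_const summableI)
  then have R_fin: "(\<Sum>k. ?H (R k)) \<noteq> \<infinity>"
    using False by (auto simp: top_unique)
  have split: "A - F \<subseteq> T n \<union> (\<Union>k. R (k + n))" for n
  proof
    fix x assume x: "x \<in> A - F"
    have pos: "infdist x F > 0"
      using x F False by (metis DiffD2 compact_imp_closed in_closed_iff_infdist_zero infdist_nonneg less_eq_real_def)
    show "x \<in> T n \<union> (\<Union>k. R (k + n))"
    proof (cases "?r n \<le> infdist x F")
      case False
      obtain k where k: "?r k \<le> infdist x F"
        using pos by (metis add.commute less_imp_le nat_approx_posE of_nat_Suc)
      define l where "l = (LEAST k. ?r k \<le> infdist x F)"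
      have l: "?r l \<le> infdist x F" unfolding l_def by (rule LeastI[of _ k]) (rule k)
      have nl: "n < l" using l r_mono[of l n] False by (meson leI order_trans)
      then obtain l' where l': "l = Suc l'" by (cases l) auto
      have "\<not> ?r l' \<le> infdist x F" using not_less_Least[of l' "\<lambda>k. ?r k \<le> infdist x F"] l' by (auto simp: l_def)
      then have "x \<in> R ((l' - n) + n)" using nl l l' x by (auto simp: R_def)
      then show ?thesis by blast
    qed (use x in \<open>auto simp: T_def\<close>)
  qed
  have bound: "?H (A \<inter> F) + ?H (A - F) \<le> ?H A + (\<Sum>k. ?H (R (k + n)))" for n
  proof -
    have "?H (A - F) \<le> ?H (T n \<union> (\<Union>k. R (k + n)))"
      by (rule hausdorff_outer_mono[OF split])
    also have "\<dots> \<le> ?H (T n) + (\<Sum>k. ?H (R (k + n)))"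
      by (rule order_trans[OF hausdorff_outer_Un add_left_mono[OF hausdorff_outer_UN]])
    finally have "?H (A \<inter> F) + ?H (A - F) \<le> (?H (A \<inter> F) + ?H (T n)) + (\<Sum>k. ?H (R (k + n)))"
      by (simp add: add.assoc add_left_mono)
    also have "\<dots> \<le> ?H A + (\<Sum>k. ?H (R (k + n)))"
      by (intro add_right_mono far)
    finally show ?thesis .
  qed
  have tail: "(\<lambda>n. \<Sum>k. ?H (R (k + n))) \<longlonglongrightarrow> 0"
  proof -
    define g where "g k = enn2real (?H (R k))" for k
    have "?H (R k) \<noteq> top" for k
      using R_fin ennreal_suminf_lessD[of "\<lambda>k. ?H (R k)" top k] by (auto simp: less_top)
    then have g: "?H (R k) = ennreal (g k)" for k by (simp add: g_def less_top)
    have g0: "g k \<ge> 0" for k by (simp add: g_def)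
    have sg: "summable g"
      using R_fin g0 unfolding g by (intro summable_suminf_not_top) auto
    have "(\<Sum>k. ?H (R (k + n))) = ennreal (\<Sum>k. g (k + n))" for n
      unfolding g using sg g0 by (intro suminf_ennreal2) (auto simp: summable_iff_shift)
    moreover have "(\<lambda>n. ennreal (\<Sum>k. g (k + n))) \<longlonglongrightarrow> ennreal 0"
      by (intro tendsto_ennrealI suminf_exist_split2 sg)
    ultimately show ?thesis by simp
  qed
  have "(\<lambda>n. ?H A + (\<Sum>k. ?H (R (k + n)))) \<longlonglongrightarrow> ?H A + 0"
    by (intro tendsto_add tail) auto
  then show ?thesis
    using bound by (intro LIMSEQ_le_const[of _ "?H A"]) auto
qed

lemma measure_space_hausdorff:
  fixes d :: "'a::euclidean_space \<Rightarrow> 'a \<Rightarrow> ennreal"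
  assumes d: "compactly_separating d"
  shows "measure_space UNIV (sets borel) (hausdorff_outer d m)"
proof -
  let ?L = "lambda_system UNIV (Pow UNIV) (hausdorff_outer d m)"
  have ms: "measure_space UNIV ?L (hausdorff_outer d m)"
    using sigma_algebra.caratheodory_lemma[OF sigma_algebra_Pow outer_measure_space_hausdorff] .
  then interpret L: sigma_algebra UNIV ?L by (simp add: measure_space_def)
  have comp: "F \<in> ?L" if "compact F" for F
    unfolding algebra.lambda_system_eq[OF algebra_Pow]
    using hausdorff_outer_compact_split[OF d that, of m]
      hausdorff_outer_Un[of d m "_ \<inter> F" "_ - F"]
    by (auto intro!: antisym) (metis Int_Diff_Un)
  have closed: "F \<in> ?L" if "closed F" for F
  proof -
    have "F = (\<Union>n::nat. F \<inter> cball 0 (real n))"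
      by (auto simp: real_arch_simple)
    moreover have "(\<Union>n::nat. F \<inter> cball 0 (real n)) \<in> ?L"
      using comp closed_Int_compact[OF that compact_cball] by (intro L.countable_UN) blast
    ultimately show ?thesis by simp
  qed
  have "sets borel = sigma_sets UNIV {S::'a set. closed S}"
    by (simp add: borel_eq_closed)
  also have "\<dots> \<subseteq> ?L"
    using closed by (intro L.sigma_sets_subset) blast
  finally have "sets borel \<subseteq> ?L" .
  then show ?thesis
    using ms by (rule measure_down[rotated 2]) (metis sets.sigma_algebra_axioms space_borel)
qed

definition hausdorff_measure :: "('a::euclidean_space \<Rightarrow> 'a \<Rightarrow> ennreal) \<Rightarrow> nat \<Rightarrow> 'a measure" where
  "hausdorff_measure d m = measure_of UNIV (sets borel) (hausdorff_outer d m)"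

lemma sets_hausdorff_measure [simp, measurable_cong]: "sets (hausdorff_measure d m) = sets borel"
  unfolding hausdorff_measure_def by (metis sets.sigma_sets_eq sets_measure_of space_borel subset_UNIV Pow_UNIV top_greatest)

lemma emeasure_hausdorff_measure:
  assumes "compactly_separating d" "A \<in> sets borel"
  shows "emeasure (hausdorff_measure d m) A = hausdorff_outer d m A"
proof -
  have "measure_space UNIV (sets borel) (hausdorff_outer d m)"
    by (rule measure_space_hausdorff) fact
  moreover have "sigma_sets UNIV (sets borel) = (sets borel :: 'a set set)"
    by (metis sets.sigma_sets_eq space_borel)
  ultimately show ?thesis
    using assms(2) unfolding hausdorff_measure_def
    by (subst emeasure_measure_of_conv) auto
qed

text \<open>
  Every comparison of Hausdorff measures of different distances below is an instance of this bound.
\<close>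

lemma hausdorff_outer_Lipschitz_image:
  assumes L: "0 < L" and lip: "\<And>x y. x \<in> E \<Longrightarrow> y \<in> E \<Longrightarrow> d2 (f x) (f y) \<le> ennreal L * d1 x y"
  shows "hausdorff_outer d2 m (f ` E) \<le> ennreal (L ^ m) * hausdorff_outer d1 m E"
proof (rule hausdorff_outer_least)
  fix \<delta> :: ennreal assume "0 < \<delta>"
  have fin: "ennreal L * ennreal (1/L) = 1" using L by (simp add: ennreal_mult[symmetric])
  have "0 < ennreal (1 / L) * \<delta>" using L \<open>0 < \<delta>\<close> by (simp add: ennreal_zero_less_mult_iff)
  let ?\<delta> = "ennreal (1 / L) * \<delta>"
  have "ennreal ((1/L)^m) * hausdorff_premeasure d2 m \<delta> (f ` E) \<le> hausdorff_premeasure d1 m ?\<delta> E"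
  proof (rule hausdorff_premeasure_greatest)
    fix C assume C: "E \<subseteq> (\<Union>i. C i)" "\<And>i::nat. ediam d1 (C i) \<le> ?\<delta>"
    have diam: "ediam d2 (f ` (C i \<inter> E)) \<le> ennreal L * ediam d1 (C i)" for i
    proof (rule ediam_least)
      fix x y assume "x \<in> f ` (C i \<inter> E)" "y \<in> f ` (C i \<inter> E)"
      then obtain x' y' where *: "x = f x'" "y = f y'" "x' \<in> C i" "x' \<in> E" "y' \<in> C i" "y' \<in> E" by auto
      then have "d2 x y \<le> ennreal L * d1 x' y'" using lip by auto
      also have "\<dots> \<le> ennreal L * ediam d1 (C i)" using * by (intro mult_left_mono le_ediam) auto
      finally show "d2 x y \<le> ennreal L * ediam d1 (C i)" .
    qed
    have "hausdorff_premeasure d2 m \<delta> (f ` E) \<le> (\<Sum>i. hausdorff_weight d2 m (f ` (C i \<inter> E)))"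
    proof (rule hausdorff_premeasure_le)
      show "f ` E \<subseteq> (\<Union>i. f ` (C i \<inter> E))" using C(1) by blast
      show "ediam d2 (f ` (C i \<inter> E)) \<le> \<delta>" for i
      proof -
        have "ediam d2 (f ` (C i \<inter> E)) \<le> ennreal L * ?\<delta>"
          using diam C(2) by (meson mult_left_mono order_trans zero_le)
        also have "\<dots> = \<delta>" by (simp add: mult.assoc[symmetric] fin)
        finally show ?thesis .
      qed
    qed
    also have "\<dots> \<le> (\<Sum>i. ennreal (L^m) * hausdorff_weight d1 m (C i))"
    proof (intro suminf_le summableI)
      fix i
      have "ediam d2 (f ` (C i \<inter> E)) ^ m \<le> (ennreal L * ediam d1 (C i)) ^ m"
        by (intro power_mono diam) auto
      also have "\<dots> = ennreal (L^m) * ediam d1 (C i) ^ m"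
        using L by (simp add: power_mult_distrib ennreal_power)
      finally have "ennreal (unit_ball_vol (real m) / 2 ^ m) * ediam d2 (f ` (C i \<inter> E)) ^ m \<le>
         ennreal (unit_ball_vol (real m) / 2 ^ m) * (ennreal (L^m) * ediam d1 (C i) ^ m)"
        by (intro mult_left_mono) auto
      then show "hausdorff_weight d2 m (f ` (C i \<inter> E)) \<le> ennreal (L^m) * hausdorff_weight d1 m (C i)"
        by (auto simp: mult_ac hausdorff_weight_def)
    qed
    also have "\<dots> = ennreal (L^m) * (\<Sum>i. hausdorff_weight d1 m (C i))" by simp
    finally have "ennreal ((1/L)^m) * hausdorff_premeasure d2 m \<delta> (f ` E) \<le>
      (ennreal ((1/L)^m) * ennreal (L^m)) * (\<Sum>i. hausdorff_weight d1 m (C i))"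
      by (simp add: mult.assoc mult_left_mono)
    also have "ennreal ((1/L)^m) * ennreal (L^m) = 1"
      using L by (simp add: ennreal_mult[symmetric] power_mult_distrib[symmetric])
    finally show "ennreal ((1/L)^m) * hausdorff_premeasure d2 m \<delta> (f ` E) \<le> (\<Sum>i. hausdorff_weight d1 m (C i))"
      by simp
  qed
  also have "\<dots> \<le> hausdorff_outer d1 m E"
    by (rule premeasure_le_hausdorff_outer) fact
  finally have "ennreal (L^m) * (ennreal ((1/L)^m) * hausdorff_premeasure d2 m \<delta> (f ` E)) \<le> ennreal (L^m) * hausdorff_outer d1 m E"
    by (intro mult_left_mono) auto
  moreover have "ennreal (L^m) * ennreal ((1/L)^m) = 1"
    using L by (simp add: ennreal_mult[symmetric] power_mult_distrib[symmetric])
  ultimately show "hausdorff_premeasure d2 m \<delta> (f ` E) \<le> ennreal (L ^ m) * hausdorff_outer d1 m E"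
    by (simp add: mult.assoc[symmetric])
qed


section \<open>Hausdorff measure of the coordinate space\<close>

lemma sigma_finite_measure_balls:
  fixes M :: "'a::euclidean_space measure"
  assumes [measurable_cong]: "sets M = sets borel" and fin: "\<And>n::nat. emeasure M (ball 0 (real n)) < \<infinity>"
  shows "sigma_finite_measure M"
proof
  have "space M = UNIV" using sets_eq_imp_space_eq[OF assms(1)] by simp
  moreover have "(\<Union>n. ball (0::'a) (real n)) = UNIV"
    by (auto simp: reals_Archimedean2)
  ultimately show "\<exists>A. countable A \<and> A \<subseteq> sets M \<and> \<Union> A = space M \<and> (\<forall>a\<in>A. emeasure M a \<noteq> \<infinity>)"
    using fin by (intro exI[of _ "range (\<lambda>n. ball 0 (real n))"]) (auto simp: less_top)
qed

text \<open>
  Integrate \<open>indicator C y * indicator A (x + y)\<close> over \<open>x\<close> with respect to \<open>M\<close> and over \<open>y\<close> with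
  respect to \<open>lborel\<close>, in both orders.  Translation invariance of the inner measure turns the two
  results into the two sides of \<open>M A * lborel C = lborel A * M (- C)\<close>, and \<open>C\<close> can be taken to be a
  ball.
\<close>

lemma translation_invariant_measure_unique:
  fixes M :: "'a::euclidean_space measure"
  assumes sets: "sets M = sets borel"
    and fin: "\<And>n::nat. emeasure M (ball 0 (real n)) < \<infinity>"
    and inv: "\<And>a A. A \<in> sets borel \<Longrightarrow> emeasure M ((\<lambda>x. a + x) -` A) = emeasure M A"
  obtains k where "k < \<infinity>" "\<And>A. A \<in> sets borel \<Longrightarrow> emeasure M A = k * emeasure lborel A"
proof -
  note [measurable_cong] = sets
  have space: "space M = UNIV" using sets_eq_imp_space_eq[OF sets] by simp
  interpret M: sigma_finite_measure M by (rule sigma_finite_measure_balls[OF sets fin])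
  interpret pair_sigma_finite M lborel ..
  have refl: "(\<lambda>x. y - x) -` C \<in> sets borel" if "C \<in> sets borel" for y and C :: "'a set"
    using measurable_sets_borel[of "\<lambda>x. y - x" borel C] that by simp
  have trans: "(\<lambda>x. y + x) -` C \<in> sets borel" if "C \<in> sets borel" for y and C :: "'a set"
    using measurable_sets_borel[of "\<lambda>x. y + x" borel C] that by simp
  have key: "emeasure M A * emeasure lborel C = emeasure lborel A * emeasure M (uminus -` C)"
    if A[measurable]: "A \<in> sets borel" and C[measurable]: "C \<in> sets borel" for A C
  proof -
    let ?i = "\<lambda>A x. indicator A x :: ennreal"
    have "emeasure M A * emeasure lborel C = (\<integral>\<^sup>+ y. emeasure M A * ?i C y \<partial>lborel)"
      by (subst nn_integral_cmult_indicator) auto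
    also have "\<dots> = (\<integral>\<^sup>+ y. \<integral>\<^sup>+ x. ?i C y * ?i A (x + y) \<partial>M \<partial>lborel)"
    proof (rule nn_integral_cong)
      fix y
      have "(\<integral>\<^sup>+ x. ?i C y * ?i A (x + y) \<partial>M) = (\<integral>\<^sup>+ x. ?i C y * ?i ((\<lambda>x. y + x) -` A) x \<partial>M)"
        by (intro nn_integral_cong) (simp add: indicator_def add.commute)
      also have "\<dots> = ?i C y * emeasure M ((\<lambda>x. y + x) -` A)"
        using trans[OF A, of y] by (subst nn_integral_cmult_indicator) (simp_all add: sets)
      finally show "emeasure M A * ?i C y = (\<integral>\<^sup>+ x. ?i C y * ?i A (x + y) \<partial>M)"
        by (simp add: inv mult.commute)
    qed
    also have "\<dots> = (\<integral>\<^sup>+ x. \<integral>\<^sup>+ y. ?i C y * ?i A (x + y) \<partial>lborel \<partial>M)"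
      by (rule Fubini') measurable
    also have "\<dots> = (\<integral>\<^sup>+ x. \<integral>\<^sup>+ y. ?i C (y - x) * ?i A y \<partial>lborel \<partial>M)"
    proof (rule nn_integral_cong)
      fix x
      have "(\<integral>\<^sup>+ y. ?i C (y - x) * ?i A y \<partial>lborel) = (\<integral>\<^sup>+ y. ?i C (y - x) * ?i A y \<partial>distr lborel borel ((+) x))"
        by (simp add: lborel_distr_plus)
      also have "\<dots> = (\<integral>\<^sup>+ y. ?i C y * ?i A (x + y) \<partial>lborel)"
        by (subst nn_integral_distr) auto
      finally show "(\<integral>\<^sup>+ y. ?i C y * ?i A (x + y) \<partial>lborel) = (\<integral>\<^sup>+ y. ?i C (y - x) * ?i A y \<partial>lborel)"
        by simp
    qed
    also have "\<dots> = (\<integral>\<^sup>+ y. \<integral>\<^sup>+ x. ?i C (y - x) * ?i A y \<partial>M \<partial>lborel)"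
      by (rule Fubini'[symmetric]) measurable
    also have "\<dots> = (\<integral>\<^sup>+ y. emeasure M (uminus -` C) * ?i A y \<partial>lborel)"
    proof (rule nn_integral_cong)
      fix y
      have "(\<integral>\<^sup>+ x. ?i C (y - x) * ?i A y \<partial>M) = (\<integral>\<^sup>+ x. ?i A y * ?i ((\<lambda>x. y - x) -` C) x \<partial>M)"
        by (intro nn_integral_cong) (simp add: indicator_def)
      also have "\<dots> = ?i A y * emeasure M ((\<lambda>x. y - x) -` C)"
        using refl[OF C, of y] by (subst nn_integral_cmult_indicator) (auto simp: sets)
      also have "(\<lambda>x. y - x) -` C = (\<lambda>x. - y + x) -` (uminus -` C)"
        by auto
      also have "emeasure M \<dots> = emeasure M (uminus -` C)"
        using refl[OF C, of 0] by (intro inv) simp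
      finally show "(\<integral>\<^sup>+ x. ?i C (y - x) * ?i A y \<partial>M) = emeasure M (uminus -` C) * ?i A y"
        by (simp add: mult.commute)
    qed
    also have "\<dots> = emeasure lborel A * emeasure M (uminus -` C)"
      by (subst nn_integral_cmult_indicator) (auto simp: mult.commute)
    finally show ?thesis .
  qed
  let ?C = "ball (0::'a) (real 1)"
  let ?v = "emeasure lborel ?C"
  have C: "uminus -` ?C = ?C" by auto
  have v: "0 < ?v" "?v < \<infinity>"
    using content_ball_pos[of 1 "0::'a"] emeasure_lborel_ball_finite[of "0::'a" 1]
    by (auto simp: emeasure_eq_ennreal_measure)
  show thesis
  proof
    show "emeasure M ?C / ?v < \<infinity>"
      using v fin[of 1]
      by (simp add: top.not_eq_extremum[symmetric] ennreal_divide_eq_top_iff zero_less_iff_neq_zero)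
    show "emeasure M A = emeasure M ?C / ?v * emeasure lborel A" if "A \<in> sets borel" for A
    proof -
      have "emeasure M A * ?v = emeasure lborel A * emeasure M ?C"
        using key[OF that, of ?C] C by simp
      then have "emeasure M A * ?v / ?v = emeasure lborel A * emeasure M ?C / ?v"
        by simp
      moreover have "emeasure M A * ?v / ?v = emeasure M A"
        using v by (intro mult_divide_eq_ennreal) auto
      ultimately show ?thesis
        by (simp add: ennreal_times_divide mult.commute)
    qed
  qed
qed

lemma hausdorff_premeasure_le_finite:
  assumes I: "finite I" and A: "A \<subseteq> (\<Union>i\<in>I. C i)" "\<And>i. i \<in> I \<Longrightarrow> ediam d (C i) \<le> \<delta>"
  shows "hausdorff_premeasure d m \<delta> A \<le> (\<Sum>i\<in>I. hausdorff_weight d m (C i))"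
proof -
  obtain b where b: "bij_betw b {0..<card I} I"
    using ex_bij_betw_nat_finite[OF I] by auto
  define D where "D k = (if k < card I then C (b k) else {})" for k
  have "hausdorff_premeasure d m \<delta> A \<le> (\<Sum>k. hausdorff_weight d m (D k))"
  proof (rule hausdorff_premeasure_le)
    show "A \<subseteq> (\<Union>k. D k)"
    proof
      fix x assume "x \<in> A"
      then obtain i where i: "i \<in> I" "x \<in> C i" using A(1) by blast
      then have "i \<in> b ` {0..<card I}" using bij_betw_imp_surj_on[OF b] by simp
      then obtain k where "k < card I" "b k = i" by auto
      then have "x \<in> D k" using i by (simp add: D_def)
      then show "x \<in> (\<Union>k. D k)" by blast
    qed
    show "ediam d (D k) \<le> \<delta>" for k
    proof (cases "k < card I")
      case True
      then have "b k \<in> I" using bij_betwE[OF b] by simp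
      then show ?thesis using True A(2) by (simp add: D_def)
    qed (simp add: D_def)
  qed
  also have "\<dots> = (\<Sum>k\<in>{0..<card I}. hausdorff_weight d m (D k))"
    by (rule suminf_finite) (auto simp: D_def)
  also have "\<dots> = (\<Sum>k\<in>{0..<card I}. hausdorff_weight d m (C (b k)))"
    by (auto simp: D_def)
  also have "\<dots> = (\<Sum>i\<in>I. hausdorff_weight d m (C i))"
    by (rule sum.reindex_bij_betw[OF b])
  finally show ?thesis .
qed

text \<open>
  The distance in the form in which the Hausdorff measure expects it.
\<close>

definition edist :: "'a::metric_space \<Rightarrow> 'a \<Rightarrow> ennreal" where
  "edist x y = ennreal (dist x y)"

lemma compactly_separating_edist: "compactly_separating edist"
  unfolding compactly_separating_def edist_def
  by (metis ennreal_leI ennreal_less_zero_iff)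

abbreviation hausdorff_cart :: "(real ^ 'p::finite) set \<Rightarrow> ennreal" where
  "hausdorff_cart \<equiv> hausdorff_outer edist CARD('p)"

text \<open>
  The grid of mesh \<open>1 / N\<close> covers the cube by \<open>N ^ p\<close> cubes of diameter at most \<open>p / N\<close>, where
  \<open>p = CARD('p)\<close>; their weights add up to a bound that is the same for all \<open>N\<close>.
\<close>

lemma hausdorff_cart_cube_finite:
  fixes Q :: "(real ^ 'p::finite) set"
  assumes Q: "\<And>x i. x \<in> Q \<Longrightarrow> 0 \<le> x $ i \<and> x $ i < 1"
  shows "hausdorff_cart Q < \<infinity>"
proof -
  let ?p = "CARD('p)"
  let ?c = "unit_ball_vol (real ?p) / 2 ^ ?p * real ?p ^ ?p"
  have "hausdorff_cart Q \<le> ennreal ?c"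
  proof (rule hausdorff_outer_least)
    fix \<delta> :: ennreal assume "0 < \<delta>"
    then obtain r where r: "r > 0" "ennreal r < \<delta>"
    proof -
      obtain q where q: "0 < q" "q < \<delta>" using dense[OF \<open>0 < \<delta>\<close>] by blast
      have "q < top" using less_le_trans[OF q(2) top_greatest] .
      then have "0 < enn2real q" "ennreal (enn2real q) = q" using q(1) by (auto simp: enn2real_positive_iff)
      then show ?thesis using q(2) that[of "enn2real q"] by simp
    qed
    obtain N :: nat where N: "N > 0" "real ?p / real N < r"
    proof -
      obtain N :: nat where "real ?p / r < real N" using reals_Archimedean2 by blast
      moreover have "real ?p / r > 0" using r by simp
      ultimately have "0 < real N" by linarith
      moreover have "real ?p < real N * r" using \<open>real ?p / r < real N\<close> r by (simp add: pos_divide_less_eq)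
      ultimately have "N > 0" "real ?p / real N < r"
        by (simp_all add: pos_divide_less_eq mult.commute)
      then show thesis by (rule that)
    qed
    define I where "I = PiE (UNIV :: 'p set) (\<lambda>_. {..<N})"
    define C where "C z = {x :: real ^ 'p. \<forall>i. real (z i) / N \<le> x $ i \<and> x $ i \<le> (real (z i) + 1) / N}" for z
    have "finite I" by (simp add: I_def finite_PiE)
    have card: "card I = N ^ ?p" by (simp add: I_def card_PiE)
    have diam: "ediam edist (C z) \<le> ennreal (real ?p / N)" for z
    proof (rule ediam_least)
      fix x y assume x: "x \<in> C z" and y: "y \<in> C z"
      have "dist x y \<le> (\<Sum>i\<in>UNIV. \<bar>(x - y) $ i\<bar>)"
        unfolding dist_norm by (rule norm_le_l1_cart)
      also have "\<dots> \<le> (\<Sum>i\<in>(UNIV::'p set). 1 / N)"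
      proof (rule sum_mono)
        fix i
        have "real (z i) / N \<le> x $ i \<and> x $ i \<le> (real (z i) + 1) / N"
             "real (z i) / N \<le> y $ i \<and> y $ i \<le> (real (z i) + 1) / N"
          using x y by (auto simp: C_def)
        then show "\<bar>(x - y) $ i\<bar> \<le> 1 / N"
          unfolding add_divide_distrib vector_minus_component abs_le_iff by linarith
      qed
      also have "\<dots> = real ?p / N" by simp
      finally show "edist x y \<le> ennreal (real ?p / N)" by (simp add: edist_def ennreal_leI)
    qed
    have "Q \<subseteq> (\<Union>z\<in>I. C z)"
    proof
      fix x assume x: "x \<in> Q"
      define z where "z i = nat \<lfloor>real N * x $ i\<rfloor>" for i
      have "z i < N" for i
      proof -
        have "real N * x $ i < real N" using Q[OF x] N by simp
        then have "\<lfloor>real N * x $ i\<rfloor> < int N" by (simp add: floor_less_iff)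
        then show ?thesis using N unfolding z_def by linarith
      qed
      moreover have "x \<in> C z"
      proof -
        have "real (z i) \<le> real N * x $ i \<and> real N * x $ i \<le> real (z i) + 1" for i
          using Q[OF x, of i] N unfolding z_def
          by simp
        then have "real (z i) / N \<le> x $ i \<and> x $ i \<le> (real (z i) + 1) / N" for i
          using N by (simp add: pos_divide_le_eq pos_le_divide_eq mult.commute)
        then show ?thesis by (simp add: C_def)
      qed
      ultimately show "x \<in> (\<Union>z\<in>I. C z)" by (auto simp: I_def)
    qed
    then have "hausdorff_premeasure edist ?p \<delta> Q \<le> (\<Sum>z\<in>I. hausdorff_weight edist ?p (C z))"
    proof (rule hausdorff_premeasure_le_finite[OF \<open>finite I\<close>])
      have "ennreal (real ?p / N) \<le> \<delta>"
        using ennreal_leI[OF less_imp_le[OF N(2)]] less_imp_le[OF r(2)] by (rule order_trans)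
      then show "ediam edist (C z) \<le> \<delta>" for z by (rule order_trans[OF diam])
    qed
    also have "\<dots> \<le> (\<Sum>z\<in>I. ennreal (unit_ball_vol (real ?p) / 2 ^ ?p * (real ?p / N) ^ ?p))"
    proof (rule sum_mono)
      fix z
      have "hausdorff_weight edist ?p (C z) \<le> ennreal (unit_ball_vol (real ?p) / 2 ^ ?p) * ediam edist (C z) ^ ?p"
        by (simp add: hausdorff_weight_def)
      also have "\<dots> \<le> ennreal (unit_ball_vol (real ?p) / 2 ^ ?p) * ennreal (real ?p / N) ^ ?p"
        by (intro mult_left_mono power_mono diam) auto
      also have "\<dots> = ennreal (unit_ball_vol (real ?p) / 2 ^ ?p * (real ?p / N) ^ ?p)"
        by (simp add: ennreal_power ennreal_mult[symmetric] unit_ball_vol_nonneg)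
      finally show "hausdorff_weight edist ?p (C z) \<le> ennreal (unit_ball_vol (real ?p) / 2 ^ ?p * (real ?p / N) ^ ?p)" .
    qed
    also have "\<dots> = ennreal (\<Sum>z\<in>I. unit_ball_vol (real ?p) / 2 ^ ?p * (real ?p / N) ^ ?p)"
      by (rule sum_ennreal) (simp add: unit_ball_vol_nonneg)
    also have "(\<Sum>z\<in>I. unit_ball_vol (real ?p) / 2 ^ ?p * (real ?p / N) ^ ?p) = ?c"
      using N by (simp add: card power_divide)
    finally show "hausdorff_premeasure edist ?p \<delta> Q \<le> ennreal ?c" .
  qed
  then show ?thesis by (rule order.strict_trans1) simp
qed

lemma hausdorff_outer_edist_isometry:
  assumes "\<And>x y. dist (f x) (f y) = dist x y"
  shows "hausdorff_outer edist m (f ` A) = hausdorff_outer edist m A"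
proof (rule antisym)
  show "hausdorff_outer edist m (f ` A) \<le> hausdorff_outer edist m A"
    using hausdorff_outer_Lipschitz_image[of 1 A edist f edist m] by (simp add: edist_def assms)
  have "hausdorff_outer edist m (inv f ` f ` A) \<le> ennreal (1 ^ m) * hausdorff_outer edist m (f ` A)"
  proof (rule hausdorff_outer_Lipschitz_image)
    have inj: "inj f" by (metis assms dist_eq_0_iff injI)
    fix x y assume "x \<in> f ` A" "y \<in> f ` A"
    then show "edist (inv f x) (inv f y) \<le> ennreal 1 * edist x y"
      using inj by (auto simp: edist_def assms)
  qed simp
  moreover have "inv f ` f ` A = A"
    by (metis assms dist_eq_0_iff image_inv_f_f injI)
  ultimately show "hausdorff_outer edist m A \<le> hausdorff_outer edist m (f ` A)" by simp
qed

lemma hausdorff_cart_ball_finite: "hausdorff_cart (ball (0 :: real ^ 'p::finite) r) < \<infinity>"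
proof (cases "r > 0")
  case r: True
  let ?Q = "{x :: real ^ 'p. \<forall>i. 0 \<le> x $ i \<and> x $ i < 1}" and ?f = "\<lambda>x. (2 * r) *\<^sub>R x - (\<chi> i. r)"
  \<comment> \<open>The map \<open>?f\<close> takes the half-open unit cube to the cube with side \<open>2 * r\<close> centred at \<open>0\<close>.\<close>
  have "ball 0 r \<subseteq> ?f ` ?Q"
  proof
    fix x :: "real ^ 'p" assume "x \<in> ball 0 r"
    then have x: "\<bar>x $ i\<bar> < r" for i using component_le_norm_cart[of x i] by simp
    have "x = ?f ((1 / (2 * r)) *\<^sub>R (x + (\<chi> i. r)))" using r by (simp add: vec_eq_iff)
    moreover have "(1 / (2 * r)) *\<^sub>R (x + (\<chi> i. r)) \<in> ?Q"
    proof -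
      have "0 \<le> x $ i + r \<and> x $ i + r < 2 * r" for i using x[of i] by (auto simp: abs_less_iff)
      then show ?thesis using r by (auto simp: field_simps)
    qed
    ultimately show "x \<in> ?f ` ?Q" by blast
  qed
  then have "hausdorff_cart (ball (0 :: real ^ 'p) r) \<le> hausdorff_cart (?f ` ?Q)"
    by (rule hausdorff_outer_mono)
  also have "\<dots> \<le> ennreal ((2 * r) ^ CARD('p)) * hausdorff_cart ?Q"
  proof (rule hausdorff_outer_Lipschitz_image)
    fix x y :: "real ^ 'p"
    have "?f x - ?f y = (2 * r) *\<^sub>R (x - y)" by (simp add: scaleR_diff_right)
    then have "dist (?f x) (?f y) = \<bar>2 * r\<bar> * norm (x - y)" by (simp only: dist_norm norm_scaleR)
    then show "edist (?f x) (?f y) \<le> ennreal (2 * r) * edist x y"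
      using r by (simp add: edist_def ennreal_mult dist_norm)
  qed (use r in simp)
  also have "\<dots> < \<infinity>"
    using hausdorff_cart_cube_finite[of ?Q] by (simp add: ennreal_mult_less_top)
  finally show ?thesis .
next
  case False
  then have *: "ball (0 :: real ^ 'p) r = {}" by simp
  show ?thesis unfolding * by simp
qed

text \<open>
  Translations are isometries, so the uniqueness of translation invariant measures applies.
\<close>

lemma hausdorff_cart_eq_lborel:
  obtains k where "k < \<infinity>"
    "\<And>A :: (real ^ 'p::finite) set. A \<in> sets borel \<Longrightarrow> hausdorff_cart A = k * emeasure lborel A"
proof -
  let ?M = "hausdorff_measure edist CARD('p) :: (real ^ 'p) measure"
  note em = emeasure_hausdorff_measure[OF compactly_separating_edist]
  have fin: "emeasure ?M (ball 0 (real n)) < \<infinity>" for n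
    by (simp only: em open_ball borel_open hausdorff_cart_ball_finite)
  have inv: "emeasure ?M ((\<lambda>x. a + x) -` A) = emeasure ?M A" if A: "A \<in> sets borel" for a A
  proof -
    have "(\<lambda>x. a + x) -` A \<in> sets borel"
      using measurable_sets_borel[of "\<lambda>x. a + x" borel A] A by simp
    moreover have "(\<lambda>x. a + x) -` A = (\<lambda>x. - a + x) ` A" by force
    ultimately show ?thesis
      using A hausdorff_outer_edist_isometry[of "\<lambda>x. - a + x" "CARD('p)" A]
      by (simp only: em dist_add_cancel)
  qed
  obtain k where "k < \<infinity>" "\<And>A. A \<in> sets borel \<Longrightarrow> emeasure ?M A = k * emeasure lborel A"
    by (rule translation_invariant_measure_unique[OF sets_hausdorff_measure fin]) (rule inv, assumption, rule that)
  then show thesis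
    by (intro that[of k]) (simp_all add: em)
qed


section \<open>Lebesgue measure of linear images\<close>

lemma matrix_image_eq_vimage:
  fixes A :: "real ^ 'p::finite ^ 'p"
  assumes "det A \<noteq> 0"
  shows "(*v) A ` F = (*v) (matrix_inv A) -` F"
proof -
  have inv: "invertible A" using assms by (simp add: invertible_det_nz)
  have "A ** matrix_inv A = mat 1 \<and> matrix_inv A ** A = mat 1"
    using inv unfolding invertible_def matrix_inv_def by (rule someI_ex)
  then have 1: "matrix_inv A *v (A *v x) = x" and 2: "A *v (matrix_inv A *v x) = x" for x
    by (simp_all add: matrix_vector_mul_assoc)
  show ?thesis
  proof (intro set_eqI iffI)
    fix x assume "x \<in> (*v) (matrix_inv A) -` F"
    then show "x \<in> (*v) A ` F" using 2[of x] by (metis imageI vimageE)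
  qed (auto simp: 1)
qed

lemma borel_matrix_image:
  fixes A :: "real ^ 'p::finite ^ 'p"
  assumes "det A \<noteq> 0" "F \<in> sets borel"
  shows "(*v) A ` F \<in> sets borel"
proof -
  have "(*v) (matrix_inv A) \<in> borel_measurable borel"
    by (intro borel_measurable_continuous_onI linear_continuous_on linear_conv_bounded_linear[THEN iffD1]
        matrix_vector_mul_linear)
  then show ?thesis
    using measurable_sets_borel[of "(*v) (matrix_inv A)" borel F] assms by (simp add: matrix_image_eq_vimage)
qed

text \<open>
  The measure \<open>F \<mapsto> lborel (A F)\<close> is again translation invariant.
\<close>

lemma lborel_matrix_image_scale:
  fixes A :: "real ^ 'p::finite ^ 'p"
  assumes A: "det A \<noteq> 0"
  obtains k where "\<And>F. F \<in> sets borel \<Longrightarrow> emeasure lborel ((*v) A ` F) = k * emeasure lborel F"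
proof -
  have meas [measurable]: "(*v) (matrix_inv A) \<in> borel_measurable borel"
    by (intro borel_measurable_continuous_onI linear_continuous_on linear_conv_bounded_linear[THEN iffD1]
        matrix_vector_mul_linear)
  define M where "M = distr lborel borel ((*v) (matrix_inv A))"
  have sets: "sets M = sets borel" by (simp add: M_def)
  have M: "emeasure M F = emeasure lborel ((*v) A ` F)" if "F \<in> sets borel" for F
    using that unfolding M_def by (subst emeasure_distr) (auto simp: matrix_image_eq_vimage[OF A])
  have fin: "emeasure M (ball 0 (real n)) < \<infinity>" for n
  proof -
    have "bounded ((*v) A ` ball 0 (real n))"
      by (intro bounded_linear_image linear_conv_bounded_linear[THEN iffD1] matrix_vector_mul_linear) simp
    then obtain a b where "(*v) A ` ball 0 (real n) \<subseteq> cbox a b"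
      by (metis bounded_subset_cbox_symmetric)
    then have "emeasure lborel ((*v) A ` ball 0 (real n)) \<le> emeasure lborel (cbox a b)"
      by (intro emeasure_mono) auto
    also have "\<dots> < \<infinity>" by (rule emeasure_lborel_cbox_finite)
    finally show ?thesis by (simp add: M)
  qed
  have inv: "emeasure M ((\<lambda>x. a + x) -` F) = emeasure M F" if F: "F \<in> sets borel" for a F
  proof -
    have F': "(\<lambda>x. a + x) -` F \<in> sets borel"
      using measurable_sets_borel[of "\<lambda>x. a + x" borel F] F by simp
    have AF: "(*v) A ` F \<in> sets borel" by (rule borel_matrix_image[OF A F])
    have "(*v) A ` ((\<lambda>x. a + x) -` F) = (\<lambda>x. A *v a + x) -` ((*v) A ` F)"
    proof (intro set_eqI iffI)
      fix y assume "y \<in> (\<lambda>x. A *v a + x) -` ((*v) A ` F)"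
      then obtain z where z: "z \<in> F" "A *v a + y = A *v z" by auto
      then have "y = A *v (z - a)" by (simp add: matrix_vector_mult_diff_distrib algebra_simps)
      moreover have "z - a \<in> (\<lambda>x. a + x) -` F" using z by simp
      ultimately show "y \<in> (*v) A ` ((\<lambda>x. a + x) -` F)" by blast
    qed (auto simp flip: matrix_vector_right_distrib)
    then have "emeasure M ((\<lambda>x. a + x) -` F) = emeasure lborel ((\<lambda>x. A *v a + x) -` ((*v) A ` F))"
      by (simp only: M[OF F'])
    also have "\<dots> = emeasure (distr lborel borel ((+) (A *v a))) ((*v) A ` F)"
      using AF by (subst emeasure_distr) auto
    finally show ?thesis by (simp only: lborel_distr_plus M[OF F])
  qed
  show thesis
    by (rule translation_invariant_measure_unique[OF sets fin])
       (rule inv, assumption, rule that, simp only: M)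
qed

text \<open>
  The scale factor \<open>k\<close> of an involution satisfies \<open>k * k = 1\<close>, and so does its determinant.
\<close>

lemma emeasure_lborel_involution:
  fixes A :: "real ^ 'p::finite ^ 'p"
  assumes A: "\<And>x. A *v (A *v x) = x" and F: "F \<in> sets borel"
  shows "emeasure lborel ((*v) A ` F) = ennreal \<bar>det A\<bar> * emeasure lborel F"
proof -
  have "A ** A = mat 1" by (simp add: matrix_eq A flip: matrix_vector_mul_assoc)
  then have "det A * det A = 1" by (metis det_I det_mul)
  then have nz: "det A \<noteq> 0" and det: "\<bar>det A\<bar> = 1"
    by (auto simp: power2_eq_1_iff simp flip: power2_eq_square)
  obtain k where k: "\<And>F. F \<in> sets borel \<Longrightarrow> emeasure lborel ((*v) A ` F) = k * emeasure lborel F"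
    using lborel_matrix_image_scale[OF nz] by metis
  let ?B = "ball (0 :: real ^ 'p) 1"
  have ball: "emeasure lborel ?B \<noteq> 0" "emeasure lborel ?B \<noteq> top"
    using content_ball_pos[of 1 "0 :: real ^ 'p"] emeasure_lborel_ball_finite[of "0 :: real ^ 'p" 1]
    by (auto simp: emeasure_eq_ennreal_measure)
  have "emeasure lborel ((*v) A ` (*v) A ` ?B) = k * (k * emeasure lborel ?B)"
    by (simp add: k borel_matrix_image[OF nz])
  moreover have "(*v) A ` (*v) A ` ?B = ?B" by (simp add: image_image A)
  ultimately have "(k * k) * emeasure lborel ?B / emeasure lborel ?B = emeasure lborel ?B / emeasure lborel ?B"
    by (simp add: mult.assoc)
  then have kk: "k * k = 1" using ball by (simp add: mult_divide_eq_ennreal top.not_eq_extremum)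
  have "k = 1"
  proof (cases k)
    case (real r)
    then have "ennreal (r * r) = ennreal 1" using kk by (simp add: ennreal_mult)
    then have "r * r = 1" using real by (subst (asm) ennreal_inj) auto
    then show ?thesis using real by (metis abs_of_nonneg abs_mult_self_eq ennreal_1 real_sqrt_abs2 real_sqrt_one)
  qed (use kk in simp)
  then show "emeasure lborel ((*v) A ` F) = ennreal \<bar>det A\<bar> * emeasure lborel F"
    using k[OF F] det by simp
qed

text \<open>
  By decomposition into elementary matrices.  For a diagonal matrix the scale factor is read off
  from the image of a cube.  Transpositions are involutions, and a shear is the product of two
  involutions, a coordinate reflection and the reflected shear.
\<close>

lemma emeasure_lborel_matrix_image:
  fixes A :: "real ^ 'p::finite ^ 'p"
  assumes "det A \<noteq> 0" "F \<in> sets borel"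
  shows "emeasure lborel ((*v) A ` F) = ennreal \<bar>det A\<bar> * emeasure lborel F"
proof -
  let ?P = "\<lambda>A :: real ^ 'p ^ 'p. det A \<noteq> 0 \<longrightarrow>
     (\<forall>F\<in>sets borel. emeasure lborel ((*v) A ` F) = ennreal \<bar>det A\<bar> * emeasure lborel F)"
  have mult: "?P (A ** B)" if P: "?P A" "?P B" for A B :: "real ^ 'p ^ 'p"
  proof (intro impI ballI)
    fix F :: "(real ^ 'p) set" assume nz: "det (A ** B) \<noteq> 0" and F: "F \<in> sets borel"
    then have nzA: "det A \<noteq> 0" and nzB: "det B \<noteq> 0" by (auto simp: det_mul)
    have "(*v) (A ** B) ` F = (*v) A ` ((*v) B ` F)"
      by (simp add: image_image matrix_vector_mul_assoc)
    then show "emeasure lborel ((*v) (A ** B) ` F) = ennreal \<bar>det (A ** B)\<bar> * emeasure lborel F"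
      using P nzA nzB F borel_matrix_image[OF nzB F]
      by (simp add: det_mul abs_mult ennreal_mult mult.assoc)
  qed
  have "?P A"
  proof (rule induct_matrix_elementary)
    show "?P (A ** B)" if P: "?P A" "?P B" for A B :: "real ^ 'p ^ 'p"
      using that by (rule mult)
  next
    fix A :: "real ^ 'p ^ 'p" and i assume "row i A = 0"
    then show "?P A" by (simp add: det_zero_row)
  next
    fix A :: "real ^ 'p ^ 'p" assume diag: "\<And>i j. i \<noteq> j \<Longrightarrow> A $ i $ j = 0"
    show "?P A"
    proof (intro impI ballI)
      fix F :: "(real ^ 'p) set" assume nz: "det A \<noteq> 0" and F: "F \<in> sets borel"
      have det: "det A = (\<Prod>i\<in>UNIV. A $ i $ i)" using diag by (rule det_diagonal)
      obtain k where k: "\<And>F. F \<in> sets borel \<Longrightarrow> emeasure lborel ((*v) A ` F) = k * emeasure lborel F"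
        using lborel_matrix_image_scale[OF nz] by metis
      have Av: "(A *v x) $ i = A $ i $ i * x $ i" for x i
      proof -
        have "(A *v x) $ i = (\<Sum>j\<in>UNIV. A $ i $ j * x $ j)" by (simp add: matrix_vector_mult_def)
        also have "\<dots> = (\<Sum>j\<in>UNIV. if j = i then A $ i $ i * x $ i else 0)"
          by (rule sum.cong) (simp_all add: diag)
        finally have "(A *v x) $ i = (\<Sum>j\<in>UNIV. if j = i then A $ i $ i * x $ i else 0)" .
        then show ?thesis by simp
      qed
      have nz': "A $ i $ i \<noteq> 0" for i using nz unfolding det by simp
      define b :: "real ^ 'p" where "b = (\<chi> i. \<bar>A $ i $ i\<bar>)"
      have "(*v) A ` cbox (- 1) 1 = cbox (- b) b"
      proof (intro set_eqI iffI)
        fix y assume "y \<in> cbox (- b) b"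
        then have y: "\<bar>y $ i\<bar> \<le> \<bar>A $ i $ i\<bar>" for i by (auto simp: mem_box_cart b_def abs_le_iff minus_le_iff)
        let ?x = "\<chi> i. y $ i / A $ i $ i"
        have "y = A *v ?x" by (simp add: vec_eq_iff Av nz')
        moreover have "?x \<in> cbox (- 1) 1"
        proof -
          have "\<bar>y $ i / A $ i $ i\<bar> \<le> 1" for i using y[of i] nz'[of i] by (simp add: abs_divide)
          then have "- 1 \<le> y $ i / A $ i $ i \<and> y $ i / A $ i $ i \<le> 1" for i by (metis abs_le_iff minus_le_iff)
          then show ?thesis by (simp add: mem_box_cart)
        qed
        ultimately show "y \<in> (*v) A ` cbox (- 1) 1" by blast
      next
        fix y assume "y \<in> (*v) A ` cbox (- 1) 1"
        then obtain x where x: "y = A *v x" "\<And>i. \<bar>x $ i\<bar> \<le> 1"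
          by (auto simp: mem_box_cart abs_le_iff minus_le_iff)
        have "\<bar>y $ i\<bar> \<le> \<bar>A $ i $ i\<bar>" for i
          using mult_left_mono[OF x(2)[of i], of "\<bar>A $ i $ i\<bar>"] by (simp add: x(1) Av abs_mult)
        then show "y \<in> cbox (- b) b" by (simp add: mem_box_cart b_def abs_le_iff minus_le_iff)
      qed
      moreover have vol: "emeasure lborel (cbox (- a) a) = ennreal (\<Prod>i\<in>UNIV. 2 * a $ i)"
        if "\<And>i. 0 \<le> a $ i" for a :: "real ^ 'p"
      proof -
        have ne: "cbox (- a) a \<noteq> {}" unfolding interval_ne_empty_cart using that by (simp add: minus_le_iff add_nonneg_nonneg)
        have "emeasure lborel (cbox (- a) a) = ennreal (measure lborel (cbox (- a) a))"
          using emeasure_lborel_cbox_finite[of "- a" a] by (intro emeasure_eq_ennreal_measure) auto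
        then show ?thesis by (simp add: content_cbox_cart[OF ne])
      qed
      ultimately have "ennreal (\<Prod>i\<in>UNIV. 2 * b $ i) = k * ennreal (\<Prod>i\<in>(UNIV::'p set). 2)"
        using k[of "cbox (- 1) 1"] vol[of b] vol[of 1] by (simp add: b_def)
      moreover have "(\<Prod>i\<in>UNIV. 2 * b $ i) = \<bar>det A\<bar> * (\<Prod>i\<in>(UNIV::'p set). 2)"
        by (simp add: b_def det prod.distrib abs_prod)
      ultimately have "k * ennreal (2 ^ CARD('p)) = ennreal \<bar>det A\<bar> * ennreal (2 ^ CARD('p))"
        by (simp add: ennreal_mult)
      then have "k * ennreal (2 ^ CARD('p)) / ennreal (2 ^ CARD('p)) = ennreal \<bar>det A\<bar> * ennreal (2 ^ CARD('p)) / ennreal (2 ^ CARD('p))"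
        by (rule arg_cong)
      moreover have "c * ennreal (2 ^ CARD('p)) / ennreal (2 ^ CARD('p)) = c" for c
        by (rule mult_divide_eq_ennreal) auto
      ultimately have "k = ennreal \<bar>det A\<bar>" by (simp only:)
      then show "emeasure lborel ((*v) A ` F) = ennreal \<bar>det A\<bar> * emeasure lborel F"
        using k[OF F] by simp
    qed
  next
    fix m n :: 'p assume "m \<noteq> n"
    let ?A = "(\<chi> i j. mat 1 $ i $ Transposition.transpose m n j) :: real ^ 'p ^ 'p"
    have Av: "?A *v x = (\<chi> i. x $ Transposition.transpose m n i)" for x
    proof (rule vec_eq_iff[THEN iffD2], rule)
      fix i
      have "i = Transposition.transpose m n j \<longleftrightarrow> j = Transposition.transpose m n i" for j
        by (metis transpose_involutory)
      then have "(?A *v x) $ i = (\<Sum>j\<in>UNIV. if j = Transposition.transpose m n i then x $ j else 0)"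
        unfolding matrix_vector_mult_def by (simp add: mat_def if_distrib[of "\<lambda>c. c * _"] cong: if_cong)
      then show "(?A *v x) $ i = (\<chi> i. x $ Transposition.transpose m n i) $ i" by simp
    qed
    show "?P ?A"
      by (intro impI ballI emeasure_lborel_involution) (simp_all add: Av)
  next
    fix m n :: 'p and c :: real assume mn: "m \<noteq> n"
    let ?A = "(\<chi> i j. if i = m \<and> j = n then c else of_bool (i = j)) :: real ^ 'p ^ 'p"
    let ?R = "(\<chi> i j. if i = j then (if i = m then - 1 else 1) else 0) :: real ^ 'p ^ 'p"
    have Av: "?A *v x = (\<chi> i. x $ i + (if i = m then c * x $ n else 0))" for x
    proof (rule vec_eq_iff[THEN iffD2], rule)
      fix i
      have "(?A *v x) $ i = (\<Sum>j\<in>UNIV. ?A $ i $ j * x $ j)" by (simp only: matrix_vector_mult_def vec_lambda_beta)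
      also have "\<dots> = (\<Sum>j\<in>UNIV. (if j = i then x $ j else 0) + (if j = n then (if i = m then c * x $ j else 0) else 0))"
        by (rule sum.cong) (use mn in auto)
      finally have "(?A *v x) $ i = (\<Sum>j\<in>UNIV. (if j = i then x $ j else 0) + (if j = n then (if i = m then c * x $ j else 0) else 0))" .
      then show "(?A *v x) $ i = (\<chi> i. x $ i + (if i = m then c * x $ n else 0)) $ i"
        by (simp add: sum.distrib)
    qed
    have Rv: "?R *v x = (\<chi> i. if i = m then - x $ i else x $ i)" for x
    proof (rule vec_eq_iff[THEN iffD2], rule)
      fix i
      have "(?R *v x) $ i = (\<Sum>j\<in>UNIV. ?R $ i $ j * x $ j)" by (simp only: matrix_vector_mult_def vec_lambda_beta)
      also have "\<dots> = (\<Sum>j\<in>UNIV. if j = i then (if i = m then - x $ i else x $ i) else 0)"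
        by (rule sum.cong) auto
      finally have "(?R *v x) $ i = (\<Sum>j\<in>UNIV. if j = i then (if i = m then - x $ i else x $ i) else 0)" .
      then show "(?R *v x) $ i = (\<chi> i. if i = m then - x $ i else x $ i) $ i" by simp
    qed
    \<comment> \<open>The reflection \<open>?R\<close> in coordinate \<open>m\<close> and \<open>?R ** ?A\<close> are involutions, and \<open>?A\<close> is their product.\<close>
    have "?P ?R"
      by (intro impI ballI emeasure_lborel_involution) (simp_all add: Rv vec_eq_iff)
    moreover have "?P (?R ** ?A)"
      by (intro impI ballI emeasure_lborel_involution)
         (use mn in \<open>simp_all add: Rv Av vec_eq_iff flip: matrix_vector_mul_assoc\<close>)
    ultimately have "?P (?R ** (?R ** ?A))" by (rule mult)
    moreover have "?R ** (?R ** ?A) = ?A"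
      by (simp add: matrix_eq Rv vec_eq_iff flip: matrix_vector_mul_assoc)
    ultimately show "?P ?A" by simp
  qed
  then show ?thesis using assms by blast
qed

lemma hausdorff_cart_matrix_image:
  fixes A :: "real ^ 'p::finite ^ 'p"
  assumes "det A \<noteq> 0" "F \<in> sets borel"
  shows "hausdorff_cart ((*v) A ` F) = ennreal \<bar>det A\<bar> * hausdorff_cart F"
proof -
  obtain k where "\<And>A :: (real ^ 'p) set. A \<in> sets borel \<Longrightarrow> hausdorff_cart A = k * emeasure lborel A"
    using hausdorff_cart_eq_lborel[where 'p = 'p] by metis
  then show ?thesis
    using assms by (simp add: borel_matrix_image emeasure_lborel_matrix_image mult.left_commute)
qed


section \<open>Scalar products, frames and Gram determinants\<close>

definition inner_product :: "('a::real_vector \<Rightarrow> 'a \<Rightarrow> real) \<Rightarrow> bool" where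
  "inner_product h \<longleftrightarrow> bilinear h \<and> (\<forall>v w. h v w = h w v) \<and> (\<forall>v. v \<noteq> 0 \<longrightarrow> h v v > 0)"

lemma inner_product_simps:
  assumes "inner_product h"
  shows "h (u + v) w = h u w + h v w" "h w (u + v) = h w u + h w v"
    and "h (c *\<^sub>R u) w = c * h u w" "h w (c *\<^sub>R u) = c * h w u"
    and "h (u - v) w = h u w - h v w" "h w (u - v) = h w u - h w v"
    and "h 0 w = 0" "h w 0 = 0"
  using assms
  by (auto simp: inner_product_def bilinear_ladd bilinear_radd bilinear_lmul bilinear_rmul
      bilinear_lsub bilinear_rsub bilinear_lzero bilinear_rzero)

lemma inner_product_sum:
  assumes "inner_product h"
  shows "h (sum f A) w = (\<Sum>a\<in>A. h (f a) w)" "h w (sum f A) = (\<Sum>a\<in>A. h w (f a))"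
  using assms unfolding inner_product_def bilinear_def
  by (auto intro: linear_sum[of "\<lambda>x. h x w"] linear_sum[of "h w"])

definition orthonormal :: "('a::real_vector \<Rightarrow> 'a \<Rightarrow> real) \<Rightarrow> 'a ^ 'p::finite \<Rightarrow> bool" where
  "orthonormal h t \<longleftrightarrow> (\<forall>a b. h (t $ a) (t $ b) = (if a = b then 1 else 0))"

lemma orthonormal_expansion:
  assumes h: "inner_product h" and t: "orthonormal h t" and v: "v \<in> span (range (\<lambda>a. t $ a))"
  shows "v = (\<Sum>a\<in>UNIV. h v (t $ a) *\<^sub>R t $ a)"
  using v
proof (induction rule: span_induct_alt)
  case base
  show ?case by (simp add: inner_product_simps[OF h])
next
  case (step c x y)
  then obtain b where b: "x = t $ b" by auto
  have "(\<Sum>a\<in>UNIV. h (t $ b) (t $ a) *\<^sub>R t $ a) = (\<Sum>a\<in>UNIV. if a = b then t $ b else 0)"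
    using t by (intro sum.cong) (auto simp: orthonormal_def)
  then have x: "(\<Sum>a\<in>UNIV. h x (t $ a) *\<^sub>R t $ a) = x" by (simp add: b)
  have "(\<Sum>a\<in>UNIV. h (c *\<^sub>R x + y) (t $ a) *\<^sub>R t $ a) =
      c *\<^sub>R (\<Sum>a\<in>UNIV. h x (t $ a) *\<^sub>R t $ a) + (\<Sum>a\<in>UNIV. h y (t $ a) *\<^sub>R t $ a)"
    by (simp add: inner_product_simps[OF h] scaleR_add_left sum.distrib scaleR_sum_right)
  then show ?case using x step by simp
qed

text \<open>
  Gram-Schmidt: normalize the part of a new vector that is orthogonal to the vectors found so far.
\<close>

lemma orthonormal_set_exists:
  fixes T :: "'a::euclidean_space set"
  assumes h: "inner_product h" and T: "subspace T"
  shows "n \<le> dim T \<Longrightarrow> \<exists>B\<subseteq>T. finite B \<and> card B = n \<and> (\<forall>u\<in>B. \<forall>v\<in>B. h u v = (if u = v then 1 else 0))"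
proof (induction n)
  case 0
  show ?case by (intro exI[of _ "{}"]) auto
next
  case (Suc n)
  then obtain B where B: "B \<subseteq> T" "finite B" "card B = n" "\<And>u v. u \<in> B \<Longrightarrow> v \<in> B \<Longrightarrow> h u v = (if u = v then 1 else 0)"
    by auto
  have "\<not> T \<subseteq> span B"
  proof
    assume "T \<subseteq> span B"
    then have "dim T \<le> dim (span B)" by (rule dim_subset)
    also have "\<dots> \<le> card B" unfolding dim_span using B(2) by (rule dim_le_card')
    finally show False using Suc.prems B by simp
  qed
  then obtain v where v: "v \<in> T" "v \<notin> span B" by auto
  define w where "w = v - (\<Sum>u\<in>B. h v u *\<^sub>R u)"
  have "(\<Sum>u\<in>B. h v u *\<^sub>R u) \<in> span B" by (intro span_sum span_scale span_base)
  then have "w \<noteq> 0" using v by (auto simp: w_def)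
  then have ww: "h w w > 0" using h by (auto simp: inner_product_def)
  have wT: "w \<in> T"
    unfolding w_def using T B v by (intro subspace_diff subspace_sum subspace_scale) auto
  have wB: "h w u = 0" if "u \<in> B" for u
  proof -
    have "(\<Sum>u'\<in>B. h v u' * h u' u) = (\<Sum>u'\<in>B. if u' = u then h v u else 0)"
      using B that by (intro sum.cong) auto
    then show ?thesis
      using B that by (simp add: w_def inner_product_simps[OF h] inner_product_sum[OF h])
  qed
  define w' where "w' = (1 / sqrt (h w w)) *\<^sub>R w"
  have w'1: "h w' w' = 1" using ww by (simp add: w'_def inner_product_simps[OF h])
  have w'B: "h w' u = 0" "h u w' = 0" if "u \<in> B" for u
    using wB[OF that] h by (auto simp: w'_def inner_product_simps[OF h] inner_product_def)
  have "w' \<notin> B" using w'1 w'B by auto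
  then have "card (insert w' B) = Suc n" using B by simp
  moreover have "insert w' B \<subseteq> T" using B wT T by (auto simp: w'_def subspace_scale)
  moreover have "\<forall>u\<in>insert w' B. \<forall>v\<in>insert w' B. h u v = (if u = v then 1 else 0)"
    using B(4) w'1 w'B \<open>w' \<notin> B\<close> by auto
  ultimately show ?case using B(2) by (intro exI[of _ "insert w' B"]) auto
qed

lemma orthonormal_independent:
  assumes h: "inner_product h" and t: "orthonormal h t" and 0: "(\<Sum>a\<in>UNIV. c a *\<^sub>R t $ a) = 0"
  shows "c b = 0"
proof -
  have "0 = h (\<Sum>a\<in>UNIV. c a *\<^sub>R t $ a) (t $ b)" by (simp only: 0 inner_product_simps[OF h])
  also have "\<dots> = (\<Sum>a\<in>UNIV. if a = b then c b else 0)"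
    unfolding inner_product_sum[OF h] inner_product_simps[OF h]
    using t by (intro sum.cong) (auto simp: orthonormal_def)
  finally show ?thesis by simp
qed

lemma orthonormal_basis_exists:
  fixes T :: "'a::euclidean_space set"
  assumes h: "inner_product h" and T: "subspace T" and dim: "dim T = CARD('p::finite)"
  obtains t :: "'a ^ 'p" where "orthonormal h t" "span (range (\<lambda>a. t $ a)) = T"
proof -
  obtain B where B: "B \<subseteq> T" "finite B" "card B = CARD('p)" "\<And>u v. u \<in> B \<Longrightarrow> v \<in> B \<Longrightarrow> h u v = (if u = v then 1 else 0)"
    using orthonormal_set_exists[OF h T, of "CARD('p)"] dim by auto
  obtain f where f: "bij_betw f (UNIV :: 'p set) B"
    using finite_same_card_bij[of "UNIV :: 'p set" B] B(2,3) by auto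
  define t where "t = (\<chi> a. f a)"
  have range: "range (\<lambda>a. t $ a) = B" using bij_betw_imp_surj_on[OF f] by (simp add: t_def)
  have fB: "f a \<in> B" for a using bij_betwE[OF f] by simp
  have ort: "orthonormal h t"
    using B(4)[OF fB fB] bij_betw_imp_inj_on[OF f] by (auto simp: orthonormal_def t_def inj_eq)
  have "independent B"
  proof (rule independent_if_scalars_zero[OF B(2)])
    fix c x assume c: "(\<Sum>x\<in>B. c x *\<^sub>R x) = 0" and "x \<in> B"
    have "(\<Sum>a\<in>UNIV. c (f a) *\<^sub>R f a) = (\<Sum>x\<in>B. c x *\<^sub>R x)"
      by (rule sum.reindex_bij_betw[OF f])
    then have "c (f a) = 0" for a
      using orthonormal_independent[OF h ort, of "\<lambda>a. c (f a)"] c by (simp add: t_def)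
    then show "c x = 0" using \<open>x \<in> B\<close> range by (auto simp: t_def)
  qed
  then have "T \<subseteq> span B"
    using B dim by (intro card_ge_dim_independent) auto
  then have "span B = T"
    using span_minimal[OF B(1) T] by auto
  then show thesis using that[OF ort] range by simp
qed

text \<open>
  The map \<open>L\<close> assigns to a vector its coordinates in an \<open>h\<close>-orthonormal basis.  It transfers norm
  estimates from the Euclidean scalar product to \<open>h\<close>.
\<close>

lemma inner_product_isometry:
  fixes h :: "real ^ 'i::finite \<Rightarrow> real ^ 'i \<Rightarrow> real"
  assumes h: "inner_product h"
  obtains L :: "real ^ 'i \<Rightarrow> real ^ 'i" where "linear L" "inj L" "\<And>v w. h v w = L v \<bullet> L w"
proof -
  obtain t :: "(real ^ 'i) ^ 'i" where t: "orthonormal h t" "span (range (\<lambda>a. t $ a)) = UNIV"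
    using orthonormal_basis_exists[OF h subspace_UNIV] by (metis dim_UNIV DIM_cart DIM_real mult.right_neutral)
  define L where "L v = (\<chi> a. h v (t $ a))" for v
  have lin: "linear L"
    by (rule linearI) (simp_all add: L_def vec_eq_iff inner_product_simps[OF h])
  have eq: "h v w = L v \<bullet> L w" for v w
  proof -
    have v: "v = (\<Sum>a\<in>UNIV. h v (t $ a) *\<^sub>R t $ a)"
      by (rule orthonormal_expansion[OF h t(1)]) (simp add: t(2))
    have "h v w = (\<Sum>a\<in>UNIV. h v (t $ a) * h (t $ a) w)"
      by (subst v) (simp add: inner_product_sum[OF h] inner_product_simps[OF h])
    then show ?thesis using h by (simp add: L_def inner_vec_def inner_product_def)
  qed
  have "inj L"
  proof (rule linear_injective_0[OF lin, THEN iffD2], intro allI impI)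
    fix v assume "L v = 0"
    then show "v = 0" using eq[of v v] h by (auto simp: inner_product_def)
  qed
  then show thesis using that lin eq by blast
qed

text \<open>
  The square of the \<open>h\<close>-volume of the parallelepiped spanned by \<open>t\<close>, that is, of the norm of
  \<open>wedge t\<close>.
\<close>

definition gram :: "('a \<Rightarrow> 'a \<Rightarrow> real) \<Rightarrow> 'a ^ 'p::finite \<Rightarrow> real" where
  "gram h t = det (\<chi> a b. h (t $ a) (t $ b))"

text \<open>
  The product of the matrix \<open>M\<close> with the column of vectors \<open>t\<close>.
\<close>

definition combine :: "real ^ 'p ^ 'p \<Rightarrow> 'a::real_vector ^ 'p::finite \<Rightarrow> 'a ^ 'p" where
  "combine M t = (\<chi> a. \<Sum>b\<in>UNIV. M $ a $ b *\<^sub>R t $ b)"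

lemma gram_combine:
  assumes h: "inner_product h"
  shows "gram h (combine M t) = (det M)\<^sup>2 * gram h t"
proof -
  let ?G = "\<chi> a b. h (t $ a) (t $ b)"
  have "(\<chi> a b. h (combine M t $ a) (combine M t $ b)) = M ** ?G ** transpose M"
    by (simp add: vec_eq_iff combine_def matrix_matrix_mult_def transpose_def
        inner_product_sum[OF h] inner_product_simps[OF h] sum_distrib_left sum_distrib_right mult_ac)
  then show ?thesis
    by (simp add: gram_def det_mul det_transpose power2_eq_square)
qed

text \<open>
  For every multi-index this is the multiplicativity of the determinant.
\<close>

lemma wedge_combine:
  fixes t :: "real ^ 'i::finite ^ 'p::finite"
  shows "wedge (combine M t) = det M *\<^sub>R wedge t"
proof -
  have "(\<chi> a b. combine M t $ a $ (I $ b)) = M ** (\<chi> a b. t $ a $ (I $ b))" for I :: "'i ^ 'p"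
    by (simp add: vec_eq_iff combine_def matrix_matrix_mult_def sum_component)
  then have "det (\<chi> a b. combine M t $ a $ (I $ b)) = det M * det (\<chi> a b. t $ a $ (I $ b))" for I :: "'i ^ 'p"
    by (simp only: det_mul)
  then show ?thesis
    by (simp add: wedge_def vec_eq_iff)
qed

lemma gram_orthonormal: "orthonormal h t \<Longrightarrow> gram h t = 1"
proof -
  assume "orthonormal h t"
  then have "(\<chi> a b. h (t $ a) (t $ b)) = mat 1"
    by (simp add: vec_eq_iff mat_def orthonormal_def)
  then show ?thesis by (simp add: gram_def)
qed

lemma combine_orthonormal:
  assumes h: "inner_product h" and t: "orthonormal h t" and v: "\<And>a. v $ a \<in> span (range (\<lambda>a. t $ a))"
  obtains M where "v = combine M t"
proof
  show "v = combine (\<chi> a b. h (v $ a) (t $ b)) t"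
    using orthonormal_expansion[OF h t v] by (simp add: vec_eq_iff combine_def)
qed


section \<open>Riemannian distances\<close>

text \<open>
  Continuity in all three arguments jointly is what the local comparison of \<open>h\<close> with a constant
  scalar product requires.
\<close>

definition riemannian_metric :: "('a::euclidean_space \<Rightarrow> 'a \<Rightarrow> 'a \<Rightarrow> real) \<Rightarrow> bool" where
  "riemannian_metric h \<longleftrightarrow> (\<forall>x. inner_product (h x)) \<and>
     continuous_on UNIV (\<lambda>z. h (fst z) (fst (snd z)) (snd (snd z)))"

lemma riemannian_metric_inner_product: "riemannian_metric h \<Longrightarrow> inner_product (h x)"
  by (simp add: riemannian_metric_def)

lemma riemannian_metric_continuous_on:
  assumes h: "riemannian_metric h" and f: "continuous_on S f" "continuous_on S v" "continuous_on S w"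
  shows "continuous_on S (\<lambda>x. h (f x) (v x) (w x))"
proof -
  have "continuous_on S (\<lambda>x. (f x, v x, w x))" by (intro continuous_intros f)
  then have "continuous_on S ((\<lambda>z. h (fst z) (fst (snd z)) (snd (snd z))) \<circ> (\<lambda>x. (f x, v x, w x)))"
    using h unfolding riemannian_metric_def
    by (intro continuous_on_compose) (auto intro: continuous_on_subset)
  then show ?thesis by (simp add: o_def)
qed

lemma riemannian_metric_lower_bound:
  fixes h :: "'a::euclidean_space \<Rightarrow> 'a \<Rightarrow> 'a \<Rightarrow> real"
  assumes h: "riemannian_metric h" and C: "compact C"
  obtains \<kappa> where "\<kappa> > 0" "\<And>z v. z \<in> C \<Longrightarrow> (\<kappa> * norm v)\<^sup>2 \<le> h z v v"
proof (cases "C = {}")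
  case True
  then show thesis using that[of 1] by simp
next
  case False
  let ?K = "C \<times> sphere (0::'a) 1"
  have "continuous_on ?K (\<lambda>z. h (fst z) (snd z) (snd z))"
    by (intro riemannian_metric_continuous_on[OF h] continuous_intros)
  moreover have "compact ?K" "?K \<noteq> {}" using C False by (auto intro: compact_Times)
  ultimately obtain z0 where z0: "z0 \<in> ?K" "\<And>z. z \<in> ?K \<Longrightarrow> h (fst z0) (snd z0) (snd z0) \<le> h (fst z) (snd z) (snd z)"
    using continuous_attains_inf by (metis (no_types, lifting))
  define m where "m = h (fst z0) (snd z0) (snd z0)"
  have ip: "inner_product (h z)" for z using h by (rule riemannian_metric_inner_product)
  have "snd z0 \<noteq> 0" using z0(1) by auto
  then have m: "m > 0" using ip by (auto simp: m_def inner_product_def)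
  show thesis
  proof
    show "sqrt m > 0" using m by simp
    fix z v :: 'a assume z: "z \<in> C"
    show "(sqrt m * norm v)\<^sup>2 \<le> h z v v"
    proof (cases "v = 0")
      case False
      let ?u = "(1 / norm v) *\<^sub>R v"
      have "m \<le> h z ?u ?u" using z0(2)[of "(z, ?u)"] z False by (simp add: m_def)
      also have "\<dots> = h z v v / (norm v)\<^sup>2"
        by (simp add: inner_product_simps[OF ip] power2_eq_square)
      finally show ?thesis using False m by (simp add: field_simps power_mult_distrib)
    qed (simp add: inner_product_simps[OF ip])
  qed
qed

lemma riemannian_metric_locally_comparable:
  fixes h :: "'a::euclidean_space \<Rightarrow> 'a \<Rightarrow> 'a \<Rightarrow> real"
  assumes h: "riemannian_metric h" and \<eta>: "\<eta> > 1"
  obtains R where "R > 0" "\<And>z v. z \<in> ball x R \<Longrightarrow> h x v v / \<eta>\<^sup>2 \<le> h z v v"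
     "\<And>z v. z \<in> ball x R \<Longrightarrow> h z v v \<le> \<eta>\<^sup>2 * h x v v"
proof -
  have ip: "inner_product (h z)" for z using h by (rule riemannian_metric_inner_product)
  obtain \<kappa> where \<kappa>: "\<kappa> > 0" "\<And>v. (\<kappa> * norm v)\<^sup>2 \<le> h x v v"
    by (rule riemannian_metric_lower_bound[OF h compact_sing[of x]]) blast
  define \<epsilon> where "\<epsilon> = (1 - 1 / \<eta>\<^sup>2) * \<kappa>\<^sup>2"
  have \<eta>2: "\<eta>\<^sup>2 > 1" using \<eta> by (simp add: power2_eq_square less_1_mult)
  then have \<eta>i: "1 / \<eta>\<^sup>2 < 1" by (subst divide_less_eq_1_pos) linarith+
  have "\<epsilon> > 0" using \<eta>i \<kappa>(1) unfolding \<epsilon>_def by (intro mult_pos_pos) auto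
  let ?K = "cball x 1 \<times> sphere (0::'a) 1"
  have "uniformly_continuous_on ?K (\<lambda>z. h (fst z) (snd z) (snd z))"
    by (intro compact_uniformly_continuous riemannian_metric_continuous_on[OF h] continuous_intros compact_Times) auto
  then obtain d where d: "d > 0" "\<And>z z'. z \<in> ?K \<Longrightarrow> z' \<in> ?K \<Longrightarrow> dist z' z < d \<Longrightarrow>
      dist (h (fst z') (snd z') (snd z')) (h (fst z) (snd z) (snd z)) < \<epsilon>"
    unfolding uniformly_continuous_on_def using \<open>\<epsilon> > 0\<close> by metis
  define R where "R = min d 1"
  have close: "\<bar>h z v v - h x v v\<bar> \<le> (1 - 1 / \<eta>\<^sup>2) * h x v v" if z: "z \<in> ball x R" for z v
  proof (cases "v = 0")
    case False
    let ?u = "(1 / norm v) *\<^sub>R v"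
    have hu: "h z ?u ?u = h z v v / (norm v)\<^sup>2" for z
      by (simp add: inner_product_simps[OF ip] power2_eq_square)
    have "dist (z, ?u) (x, ?u) < d" using z by (simp add: dist_Pair_Pair R_def dist_commute)
    then have "\<bar>h z ?u ?u - h x ?u ?u\<bar> < \<epsilon>"
      using d(2)[of "(x, ?u)" "(z, ?u)"] z False by (simp add: R_def dist_real_def)
    then have "\<bar>h z v v - h x v v\<bar> / (norm v)\<^sup>2 < \<epsilon>"
      unfolding hu diff_divide_distrib[symmetric] by (simp add: abs_divide)
    then have "\<bar>h z v v - h x v v\<bar> < (1 - 1 / \<eta>\<^sup>2) * (\<kappa> * norm v)\<^sup>2"
      using False by (simp add: \<epsilon>_def pos_divide_less_eq power_mult_distrib mult.assoc)
    also have "\<dots> \<le> (1 - 1 / \<eta>\<^sup>2) * h x v v"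
      using \<eta>i by (intro mult_left_mono \<kappa>) auto
    finally show ?thesis by simp
  qed (simp add: inner_product_simps[OF ip])
  show thesis
  proof
    show "R > 0" using d by (simp add: R_def)
    fix z v assume z: "z \<in> ball x R"
    have nn: "h x v v \<ge> 0" using \<kappa>(2)[of v] by (meson order_trans zero_le_power2)
    show "h x v v / \<eta>\<^sup>2 \<le> h z v v"
      using close[OF z, of v] by (simp add: left_diff_distrib abs_le_iff)
    have "h z v v \<le> (2 - 1 / \<eta>\<^sup>2) * h x v v"
      using close[OF z, of v] by (simp add: left_diff_distrib abs_le_iff)
    also have "\<dots> \<le> \<eta>\<^sup>2 * h x v v"
    proof (intro mult_right_mono nn)
      \<comment> \<open>This is \<open>\<eta>\<^sup>2 + 1 / \<eta>\<^sup>2 \<ge> 2\<close>.\<close>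
      have "0 \<le> (\<eta>\<^sup>2 - 1)\<^sup>2 / \<eta>\<^sup>2" by simp
      also have "\<dots> = \<eta>\<^sup>2 - (2 - 1 / \<eta>\<^sup>2)" using \<eta> by (simp add: field_simps power2_eq_square)
      finally show "2 - 1 / \<eta>\<^sup>2 \<le> \<eta>\<^sup>2" by simp
    qed
    finally show "h z v v \<le> \<eta>\<^sup>2 * h x v v" .
  qed
qed

text \<open>
  The fundamental theorem of calculus for \<open>L \<circ> \<gamma>\<close> on \<open>[0, u]\<close>.  The velocity is only known to be
  continuous off a finite set, and the length may be infinite; in the finite case the velocity is
  integrable and the norm of its integral is at most the integral of its norm.
\<close>

lemma riem_length_ge:
  fixes h :: "'a::euclidean_space \<Rightarrow> 'a \<Rightarrow> 'a \<Rightarrow> real" and L :: "'a \<Rightarrow> 'b::euclidean_space"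
  assumes \<gamma>: "valid_path \<gamma>" and u: "0 \<le> u" "u \<le> 1" and L: "linear L" and \<kappa>: "0 \<le> \<kappa>"
    and le: "\<And>t v. 0 \<le> t \<Longrightarrow> t < u \<Longrightarrow> (\<kappa> * norm (L v))\<^sup>2 \<le> h (\<gamma> t) v v"
  shows "ennreal (\<kappa> * norm (L (\<gamma> u - \<gamma> 0))) \<le> riem_length h \<gamma>"
proof -
  have bl: "bounded_linear L" using L by (simp add: linear_conv_bounded_linear)
  obtain K D where K: "finite K" and D: "\<And>t. t \<in> {0..1} - K \<Longrightarrow> (\<gamma> has_vector_derivative D t) (at t)"
    and cD: "continuous_on ({0..1} - K) D" and c\<gamma>: "continuous_on {0..1} \<gamma>"
    using \<gamma> unfolding valid_path_def piecewise_C1_differentiable_on_def C1_differentiable_on_def by metis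
  define S where "S = {0..u} - insert u K"
  have S: "S \<subseteq> {0..1} - K" using u by (auto simp: S_def)
  define G where "G t = indicator S t *\<^sub>R L (D t)" for t
  have "S \<in> sets borel" using K unfolding S_def by (intro sets.Diff borel_closed[OF finite_imp_closed] borel_closed[OF closed_atLeastAtMost]) auto
  moreover have "continuous_on S (\<lambda>t. L (D t))"
    by (intro bounded_linear.continuous_on[OF bl] continuous_on_subset[OF cD S])
  ultimately have G [measurable]: "G \<in> borel_measurable borel"
    unfolding G_def by (rule borel_measurable_continuous_on_indicator)
  have len: "(\<integral>\<^sup>+ t. ennreal (\<kappa> * norm (G t)) \<partial>lborel) \<le> riem_length h \<gamma>"
    unfolding riem_length_def
  proof (rule nn_integral_mono)
    fix t
    let ?v = "vector_derivative \<gamma> (at t)"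
    show "ennreal (\<kappa> * norm (G t)) \<le> ennreal (sqrt (h (\<gamma> t) ?v ?v)) * indicator {0..1} t"
    proof (cases "t \<in> S")
      case True
      then have "?v = D t" using D S by (intro vector_derivative_at) auto
      moreover have "\<kappa> * norm (L (D t)) \<le> sqrt (h (\<gamma> t) (D t) (D t))"
        using le[of t "D t"] True u by (intro real_le_rsqrt) (auto simp: S_def)
      ultimately show ?thesis using True S by (auto simp: G_def indicator_def intro: ennreal_leI)
    qed (simp add: G_def)
  qed
  show ?thesis
  proof (cases "\<kappa> = 0 \<or> (\<integral>\<^sup>+ t. ennreal (norm (G t)) \<partial>lborel) = \<infinity>")
    case True
    show ?thesis
    proof (cases "\<kappa> = 0")
      case False
      then have "(\<integral>\<^sup>+ t. ennreal \<kappa> * ennreal (norm (G t)) \<partial>lborel) = \<infinity>"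
        using True \<kappa> by (subst nn_integral_cmult) (auto simp: ennreal_mult_eq_top_iff)
      then show ?thesis using len \<kappa> by (simp add: ennreal_mult top_unique)
    qed simp
  next
    case False
    then have int: "integrable lborel G"
      by (intro integrableI_bounded) (auto simp: top.not_eq_extremum)
    have "((\<lambda>t. L (D t)) has_integral (L (\<gamma> u) - L (\<gamma> 0))) {0..u}"
    proof (rule fundamental_theorem_of_calculus_interior_strong[of "insert u K"])
      show "finite (insert u K)" using K by simp
      show "continuous_on {0..u} (\<lambda>t. L (\<gamma> t))"
        using u by (intro bounded_linear.continuous_on[OF bl] continuous_on_subset[OF c\<gamma>]) auto
      fix t assume "t \<in> {0<..<u} - insert u K"
      then have "(\<gamma> has_vector_derivative D t) (at t)" using u by (intro D) auto
      then show "((\<lambda>t. L (\<gamma> t)) has_vector_derivative L (D t)) (at t)"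
        by (rule bounded_linear.has_vector_derivative[OF bl])
    qed (use u in auto)
    then have "((\<lambda>t. if t \<in> {0..u} then L (D t) else 0) has_integral (L (\<gamma> u) - L (\<gamma> 0))) UNIV"
      by (simp only: has_integral_restrict_UNIV)
    then have "(G has_integral (L (\<gamma> u) - L (\<gamma> 0))) UNIV"
      by (rule has_integral_spike_finite[rotated 2, of _ _ _ "insert u K"])
         (use K in \<open>auto simp: G_def S_def indicator_def\<close>)
    then have "integral\<^sup>L lborel G = L (\<gamma> u) - L (\<gamma> 0)"
      using has_integral_integral_lborel[OF int] by (rule has_integral_unique[symmetric])
    then have "ennreal (norm (L (\<gamma> u - \<gamma> 0))) \<le> (\<integral>\<^sup>+ t. ennreal (norm (G t)) \<partial>lborel)"
      using integral_norm_bound_ennreal[OF int] by (simp add: linear_diff[OF L])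
    then have "ennreal \<kappa> * ennreal (norm (L (\<gamma> u - \<gamma> 0))) \<le> ennreal \<kappa> * (\<integral>\<^sup>+ t. ennreal (norm (G t)) \<partial>lborel)"
      by (rule mult_left_mono) simp
    also have "\<dots> = (\<integral>\<^sup>+ t. ennreal (\<kappa> * norm (G t)) \<partial>lborel)"
      using \<kappa> by (subst nn_integral_cmult[symmetric]) (auto simp: ennreal_mult)
    also note len
    finally show ?thesis using \<kappa> by (simp add: ennreal_mult)
  qed
qed

text \<open>
  A path from \<open>x\<close> to \<open>y\<close> either stays in the ball, where \<open>h\<close> is controlled, or the part up to its
  first exit already has length at least \<open>\<kappa> * (m * r)\<close>.
\<close>

lemma riem_dist_ge:
  fixes h :: "'a::euclidean_space \<Rightarrow> 'a \<Rightarrow> 'a \<Rightarrow> real" and L :: "'a \<Rightarrow> 'b::euclidean_space"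
  assumes L: "linear L" "\<And>v. m * norm v \<le> norm (L v)" and \<kappa>: "0 \<le> \<kappa>" and m: "0 \<le> m"
    and le: "\<And>z v. z \<in> ball x r \<Longrightarrow> (\<kappa> * norm (L v))\<^sup>2 \<le> h z v v"
  shows "ennreal (min (\<kappa> * norm (L (y - x))) (\<kappa> * (m * r))) \<le> riem_dist h x y"
  unfolding riem_dist_def
proof (rule INF_greatest)
  fix \<gamma> assume "\<gamma> \<in> {\<gamma>. valid_path \<gamma> \<and> pathstart \<gamma> = x \<and> pathfinish \<gamma> = y}"
  then have \<gamma>: "valid_path \<gamma>" "\<gamma> 0 = x" "\<gamma> 1 = y" by (auto simp: pathstart_def pathfinish_def)
  show "ennreal (min (\<kappa> * norm (L (y - x))) (\<kappa> * (m * r))) \<le> riem_length h \<gamma>"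
  proof (cases "\<forall>t\<in>{0..1}. \<gamma> t \<in> ball x r")
    case True
    have "ennreal (\<kappa> * norm (L (\<gamma> 1 - \<gamma> 0))) \<le> riem_length h \<gamma>"
      using True by (intro riem_length_ge[OF \<gamma>(1) _ _ L(1) \<kappa>] le) auto
    then show ?thesis using \<gamma> by (meson ennreal_leI min.cobounded1 order_trans)
  next
    case False
    define Z where "Z = {0..1} \<inter> \<gamma> -` (- ball x r)"
    have "continuous_on {0..1} \<gamma>" using valid_path_imp_path[OF \<gamma>(1)] by (simp add: path_def)
    then have "closed Z"
      unfolding Z_def by (intro continuous_closed_preimage closed_Compl open_ball) auto
    moreover have "bounded Z" unfolding Z_def by (rule bounded_subset[of "{0..1}"]) auto
    ultimately have "compact Z" by (simp add: compact_eq_bounded_closed)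
    moreover have "Z \<noteq> {}" using False by (auto simp: Z_def)
    ultimately obtain u where u: "u \<in> Z" "\<And>t. t \<in> Z \<Longrightarrow> u \<le> t"
      using compact_attains_inf by metis
    have u01: "0 \<le> u" "u \<le> 1" and out: "\<gamma> u \<notin> ball x r" using u(1) by (auto simp: Z_def)
    have inside: "\<gamma> t \<in> ball x r" if "0 \<le> t" "t < u" for t
      using u(2)[of t] that u01 by (auto simp: Z_def)
    have "r \<le> norm (\<gamma> u - x)" using out by (simp add: dist_norm norm_minus_commute)
    then have "m * r \<le> norm (L (\<gamma> u - x))"
      using m L(2)[of "\<gamma> u - x"] by (meson mult_left_mono order_trans)
    then have "ennreal (\<kappa> * (m * r)) \<le> ennreal (\<kappa> * norm (L (\<gamma> u - \<gamma> 0)))"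
      using \<kappa> \<gamma> by (intro ennreal_leI mult_left_mono) auto
    also have "\<dots> \<le> riem_length h \<gamma>"
      using inside by (intro riem_length_ge[OF \<gamma>(1) u01 L(1) \<kappa>] le) auto
    finally show ?thesis by (meson ennreal_leI min.cobounded2 order_trans)
  qed
qed

text \<open>
  The straight segment is an admissible path.
\<close>

lemma riem_dist_le:
  fixes h :: "'a::euclidean_space \<Rightarrow> 'a \<Rightarrow> 'a \<Rightarrow> real"
  assumes \<kappa>: "0 \<le> \<kappa>" and C: "convex C" "x \<in> C" "y \<in> C"
    and le: "\<And>z v. z \<in> C \<Longrightarrow> h z v v \<le> (\<kappa> * norm (L v))\<^sup>2"
  shows "riem_dist h x y \<le> ennreal (\<kappa> * norm (L (y - x)))"
proof -
  have "riem_dist h x y \<le> riem_length h (linepath x y)"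
    unfolding riem_dist_def by (intro INF_lower) auto
  also have "\<dots> \<le> (\<integral>\<^sup>+ t. ennreal (\<kappa> * norm (L (y - x))) * indicator {0..1::real} t \<partial>lborel)"
    unfolding riem_length_def
  proof (rule nn_integral_mono)
    fix t :: real
    let ?g = "linepath x y" and ?v = "vector_derivative (linepath x y) (at t)"
    have "sqrt (h (?g t) (y - x) (y - x)) \<le> \<kappa> * norm (L (y - x))" if "t \<in> {0..1}"
    proof (rule real_le_lsqrt)
      have "?g t \<in> closed_segment x y" using that by (metis imageI path_image_linepath path_image_def)
      then have "?g t \<in> C" using C by (metis closed_segment_subset subset_iff)
      then show "h (?g t) (y - x) (y - x) \<le> (\<kappa> * norm (L (y - x)))\<^sup>2" by (rule le)
    qed (use \<kappa> in simp)
    then show "ennreal (sqrt (h (?g t) ?v ?v)) * indicator {0..1} t \<le> ennreal (\<kappa> * norm (L (y - x))) * indicator {0..1} t"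
      by (auto simp: indicator_def intro: ennreal_leI)
  qed
  also have "\<dots> = ennreal (\<kappa> * norm (L (y - x)))"
    by (subst nn_integral_cmult_indicator) auto
  finally show ?thesis .
qed

text \<open>
  On a compact neighbourhood of \<open>K\<close> the metric is bounded below, so a path that leaves the
  \<open>\<epsilon>\<close>-ball around a point of \<open>K\<close> has a definite length.
\<close>

lemma compactly_separating_riem_dist:
  fixes h :: "'a::euclidean_space \<Rightarrow> 'a \<Rightarrow> 'a \<Rightarrow> real"
  assumes h: "riemannian_metric h"
  shows "compactly_separating (riem_dist h)"
  unfolding compactly_separating_def
proof (intro allI impI)
  fix K :: "'a set" and \<epsilon> :: real assume K: "compact K" and \<epsilon>: "0 < \<epsilon>"
  show "\<exists>c>0. \<forall>x\<in>K. \<forall>y. \<epsilon> \<le> dist x y \<longrightarrow> c \<le> riem_dist h x y"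
  proof (cases "K = {}")
    case False
    obtain \<kappa> where \<kappa>: "\<kappa> > 0" "\<And>z v. z \<in> {z. infdist z K \<le> \<epsilon>} \<Longrightarrow> (\<kappa> * norm v)\<^sup>2 \<le> h z v v"
      by (rule riemannian_metric_lower_bound[OF h compact_infdist_le[OF False K \<epsilon>]]) blast
    show ?thesis
    proof (intro exI[of _ "ennreal (\<kappa> * \<epsilon>)"] conjI ballI allI impI)
      show "0 < ennreal (\<kappa> * \<epsilon>)" using \<kappa> \<epsilon> by simp
      fix x y assume x: "x \<in> K" and y: "\<epsilon> \<le> dist x y"
      have "ennreal (min (\<kappa> * norm (id (y - x))) (\<kappa> * (1 * \<epsilon>))) \<le> riem_dist h x y"
      proof (rule riem_dist_ge)
        fix z v assume "z \<in> ball x \<epsilon>"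
        then have "infdist z K \<le> \<epsilon>" using infdist_le[OF x, of z] by (simp add: dist_commute)
        then show "(\<kappa> * norm (id v))\<^sup>2 \<le> h z v v" using \<kappa>(2)[of z v] by simp
      qed (use \<kappa> linear_id in \<open>auto simp: id_def\<close>)
      moreover have "\<kappa> * \<epsilon> \<le> \<kappa> * norm (y - x)"
        using y \<kappa> by (intro mult_left_mono) (auto simp: dist_norm norm_minus_commute)
      ultimately show "ennreal (\<kappa> * \<epsilon>) \<le> riem_dist h x y" by (simp add: min_absorb2)
    qed
  qed (auto intro: exI[of _ 1])
qed

text \<open>
  The radius \<open>R\<close> is chosen so small compared with \<open>R1\<close> that leaving the ball of radius \<open>R1 / 2\<close> around
  \<open>y\<close> costs more than the straight way to \<open>z\<close>; then the lower bound \<open>riem_dist_ge\<close> is the Euclidean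
  one.
\<close>

lemma riem_dist_locally_euclidean:
  fixes h :: "'a::euclidean_space \<Rightarrow> 'a \<Rightarrow> 'a \<Rightarrow> real" and L :: "'a \<Rightarrow> 'b::euclidean_space"
  assumes h: "riemannian_metric h" and \<eta>: "\<eta> > 1"
    and L: "linear L" "inj L" "\<And>v w. h x v w = L v \<bullet> L w"
  obtains R where "R > 0"
    "\<And>y z. y \<in> ball x R \<Longrightarrow> z \<in> ball x R \<Longrightarrow> riem_dist h y z \<le> ennreal (\<eta> * norm (L z - L y))"
    "\<And>y z. y \<in> ball x R \<Longrightarrow> z \<in> ball x R \<Longrightarrow> ennreal (norm (L z - L y)) \<le> ennreal \<eta> * riem_dist h y z"
proof -
  obtain R1 where R1: "R1 > 0" "\<And>z v. z \<in> ball x R1 \<Longrightarrow> h x v v / \<eta>\<^sup>2 \<le> h z v v"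
     "\<And>z v. z \<in> ball x R1 \<Longrightarrow> h z v v \<le> \<eta>\<^sup>2 * h x v v"
    using riemannian_metric_locally_comparable[OF h \<eta>, of x] by metis
  have hx: "h x v v = (norm (L v))\<^sup>2" for v by (simp add: L(3) power2_norm_eq_inner)
  obtain m where m: "m > 0" "\<And>v. m * norm v \<le> norm (L v)"
    using linear_inj_bounded_below_pos[OF L(1,2)] by (metis mult.commute)
  obtain M where M: "M > 0" "\<And>v. norm (L v) \<le> M * norm v"
    using linear_bounded_pos[OF L(1)] by metis
  \<comment> \<open>Points of the ball of radius \<open>R\<close> have distance less than \<open>2 * R\<close>, and \<open>M * (2 * R) \<le> m * (R1 / 2)\<close>.\<close>
  define R where "R = min (R1 / 2) (m * R1 / (4 * M))"
  have "R > 0" using R1 m M by (simp add: R_def)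
  have sub: "z \<in> ball x R1" if "z \<in> ball x R" for z using that R1 by (simp add: R_def)
  show thesis
  proof
    fix y z assume y: "y \<in> ball x R" and z: "z \<in> ball x R"
    have "riem_dist h y z \<le> ennreal (\<eta> * norm (L (z - y)))"
    proof (rule riem_dist_le)
      show "y \<in> ball x R1" "z \<in> ball x R1" using sub y z by auto
      show "h z v v \<le> (\<eta> * norm (L v))\<^sup>2" if "z \<in> ball x R1" for z v
        using R1(3)[OF that, of v] by (simp add: hx power_mult_distrib)
    qed (use \<eta> in auto)
    then show "riem_dist h y z \<le> ennreal (\<eta> * norm (L z - L y))" by (simp add: linear_diff[OF L(1)])
    have "ennreal (min (1 / \<eta> * norm (L (z - y))) (1 / \<eta> * (m * (R1 / 2)))) \<le> riem_dist h y z"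
    proof (rule riem_dist_ge[OF L(1) m(2)])
      fix w v assume "w \<in> ball y (R1 / 2)"
      moreover have "dist x w \<le> dist x y + dist y w" by (rule dist_triangle)
      ultimately have "w \<in> ball x R1" using y by (simp add: R_def)
      then show "(1 / \<eta> * norm (L v))\<^sup>2 \<le> h w v v"
        using R1(2)[of w v] by (simp add: hx power_divide)
    qed (use \<eta> m in auto)
    moreover have "norm (L (z - y)) \<le> m * (R1 / 2)"
    proof -
      have "norm (z - y) \<le> 2 * R"
        using y z dist_triangle[of z y x] by (simp add: dist_commute dist_norm[symmetric])
      then have "norm (L (z - y)) \<le> M * (2 * R)" using M by (meson less_imp_le mult_left_mono order_trans)
      also have "\<dots> \<le> M * (2 * (m * R1 / (4 * M)))" using M by (intro mult_left_mono) (auto simp: R_def)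
      also have "\<dots> = m * (R1 / 2)" using M by simp
      finally show ?thesis .
    qed
    then have "1 / \<eta> * norm (L (z - y)) \<le> 1 / \<eta> * (m * (R1 / 2))"
      using \<eta> by (intro mult_left_mono) auto
    ultimately have "ennreal (1 / \<eta> * norm (L (z - y))) \<le> riem_dist h y z" by (simp only: min_absorb1)
    then have "ennreal \<eta> * ennreal (1 / \<eta> * norm (L (z - y))) \<le> ennreal \<eta> * riem_dist h y z"
      by (rule mult_left_mono) simp
    then show "ennreal (norm (L z - L y)) \<le> ennreal \<eta> * riem_dist h y z"
      using \<eta> by (simp add: ennreal_mult[symmetric] linear_diff[OF L(1)])
  qed (rule \<open>R > 0\<close>)
qed


section \<open>Hausdorff measure in a chart\<close>

text \<open>
  The mean value inequality for \<open>\<phi> - \<phi>' u0\<close>, whose derivative is small near \<open>u0\<close>.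
\<close>

lemma blinfun_perturbation:
  fixes \<phi> :: "'a::euclidean_space \<Rightarrow> 'b::euclidean_space" and \<phi>' :: "'a \<Rightarrow> 'a \<Rightarrow>\<^sub>L 'b"
  assumes W: "open W" "u0 \<in> W" and der: "\<And>u. u \<in> W \<Longrightarrow> (\<phi> has_derivative blinfun_apply (\<phi>' u)) (at u)"
    and cont: "continuous_on W \<phi>'" and \<epsilon>: "\<epsilon> > 0"
  obtains r where "r > 0" "ball u0 r \<subseteq> W"
    "\<And>u v. u \<in> ball u0 r \<Longrightarrow> v \<in> ball u0 r \<Longrightarrow> norm (\<phi> u - \<phi> v - \<phi>' u0 (u - v)) \<le> \<epsilon> * norm (u - v)"
proof -
  have "isCont \<phi>' u0" using cont W by (simp add: continuous_on_eq_continuous_at)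
  then obtain d where d: "d > 0" "\<And>u. dist u u0 < d \<Longrightarrow> dist (\<phi>' u) (\<phi>' u0) < \<epsilon>"
    using \<epsilon> unfolding continuous_at_eps_delta by metis
  obtain e where e: "e > 0" "ball u0 e \<subseteq> W" using W by (meson open_contains_ball)
  define r where "r = min d e"
  have rW: "ball u0 r \<subseteq> W" using e by (auto simp: r_def)
  show thesis
  proof (rule that)
    show "r > 0" using d e by (simp add: r_def)
    show "ball u0 r \<subseteq> W" by (rule rW)
    fix u v assume uv: "u \<in> ball u0 r" "v \<in> ball u0 r"
    have "norm ((\<phi> u - \<phi>' u0 u) - (\<phi> v - \<phi>' u0 v)) \<le> \<epsilon> * norm (u - v)"
    proof (rule differentiable_bound[of "ball u0 r"])
      fix w assume w: "w \<in> ball u0 r"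
      then have "(\<phi> has_derivative blinfun_apply (\<phi>' w)) (at w)" using rW by (intro der) auto
      then have "((\<lambda>u. \<phi> u - \<phi>' u0 u) has_derivative (\<lambda>v. \<phi>' w v - \<phi>' u0 v)) (at w)"
        by (auto intro!: derivative_eq_intros)
      then show "((\<lambda>u. \<phi> u - \<phi>' u0 u) has_derivative blinfun_apply (\<phi>' w - \<phi>' u0)) (at w within ball u0 r)"
        by (simp add: minus_blinfun.rep_eq has_derivative_at_withinI)
      have "dist w u0 < d" using w by (simp add: r_def dist_commute)
      then show "onorm (blinfun_apply (\<phi>' w - \<phi>' u0)) \<le> \<epsilon>"
        using d(2)[of w] by (simp add: dist_norm norm_blinfun.rep_eq less_imp_le)
    qed (use uv in auto)
    then show "norm (\<phi> u - \<phi> v - \<phi>' u0 (u - v)) \<le> \<epsilon> * norm (u - v)"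
      by (simp add: blinfun.diff_right algebra_simps)
  qed
qed

text \<open>
  Near \<open>u0\<close> the increments of \<open>L \<circ> \<phi>\<close> differ from those of its differential at \<open>u0\<close> by a small multiple
  of \<open>norm (u - v)\<close>, which injectivity of \<open>B\<close> turns into a small multiple of \<open>norm (B u - B v)\<close>.
\<close>

lemma chart_almost_linear:
  fixes \<phi> :: "'a::euclidean_space \<Rightarrow> 'b::euclidean_space" and \<phi>' :: "'a \<Rightarrow> 'a \<Rightarrow>\<^sub>L 'b"
    and L :: "'b \<Rightarrow> 'c::euclidean_space" and B :: "'a \<Rightarrow> 'd::euclidean_space"
  assumes W: "open W" "u0 \<in> W" and der: "\<And>u. u \<in> W \<Longrightarrow> (\<phi> has_derivative blinfun_apply (\<phi>' u)) (at u)"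
    and cont: "continuous_on W \<phi>'" and \<eta>: "\<eta> > 1"
    and L: "linear L" and B: "linear B" "inj B" and LB: "\<And>w. norm (L (\<phi>' u0 w)) = norm (B w)"
  obtains r where "r > 0" "ball u0 r \<subseteq> W"
    "\<And>u v. u \<in> ball u0 r \<Longrightarrow> v \<in> ball u0 r \<Longrightarrow> norm (L (\<phi> u) - L (\<phi> v)) \<le> \<eta> * norm (B u - B v)"
    "\<And>u v. u \<in> ball u0 r \<Longrightarrow> v \<in> ball u0 r \<Longrightarrow> norm (B u - B v) \<le> \<eta> * norm (L (\<phi> u) - L (\<phi> v))"
proof -
  obtain m where m: "m > 0" "\<And>v. m * norm v \<le> norm (B v)"
    using linear_inj_bounded_below_pos[OF B] by (metis mult.commute)
  obtain M where M: "M > 0" "\<And>v. norm (L v) \<le> M * norm v"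
    using linear_bounded_pos[OF L] by metis
  \<comment> \<open>The largest relative error \<open>\<theta>\<close> with \<open>1 / \<eta> \<le> 1 - \<theta>\<close>; then also \<open>1 + \<theta> \<le> \<eta>\<close>.\<close>
  define \<theta> where "\<theta> = 1 - 1 / \<eta>"
  have \<theta>: "\<theta> > 0" "1 + \<theta> \<le> \<eta>" "1 - \<theta> = 1 / \<eta>"
  proof -
    have "0 \<le> (\<eta> - 1)\<^sup>2 / \<eta>" using \<eta> by simp
    also have "\<dots> = \<eta> - (1 + \<theta>)" using \<eta> by (simp add: \<theta>_def field_simps power2_eq_square)
    finally show "1 + \<theta> \<le> \<eta>" by simp
  qed (use \<eta> in \<open>auto simp: \<theta>_def\<close>)
  have \<epsilon>: "\<theta> * m / M > 0" using \<theta> m M by simp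
  obtain r where r: "r > 0" "ball u0 r \<subseteq> W"
    "\<And>u v. u \<in> ball u0 r \<Longrightarrow> v \<in> ball u0 r \<Longrightarrow> norm (\<phi> u - \<phi> v - \<phi>' u0 (u - v)) \<le> \<theta> * m / M * norm (u - v)"
    using blinfun_perturbation[OF W der cont \<epsilon>] by metis
  have close: "norm (L (\<phi> u) - L (\<phi> v) - L (\<phi>' u0 (u - v))) \<le> \<theta> * norm (B u - B v)"
    if "u \<in> ball u0 r" "v \<in> ball u0 r" for u v
  proof -
    have "norm (L (\<phi> u) - L (\<phi> v) - L (\<phi>' u0 (u - v))) = norm (L (\<phi> u - \<phi> v - \<phi>' u0 (u - v)))"
      by (simp add: linear_diff[OF L])
    also have "\<dots> \<le> M * norm (\<phi> u - \<phi> v - \<phi>' u0 (u - v))" by (rule M)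
    also have "\<dots> \<le> M * (\<theta> * m / M * norm (u - v))" using M by (intro mult_left_mono r that) auto
    also have "\<dots> = \<theta> * (m * norm (u - v))" using M by simp
    also have "\<dots> \<le> \<theta> * norm (B (u - v))" using \<theta> by (intro mult_left_mono m) auto
    finally show ?thesis by (simp add: linear_diff[OF B(1)])
  qed
  show thesis
  proof (rule that[OF r(1,2)])
    fix u v assume uv: "u \<in> ball u0 r" "v \<in> ball u0 r"
    have A: "norm (L (\<phi>' u0 (u - v))) = norm (B u - B v)" by (simp add: LB linear_diff[OF B(1)])
    have "norm (L (\<phi> u) - L (\<phi> v)) \<le> norm (L (\<phi>' u0 (u - v))) + norm (L (\<phi> u) - L (\<phi> v) - L (\<phi>' u0 (u - v)))"
      by (rule norm_triangle_sub)
    also have "\<dots> \<le> (1 + \<theta>) * norm (B u - B v)" using close[OF uv] A by (simp add: algebra_simps)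
    also have "\<dots> \<le> \<eta> * norm (B u - B v)" using \<theta> by (intro mult_right_mono) auto
    finally show "norm (L (\<phi> u) - L (\<phi> v)) \<le> \<eta> * norm (B u - B v)" .
    have "norm (B u - B v) \<le> norm (L (\<phi> u) - L (\<phi> v)) + \<theta> * norm (B u - B v)"
      using close[OF uv] A norm_triangle_sub[of "L (\<phi>' u0 (u - v))" "L (\<phi> u) - L (\<phi> v)"]
      by (simp add: norm_minus_commute)
    then have "(1 / \<eta>) * norm (B u - B v) \<le> norm (L (\<phi> u) - L (\<phi> v))"
      unfolding \<theta>(3)[symmetric] by (simp add: algebra_simps)
    then show "norm (B u - B v) \<le> \<eta> * norm (L (\<phi> u) - L (\<phi> v))"
      using \<eta> by (simp add: field_simps)
  qed
qed

lemma inner_product_pullback: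
  fixes A :: "'a::real_vector \<Rightarrow> 'b::real_vector"
  assumes h: "inner_product h" and A: "linear A" "inj A"
  shows "inner_product (\<lambda>u v. h (A u) (A v))"
  unfolding inner_product_def bilinear_def
proof (intro conjI allI impI linearI)
  fix v :: 'a assume "v \<noteq> 0"
  then have "A v \<noteq> 0" using A linear_0[OF A(1)] by (metis injD)
  then show "h (A v) (A v) > 0" using h by (simp add: inner_product_def)
next
  show "h (A v) (A w) = h (A w) (A v)" for v w using h by (simp add: inner_product_def)
qed (simp_all add: linear_add[OF A(1)] linear_scale[OF A(1)] inner_product_simps[OF h])

text \<open>
  The images of the standard basis, as a frame.
\<close>

definition frame_image :: "(real ^ 'p::finite \<Rightarrow> 'a) \<Rightarrow> 'a ^ 'p" where
  "frame_image A = (\<chi> a. A (axis a 1))"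

text \<open>
  The Gram matrix is \<open>transpose B ** B\<close>.
\<close>

lemma det_eq_sqrt_gram:
  fixes B :: "real ^ 'p::finite \<Rightarrow> real ^ 'p"
  assumes "linear B" and "\<And>u v. h (A u) (A v) = B u \<bullet> B v"
  shows "\<bar>det (matrix B)\<bar> = sqrt (gram h (frame_image A))"
proof -
  have "(\<chi> a b. h (frame_image A $ a) (frame_image A $ b)) = transpose (matrix B) ** matrix B"
    by (simp add: vec_eq_iff frame_image_def assms(2) matrix_matrix_mult_def transpose_def matrix_def inner_vec_def)
  then have "gram h (frame_image A) = (det (matrix B))\<^sup>2"
    by (simp add: gram_def det_mul det_transpose power2_eq_square)
  then show ?thesis by simp
qed

text \<open>
  Pulling \<open>h (\<phi> u0)\<close> back along the differential of the chart gives a scalar product on the parameter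
  space, represented by a linear map \<open>B\<close>.  One factor \<open>sqrt \<eta>\<close> pays for freezing the metric at
  \<open>\<phi> u0\<close>, another one for replacing the chart by its differential.
\<close>

lemma chart_riem_dist:
  fixes \<phi> :: "real ^ 'p::finite \<Rightarrow> real ^ 'i::finite" and \<phi>' :: "real ^ 'p \<Rightarrow> (real ^ 'p) \<Rightarrow>\<^sub>L (real ^ 'i)"
  assumes h: "riemannian_metric h"
    and W: "open W" "u0 \<in> W" and der: "\<And>u. u \<in> W \<Longrightarrow> (\<phi> has_derivative blinfun_apply (\<phi>' u)) (at u)"
    and cont: "continuous_on W \<phi>'" and inj: "inj (blinfun_apply (\<phi>' u0))" and \<eta>: "\<eta> > 1"
  obtains r B where "r > 0" "ball u0 r \<subseteq> W" "linear B" "inj B"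
    "\<bar>det (matrix B)\<bar> = sqrt (gram (h (\<phi> u0)) (frame_image (\<phi>' u0)))"
    "\<And>u v. u \<in> ball u0 r \<Longrightarrow> v \<in> ball u0 r \<Longrightarrow> riem_dist h (\<phi> u) (\<phi> v) \<le> ennreal \<eta> * edist (B u) (B v)"
    "\<And>u v. u \<in> ball u0 r \<Longrightarrow> v \<in> ball u0 r \<Longrightarrow> edist (B u) (B v) \<le> ennreal \<eta> * riem_dist h (\<phi> u) (\<phi> v)"
proof -
  let ?x = "\<phi> u0" and ?A = "blinfun_apply (\<phi>' u0)"
  define \<zeta> where "\<zeta> = sqrt \<eta>"
  have \<zeta>: "\<zeta> > 1" "\<zeta> * \<zeta> = \<eta>" using \<eta> by (auto simp: \<zeta>_def)
  have ip: "inner_product (h ?x)" by (rule riemannian_metric_inner_product[OF h])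
  have lin: "linear ?A" using blinfun.bounded_linear_right linear_conv_bounded_linear by blast
  obtain L :: "real ^ 'i \<Rightarrow> real ^ 'i" where L: "linear L" "inj L" "\<And>v w. h ?x v w = L v \<bullet> L w"
    using inner_product_isometry[OF ip] by metis
  obtain B :: "real ^ 'p \<Rightarrow> real ^ 'p" where B: "linear B" "inj B" "\<And>u v. h ?x (?A u) (?A v) = B u \<bullet> B v"
    using inner_product_isometry[OF inner_product_pullback[OF ip lin inj]] by metis
  have LB: "norm (L (?A w)) = norm (B w)" for w by (simp add: norm_eq_sqrt_inner flip: L(3) B(3))
  obtain r1 where r1: "r1 > 0" "ball u0 r1 \<subseteq> W"
    "\<And>u v. u \<in> ball u0 r1 \<Longrightarrow> v \<in> ball u0 r1 \<Longrightarrow> norm (L (\<phi> u) - L (\<phi> v)) \<le> \<zeta> * norm (B u - B v)"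
    "\<And>u v. u \<in> ball u0 r1 \<Longrightarrow> v \<in> ball u0 r1 \<Longrightarrow> norm (B u - B v) \<le> \<zeta> * norm (L (\<phi> u) - L (\<phi> v))"
    using chart_almost_linear[OF W der cont \<zeta>(1) L(1) B(1,2) LB] by metis
  obtain R where R: "R > 0"
    "\<And>y z. y \<in> ball ?x R \<Longrightarrow> z \<in> ball ?x R \<Longrightarrow> riem_dist h y z \<le> ennreal (\<zeta> * norm (L z - L y))"
    "\<And>y z. y \<in> ball ?x R \<Longrightarrow> z \<in> ball ?x R \<Longrightarrow> ennreal (norm (L z - L y)) \<le> ennreal \<zeta> * riem_dist h y z"
    using riem_dist_locally_euclidean[OF h \<zeta>(1) L] by metis
  have "isCont \<phi> u0" using der[OF W(2)] by (rule has_derivative_continuous)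
  then obtain r2 where r2: "r2 > 0" "\<And>u. dist u u0 < r2 \<Longrightarrow> dist (\<phi> u) ?x < R"
    using R(1) unfolding continuous_at_eps_delta by metis
  define r where "r = min r1 r2"
  have r: "u \<in> ball u0 r1" "\<phi> u \<in> ball ?x R" if "u \<in> ball u0 r" for u
    using that r2(2)[of u] by (auto simp: r_def dist_commute)
  show thesis
  proof (rule that[OF _ _ B(1,2)])
    show "r > 0" using r1 r2 by (simp add: r_def)
    show "ball u0 r \<subseteq> W" using r1(2) by (auto simp: r_def)
    show "\<bar>det (matrix B)\<bar> = sqrt (gram (h (\<phi> u0)) (frame_image (\<phi>' u0)))"
      by (rule det_eq_sqrt_gram[where h = "h ?x" and A = ?A, OF B(1,3)])
    fix u v assume u: "u \<in> ball u0 r" and v: "v \<in> ball u0 r"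
    have "riem_dist h (\<phi> u) (\<phi> v) \<le> ennreal (\<zeta> * norm (L (\<phi> v) - L (\<phi> u)))"
      by (rule R(2)[OF r(2)[OF u] r(2)[OF v]])
    also have "\<dots> \<le> ennreal (\<zeta> * (\<zeta> * norm (B u - B v)))"
      using \<zeta> r1(3)[OF r(1)[OF u] r(1)[OF v]] by (intro ennreal_leI mult_left_mono) (auto simp: norm_minus_commute)
    also have "\<dots> = ennreal \<eta> * edist (B u) (B v)"
      using \<eta> by (simp add: edist_def dist_norm ennreal_mult[symmetric] mult.assoc[symmetric] \<zeta>(2))
    finally show "riem_dist h (\<phi> u) (\<phi> v) \<le> ennreal \<eta> * edist (B u) (B v)" .
    have "edist (B u) (B v) \<le> ennreal (\<zeta> * norm (L (\<phi> v) - L (\<phi> u)))"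
      using r1(4)[OF r(1)[OF u] r(1)[OF v]] by (auto simp: edist_def dist_norm norm_minus_commute intro: ennreal_leI)
    also have "\<dots> = ennreal \<zeta> * ennreal (norm (L (\<phi> v) - L (\<phi> u)))" using \<zeta> by (simp add: ennreal_mult)
    also have "\<dots> \<le> ennreal \<zeta> * (ennreal \<zeta> * riem_dist h (\<phi> u) (\<phi> v))"
      by (intro mult_left_mono R(3) r(2) u v) auto
    also have "\<dots> = ennreal \<eta> * riem_dist h (\<phi> u) (\<phi> v)"
      using \<zeta> by (simp add: mult.assoc[symmetric] ennreal_mult[symmetric])
    finally show "edist (B u) (B v) \<le> ennreal \<eta> * riem_dist h (\<phi> u) (\<phi> v)" .
  qed
qed

text \<open>
  Distances in \<open>\<phi> F\<close> and in \<open>B F\<close> agree up to the factor \<open>\<zeta>\<close> with \<open>\<zeta> ^ p = \<eta>\<close>, \<open>p = CARD('p)\<close>, and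
  the Hausdorff measure of \<open>B F\<close> is \<open>\<bar>det B\<bar>\<close> times that of \<open>F\<close>.
\<close>

lemma chart_hausdorff:
  fixes \<phi> :: "real ^ 'p::finite \<Rightarrow> real ^ 'i::finite" and \<phi>' :: "real ^ 'p \<Rightarrow> (real ^ 'p) \<Rightarrow>\<^sub>L (real ^ 'i)"
  assumes h: "riemannian_metric h"
    and W: "open W" "u0 \<in> W" and der: "\<And>u. u \<in> W \<Longrightarrow> (\<phi> has_derivative blinfun_apply (\<phi>' u)) (at u)"
    and cont: "continuous_on W \<phi>'" and inj: "inj (blinfun_apply (\<phi>' u0))" and inj_\<phi>: "inj_on \<phi> W"
    and \<eta>: "\<eta> > 1"
  defines "J \<equiv> sqrt (gram (h (\<phi> u0)) (frame_image (\<phi>' u0)))"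
  obtains r where "r > 0" "ball u0 r \<subseteq> W" "J > 0"
    "\<And>F. F \<in> sets borel \<Longrightarrow> F \<subseteq> ball u0 r \<Longrightarrow>
       hausdorff_outer (riem_dist h) CARD('p) (\<phi> ` F) \<le> ennreal (\<eta> * J) * hausdorff_cart F"
    "\<And>F. F \<in> sets borel \<Longrightarrow> F \<subseteq> ball u0 r \<Longrightarrow>
       ennreal J * hausdorff_cart F \<le> ennreal \<eta> * hausdorff_outer (riem_dist h) CARD('p) (\<phi> ` F)"
proof -
  let ?p = "CARD('p)" and ?H = "hausdorff_outer (riem_dist h) CARD('p)"
  define \<zeta> where "\<zeta> = root ?p \<eta>"
  have \<zeta>: "\<zeta> > 1" "\<zeta> ^ ?p = \<eta>" using \<eta> by (auto simp: \<zeta>_def)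
  obtain r B where r: "r > 0" "ball u0 r \<subseteq> W" and B: "linear B" "inj B" "\<bar>det (matrix B)\<bar> = J"
    and up: "\<And>u v. u \<in> ball u0 r \<Longrightarrow> v \<in> ball u0 r \<Longrightarrow> riem_dist h (\<phi> u) (\<phi> v) \<le> ennreal \<zeta> * edist (B u) (B v)"
    and lo: "\<And>u v. u \<in> ball u0 r \<Longrightarrow> v \<in> ball u0 r \<Longrightarrow> edist (B u) (B v) \<le> ennreal \<zeta> * riem_dist h (\<phi> u) (\<phi> v)"
    using chart_riem_dist[OF h W der cont inj \<zeta>(1)] unfolding J_def by metis
  have nz: "det (matrix B) \<noteq> 0" using det_nz_iff_inj[OF B(1)] B(2) by simp
  have BM: "(*v) (matrix B) = B" by (rule matrix_vector_mul(2)[OF B(1)])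
  have BF: "hausdorff_cart (B ` F) = ennreal J * hausdorff_cart F" if "F \<in> sets borel" for F
    using hausdorff_cart_matrix_image[OF nz that] by (simp only: BM B(3))
  show thesis
  proof (rule that[OF r])
    show "J > 0" using nz B(3) by linarith
    fix F assume F: "F \<in> sets borel" "F \<subseteq> ball u0 r"
    have "?H ((\<phi> \<circ> inv B) ` (B ` F)) \<le> ennreal (\<zeta> ^ ?p) * hausdorff_cart (B ` F)"
    proof (rule hausdorff_outer_Lipschitz_image)
      fix x y assume "x \<in> B ` F" "y \<in> B ` F"
      then obtain u v where uv: "x = B u" "u \<in> F" "y = B v" "v \<in> F" by auto
      then have "u \<in> ball u0 r" "v \<in> ball u0 r" using F(2) by auto
      then show "riem_dist h ((\<phi> \<circ> inv B) x) ((\<phi> \<circ> inv B) y) \<le> ennreal \<zeta> * edist x y"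
        using up uv(1,3) B(2) by (simp add: inv_f_f)
    qed (use \<zeta> in simp)
    moreover have "(\<phi> \<circ> inv B) ` (B ` F) = \<phi> ` F" using B(2) by (simp add: image_image inv_f_f)
    ultimately show "?H (\<phi> ` F) \<le> ennreal (\<eta> * J) * hausdorff_cart F"
      using \<eta> B(3) by (simp only: \<zeta>(2) BF[OF F(1)]) (simp add: ennreal_mult' mult.assoc)
    have inj_F: "inv_into F \<phi> (\<phi> u) = u" if "u \<in> F" for u
      using inj_on_subset[OF inj_\<phi>, of F] F(2) r(2) that by (intro inv_into_f_f) auto
    have "hausdorff_cart ((B \<circ> inv_into F \<phi>) ` (\<phi> ` F)) \<le> ennreal (\<zeta> ^ ?p) * ?H (\<phi> ` F)"
    proof (rule hausdorff_outer_Lipschitz_image)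
      fix x y assume "x \<in> \<phi> ` F" "y \<in> \<phi> ` F"
      then obtain u v where uv: "x = \<phi> u" "u \<in> F" "y = \<phi> v" "v \<in> F" by auto
      then have "u \<in> ball u0 r" "v \<in> ball u0 r" using F(2) by auto
      then show "edist ((B \<circ> inv_into F \<phi>) x) ((B \<circ> inv_into F \<phi>) y) \<le> ennreal \<zeta> * riem_dist h x y"
        using lo uv by (simp add: inj_F)
    qed (use \<zeta> in simp)
    moreover have "(B \<circ> inv_into F \<phi>) ` (\<phi> ` F) = B ` F" by (auto simp: image_image inj_F)
    ultimately show "ennreal J * hausdorff_cart F \<le> ennreal \<eta> * ?H (\<phi> ` F)"
      by (simp only: \<zeta>(2) BF[OF F(1)])
  qed
qed


section \<open>Tangent spaces\<close>

text \<open>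
  The image of a small parameter ball is a relatively open piece of \<open>S\<close>, cut out by an open set.
\<close>

lemma homeomorphism_small_image:
  assumes U: "open U" and W: "open W" and hom: "homeomorphism W (S \<inter> U) \<phi> \<psi>"
    and r: "ball u0 r \<subseteq> W" and u: "u \<in> ball u0 r"
  obtains V where "open V" "\<phi> u \<in> V" "V \<subseteq> U" "S \<inter> V = \<phi> ` ball u0 r"
proof -
  have "openin (top_of_set W) (ball u0 r)" using r by (simp add: open_openin_trans open_subset)
  then have "openin (top_of_set (S \<inter> U)) (\<phi> ` ball u0 r)"
    by (rule homeomorphism_imp_open_map[OF hom])
  then obtain T where "open T" "\<phi> ` ball u0 r = S \<inter> U \<inter> T" by (auto simp: openin_open)
  then show thesis using U u by (intro that[of "U \<inter> T"]) auto
qed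

text \<open>
  The difference quotient of a curve in \<open>S\<close> at time \<open>t\<close>, where it passes through \<open>\<phi> u\<close>, is close to the
  image of \<open>(u - u0) / t\<close> under the differential of the chart.  So the velocity is a limit of vectors in
  the range of the differential, which is closed.
\<close>

lemma tangent_space_chart_subset:
  fixes \<phi> :: "real ^ 'p::finite \<Rightarrow> real ^ 'i::finite" and \<phi>' :: "real ^ 'p \<Rightarrow> (real ^ 'p) \<Rightarrow>\<^sub>L (real ^ 'i)"
  assumes U: "open U" and W: "open W" "u0 \<in> W" and hom: "homeomorphism W (S \<inter> U) \<phi> \<psi>"
    and der: "\<And>u. u \<in> W \<Longrightarrow> (\<phi> has_derivative blinfun_apply (\<phi>' u)) (at u)"
    and cont: "continuous_on W \<phi>'" and inj: "inj (blinfun_apply (\<phi>' u0))"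
  shows "tangent_space S (\<phi> u0) \<subseteq> range (\<phi>' u0)"
proof
  fix v assume "v \<in> tangent_space S (\<phi> u0)"
  then obtain \<gamma> e where e: "e > 0" and \<gamma>S: "\<gamma> ` {-e<..<e} \<subseteq> S" and \<gamma>0: "\<gamma> 0 = \<phi> u0"
    and \<gamma>': "(\<gamma> has_vector_derivative v) (at 0)"
    by (auto simp: tangent_space_def)
  let ?A = "blinfun_apply (\<phi>' u0)"
  have lin: "linear ?A" using blinfun.bounded_linear_right linear_conv_bounded_linear by blast
  obtain m where m: "m > 0" "\<And>w. m * norm w \<le> norm (?A w)"
    using linear_inj_bounded_below_pos[OF lin inj] by (metis mult.commute)
  have "closed (range ?A)"
    by (intro closed_subspace linear_subspace_image[OF lin] subspace_UNIV)
  moreover have "v \<in> closure (range ?A)"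
    unfolding closure_approachable
  proof (intro allI impI)
    fix \<delta> :: real assume \<delta>: "\<delta> > 0"
    \<comment> \<open>The first bound gives \<open>norm (u - u0) \<le> 2 * (norm v + 1) * t / m\<close>, the second one makes the error of the
      chart on such \<open>u\<close> at most \<open>\<delta> / 2 * t\<close>.\<close>
    define \<epsilon> where "\<epsilon> = min (m / 2) (m * \<delta> / (4 * (norm v + 1)))"
    have nv: "norm v + 1 > 0" by (simp add: add_nonneg_pos)
    have \<epsilon>: "\<epsilon> > 0" using m \<delta> nv by (simp add: \<epsilon>_def)
    have \<epsilon>m: "\<epsilon> \<le> m / 2" unfolding \<epsilon>_def by (rule min.cobounded1)
    obtain r where r: "r > 0" "ball u0 r \<subseteq> W"
      "\<And>u v. u \<in> ball u0 r \<Longrightarrow> v \<in> ball u0 r \<Longrightarrow> norm (\<phi> u - \<phi> v - ?A (u - v)) \<le> \<epsilon> * norm (u - v)"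
      using blinfun_perturbation[OF W der cont \<epsilon>] by metis
    obtain V where V: "open V" "\<phi> u0 \<in> V" "S \<inter> V = \<phi> ` ball u0 r"
      using homeomorphism_small_image[OF U W(1) hom r(2)] centre_in_ball r(1) by metis
    have "(\<gamma> has_derivative (\<lambda>t. t *\<^sub>R v)) (at 0)"
      using \<gamma>' by (simp add: has_vector_derivative_def)
    moreover have "min 1 (\<delta> / 4) > 0" using \<delta> by simp
    ultimately have "\<exists>d>0. \<forall>t. norm (t - 0) < d \<longrightarrow> norm (\<gamma> t - \<gamma> 0 - (t - 0) *\<^sub>R v) \<le> min 1 (\<delta> / 4) * norm (t - 0)"
      unfolding has_derivative_at_alt by blast
    then obtain d where d: "d > 0" "\<And>t. \<bar>t\<bar> < d \<Longrightarrow> norm (\<gamma> t - \<phi> u0 - t *\<^sub>R v) \<le> min 1 (\<delta> / 4) * \<bar>t\<bar>"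
      by (auto simp: \<gamma>0)
    have "isCont \<gamma> 0" using \<gamma>' by (rule has_vector_derivative_continuous)
    then have "\<forall>\<^sub>F t in at 0. \<gamma> t \<in> V"
      using V(1,2) \<gamma>0 unfolding continuous_at by (metis topological_tendstoD)
    then obtain d2 where d2: "d2 > 0" "\<And>t. t \<noteq> 0 \<Longrightarrow> \<bar>t\<bar> < d2 \<Longrightarrow> \<gamma> t \<in> V"
      unfolding eventually_at by auto
    define t where "t = min (min d d2) e / 2"
    have t: "t > 0" "t < d" "t < d2" "t < e" using d d2 e by (auto simp: t_def)
    then have "\<gamma> t \<in> S \<inter> V" using \<gamma>S d2(2)[of t] by (auto simp: image_subset_iff)
    then obtain u where u: "u \<in> ball u0 r" "\<gamma> t = \<phi> u" using V(3) by auto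
    have 1: "norm (\<phi> u - \<phi> u0 - t *\<^sub>R v) \<le> min 1 (\<delta> / 4) * t" using d(2)[of t] t u by simp
    have 2: "norm (\<phi> u - \<phi> u0 - ?A (u - u0)) \<le> \<epsilon> * norm (u - u0)" using r u by simp
    have "norm (\<phi> u - \<phi> u0) \<le> norm (t *\<^sub>R v) + norm (\<phi> u - \<phi> u0 - t *\<^sub>R v)"
      by (rule norm_triangle_sub)
    also have "\<dots> \<le> t * norm v + 1 * t"
      using order_trans[OF 1 mult_right_mono[of "min 1 (\<delta> / 4)" 1 t]] t by (intro add_mono) auto
    finally have 3: "norm (\<phi> u - \<phi> u0) \<le> (norm v + 1) * t" by (simp add: algebra_simps)
    have "m * norm (u - u0) \<le> norm (?A (u - u0))" by (rule m)
    also have "\<dots> \<le> norm (\<phi> u - \<phi> u0) + norm (\<phi> u - \<phi> u0 - ?A (u - u0))"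
      using norm_triangle_sub[of "?A (u - u0)" "\<phi> u - \<phi> u0"] by (simp add: norm_minus_commute)
    also have "\<dots> \<le> (norm v + 1) * t + m / 2 * norm (u - u0)"
      using 3 order_trans[OF 2 mult_right_mono[OF \<epsilon>m norm_ge_zero]] by (intro add_mono) auto
    finally have 4: "m / 2 * norm (u - u0) \<le> (norm v + 1) * t" by (simp add: algebra_simps)
    have "\<epsilon> * norm (u - u0) \<le> m * \<delta> / (4 * (norm v + 1)) * norm (u - u0)"
      by (intro mult_right_mono) (auto simp: \<epsilon>_def)
    also have "\<dots> = \<delta> / (2 * (norm v + 1)) * (m / 2 * norm (u - u0))"
      by (simp add: field_simps)
    also have "\<dots> \<le> \<delta> / (2 * (norm v + 1)) * ((norm v + 1) * t)"
      using \<delta> nv by (intro mult_left_mono 4) auto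
    also have "\<dots> = \<delta> / 2 * t" using nv by (simp add: field_simps)
    finally have 5: "norm (\<phi> u - \<phi> u0 - ?A (u - u0)) \<le> \<delta> / 2 * t" using 2 by linarith
    have "norm (?A (u - u0) - t *\<^sub>R v) \<le> norm (\<phi> u - \<phi> u0 - t *\<^sub>R v) + norm (\<phi> u - \<phi> u0 - ?A (u - u0))"
      using norm_triangle_ineq4[of "\<phi> u - \<phi> u0 - t *\<^sub>R v" "\<phi> u - \<phi> u0 - ?A (u - u0)"] by simp
    also have "\<dots> \<le> \<delta> / 4 * t + \<delta> / 2 * t"
      using 5 order_trans[OF 1 mult_right_mono[of "min 1 (\<delta> / 4)" "\<delta> / 4" t]] t by (intro add_mono) auto
    also have "\<dots> < \<delta> * t" using \<delta> t by (simp add: algebra_simps)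
    finally have 6: "norm (?A (u - u0) - t *\<^sub>R v) < \<delta> * t" .
    have "?A ((1 / t) *\<^sub>R (u - u0)) - v = (1 / t) *\<^sub>R (?A (u - u0) - t *\<^sub>R v)"
      using t by (subst blinfun.scaleR_right, subst scaleR_diff_right) simp
    then have "dist (?A ((1 / t) *\<^sub>R (u - u0))) v = norm (?A (u - u0) - t *\<^sub>R v) / t"
      unfolding dist_norm using t by simp
    also have "\<dots> < \<delta>" using 6 t by (simp add: pos_divide_less_eq)
    finally show "\<exists>y\<in>range ?A. dist y v < \<delta>" by blast
  qed
  ultimately show "v \<in> range ?A" by simp
qed

text \<open>
  Conversely, a vector in the range of the differential is the velocity of the image of a straight
  line in the parameter domain.
\<close>

lemma tangent_space_chart:
  fixes \<phi> :: "real ^ 'p::finite \<Rightarrow> real ^ 'i::finite" and \<phi>' :: "real ^ 'p \<Rightarrow> (real ^ 'p) \<Rightarrow>\<^sub>L (real ^ 'i)"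
  assumes U: "open U" and W: "open W" "u0 \<in> W" and hom: "homeomorphism W (S \<inter> U) \<phi> \<psi>"
    and der: "\<And>u. u \<in> W \<Longrightarrow> (\<phi> has_derivative blinfun_apply (\<phi>' u)) (at u)"
    and cont: "continuous_on W \<phi>'" and inj: "inj (blinfun_apply (\<phi>' u0))"
  shows "tangent_space S (\<phi> u0) = range (\<phi>' u0)"
proof
  show "tangent_space S (\<phi> u0) \<subseteq> range (\<phi>' u0)"
    by (rule tangent_space_chart_subset[OF assms])
  show "range (\<phi>' u0) \<subseteq> tangent_space S (\<phi> u0)"
  proof
    fix v assume "v \<in> range (\<phi>' u0)"
    then obtain w where w: "v = \<phi>' u0 w" by auto
    define l where "l t = u0 + t *\<^sub>R w" for t
    have "\<forall>\<^sub>F t in at 0. l t \<in> W"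
    proof (rule topological_tendstoD)
      show "(l \<longlongrightarrow> u0) (at 0)" unfolding l_def by (auto intro!: tendsto_eq_intros)
    qed (use W in auto)
    then obtain e where e: "e > 0" "\<And>t. t \<noteq> 0 \<Longrightarrow> \<bar>t\<bar> < e \<Longrightarrow> l t \<in> W"
      unfolding eventually_at by auto
    have lW: "l t \<in> W" if "t \<in> {-e<..<e}" for t
      using e(2)[of t] that W(2) by (cases "t = 0") (auto simp: l_def)
    have d: "((\<lambda>t. \<phi> (l t)) has_vector_derivative \<phi>' (l t) w) (at t)" if "t \<in> {-e<..<e}" for t
    proof -
      have "(l has_derivative (\<lambda>s. s *\<^sub>R w)) (at t)" unfolding l_def by (auto intro!: derivative_eq_intros)
      then have "((\<lambda>t. \<phi> (l t)) has_derivative (\<lambda>s. \<phi>' (l t) (s *\<^sub>R w))) (at t)"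
        by (rule has_derivative_compose) (rule der[OF lW[OF that]])
      then show ?thesis by (simp add: has_vector_derivative_def blinfun.scaleR_right)
    qed
    have "continuous_on {-e<..<e} l" unfolding l_def by (intro continuous_intros)
    then have "continuous_on {-e<..<e} (\<lambda>t. \<phi>' (l t))"
      by (rule continuous_on_compose2[OF cont]) (use lW in auto)
    then have "continuous_on {-e<..<e} (\<lambda>t. \<phi>' (l t) w)" by (intro continuous_intros)
    then have C1: "(\<lambda>t. \<phi> (l t)) C1_differentiable_on {-e<..<e}"
      unfolding C1_differentiable_on_def by (intro exI[of _ "\<lambda>t. \<phi>' (l t) w"] conjI ballI d)
    have img: "(\<lambda>t. \<phi> (l t)) ` {-e<..<e} \<subseteq> S"
    proof (intro image_subsetI)
      fix t assume "t \<in> {-e<..<e}"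
      then have "\<phi> (l t) \<in> \<phi> ` W" using lW by (intro imageI)
      then show "\<phi> (l t) \<in> S" unfolding homeomorphism_image1[OF hom] by simp
    qed
    have start: "\<phi> (l 0) = \<phi> u0" by (simp add: l_def)
    have "((\<lambda>t. \<phi> (l t)) has_vector_derivative v) (at 0)"
      using d[of 0] e w by (simp add: l_def)
    then show "v \<in> tangent_space S (\<phi> u0)"
      unfolding tangent_space_def
      by (intro CollectI exI[of _ "\<lambda>t. \<phi> (l t)"] exI[of _ e] conjI e(1) C1 img start)
  qed
qed


section \<open>Comparison of measures and integrals\<close>

lemma ennreal_le_of_forall_mult_le:
  fixes a b :: ennreal
  assumes "\<And>\<eta>::real. \<eta> > 1 \<Longrightarrow> a \<le> ennreal \<eta> * b"
  shows "a \<le> b"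
proof (rule ennreal_le_epsilon)
  fix e :: real assume e: "e > 0" "b < top"
  define r where "r = enn2real b"
  have b: "b = ennreal r" "r \<ge> 0" using e(2) by (simp_all add: r_def)
  have "a \<le> ennreal (1 + e / (r + 1)) * b" using e b by (intro assms) auto
  also have "\<dots> = ennreal ((1 + e / (r + 1)) * r)" using b e by (simp add: ennreal_mult)
  also have "\<dots> \<le> ennreal (r + e)"
  proof (rule ennreal_leI)
    have "e / (r + 1) * r \<le> e" using b e by (simp add: pos_divide_le_eq mult_left_mono)
    then show "(1 + e / (r + 1)) * r \<le> r + e" by (simp add: algebra_simps)
  qed
  also have "\<dots> = b + ennreal e" using b e by simp
  finally show "a \<le> b + ennreal e" .
qed

text \<open>
  Countably many of the given neighbourhoods cover \<open>E\<close> by Lindelof's theorem; made disjoint, they cut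
  \<open>E\<close> into pieces on which the estimate holds with the factor \<open>\<eta>\<close>, which then tends to \<open>1\<close>.
\<close>

lemma measure_le_of_locally_le:
  fixes N M :: "'a::euclidean_space measure"
  assumes N: "sets N = sets borel" and M: "sets M = sets borel" and E: "E \<in> sets borel"
    and loc: "\<And>x \<eta>. x \<in> E \<Longrightarrow> \<eta> > (1::real) \<Longrightarrow> \<exists>U. open U \<and> x \<in> U \<and>
      (\<forall>A\<in>sets borel. A \<subseteq> E \<inter> U \<longrightarrow> emeasure N A \<le> ennreal \<eta> * emeasure M A)"
  shows "emeasure N E \<le> emeasure M E"
proof (rule ennreal_le_of_forall_mult_le)
  fix \<eta> :: real assume \<eta>: "\<eta> > 1"
  define \<U> where "\<U> = {U. open U \<and> (\<forall>A\<in>sets borel. A \<subseteq> E \<inter> U \<longrightarrow> emeasure N A \<le> ennreal \<eta> * emeasure M A)}"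
  obtain \<C> where \<C>: "\<C> \<subseteq> \<U>" "countable \<C>" "\<Union>\<C> = \<Union>\<U>"
    by (rule Lindelof[of \<U>]) (auto simp: \<U>_def)
  have cover: "E \<subseteq> \<Union>\<C>"
  proof
    fix x assume "x \<in> E"
    then have "\<exists>U\<in>\<U>. x \<in> U" using loc[OF _ \<eta>, of x] by (auto simp: \<U>_def)
    then show "x \<in> \<Union>\<C>" using \<C>(3) by auto
  qed
  show "emeasure N E \<le> ennreal \<eta> * emeasure M E"
  proof (cases "E = {}")
    case False
    then have ne: "\<C> \<noteq> {}" using cover by auto
    define U where "U = from_nat_into \<C>"
    have U: "U n \<in> \<U>" for n using \<C>(1) from_nat_into[OF ne] by (auto simp: U_def)
    have UU: "(\<Union>n. U n) = \<Union>\<C>" using range_from_nat_into[OF ne \<C>(2)] by (simp add: U_def)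
    have Ub: "U n \<in> sets borel" for n using U[of n] by (auto simp: \<U>_def)
    define D where "D n = E \<inter> disjointed U n" for n
    have db: "disjointed U n \<in> sets borel" for n
      using sets.range_disjointed_sets[of U borel] Ub by auto
    have Db: "D n \<in> sets borel" for n using E db by (auto simp: D_def)
    have disj: "disjoint_family D"
      using disjoint_family_disjointed[of U] unfolding D_def disjoint_family_on_def by blast
    have UD: "(\<Union>n. D n) = E"
      using cover UU UN_disjointed_eq[of U] by (auto simp: D_def)
    have le: "emeasure N (D n) \<le> ennreal \<eta> * emeasure M (D n)" for n
    proof -
      have "D n \<subseteq> E \<inter> U n" using disjointed_subset[of U n] by (auto simp: D_def)
      then show ?thesis using U[of n] Db[of n] by (auto simp: \<U>_def)
    qed
    have "emeasure N E = (\<Sum>n. emeasure N (D n))"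
      using suminf_emeasure[of D N] Db disj by (simp add: N UD image_subset_iff)
    also have "\<dots> \<le> (\<Sum>n. ennreal \<eta> * emeasure M (D n))" by (intro suminf_le le summableI)
    also have "\<dots> = ennreal \<eta> * emeasure M E"
      using suminf_emeasure[of D M] Db disj by (simp add: M UD image_subset_iff)
    finally show ?thesis .
  qed simp
qed

text \<open>
  The function \<open>f\<close> may be arbitrary, because the integral is the supremum over the simple functions
  below \<open>f\<close> and for those the claim only concerns the measure of Borel subsets of \<open>S\<close>.  The integrands
  of the theorem depend on a chosen frame at every point, so this spares a discussion of their
  measurability.
\<close>

lemma set_nn_integral_le_of_measure_le:
  fixes f \<theta> :: "'a::euclidean_space \<Rightarrow> ennreal"
  assumes N: "sets N = sets borel" and M: "sets M = sets borel"
    and \<theta>: "(\<lambda>x. \<theta> x * indicator S x) \<in> borel_measurable borel"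
    and le: "\<And>E. E \<in> sets borel \<Longrightarrow> E \<subseteq> S \<Longrightarrow>
      emeasure N E \<le> emeasure (density M (\<lambda>x. \<theta> x * indicator S x)) E"
  shows "(\<integral>\<^sup>+ x\<in>S. f x \<partial>N) \<le> (\<integral>\<^sup>+ x\<in>S. \<theta> x * f x \<partial>M)"
proof -
  let ?\<theta> = "\<lambda>x. \<theta> x * indicator S x" and ?g = "\<lambda>x. f x * indicator S x"
  let ?D = "density M ?\<theta>"
  have spN: "space N = UNIV" using sets_eq_imp_space_eq[OF N] by simp
  have spM: "space M = UNIV" using sets_eq_imp_space_eq[OF M] by simp
  have \<theta>M [measurable]: "?\<theta> \<in> borel_measurable M" using \<theta> by (simp add: measurable_cong_sets[OF M])
  have "(\<integral>\<^sup>+ x. ?g x \<partial>N) = (SUP s\<in>{s. simple_function N s \<and> s \<le> ?g}. integral\<^sup>S N s)"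
    by (simp add: nn_integral_def)
  also have "\<dots> \<le> (\<integral>\<^sup>+ x. \<theta> x * f x * indicator S x \<partial>M)"
  proof (rule SUP_least)
    fix s assume "s \<in> {s. simple_function N s \<and> s \<le> ?g}"
    then have s: "simple_function N s" "\<And>x. s x \<le> ?g x" by (auto simp: le_fun_def)
    have sM: "simple_function ?D s" using s(1) by (simp add: simple_function_def spN spM N M)
    have "integral\<^sup>S N s = (\<Sum>y\<in>s ` UNIV. y * emeasure N (s -` {y}))"
      by (simp add: simple_integral_def spN)
    also have "\<dots> \<le> (\<Sum>y\<in>s ` UNIV. y * emeasure ?D (s -` {y}))"
    proof (rule sum_mono)
      fix y assume "y \<in> s ` UNIV"
      show "y * emeasure N (s -` {y}) \<le> y * emeasure ?D (s -` {y})"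
      proof (cases "y = 0")
        case False
        have "x \<in> S" if "s x = y" for x
          using s(2)[of x] that False by (cases "x \<in> S") auto
        moreover have "s -` {y} \<in> sets borel"
          using simple_functionD(2)[OF s(1), of "{y}"] by (simp add: spN N)
        ultimately show ?thesis by (intro mult_left_mono le) auto
      qed simp
    qed
    also have "\<dots> = integral\<^sup>S ?D s" by (simp add: simple_integral_def spM)
    also have "\<dots> = (\<integral>\<^sup>+ x. s x \<partial>?D)" by (simp add: nn_integral_eq_simple_integral[OF sM])
    also have "\<dots> = (\<integral>\<^sup>+ x. ?\<theta> x * s x \<partial>M)"
      using borel_measurable_simple_function[OF sM] by (intro nn_integral_density) auto
    also have "\<dots> \<le> (\<integral>\<^sup>+ x. \<theta> x * f x * indicator S x \<partial>M)"
    proof (rule nn_integral_mono)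
      fix x
      show "?\<theta> x * s x \<le> \<theta> x * f x * indicator S x"
        using mult_left_mono[OF s(2)[of x], of "?\<theta> x"] by (auto simp: indicator_def)
    qed
    finally show "integral\<^sup>S N s \<le> (\<integral>\<^sup>+ x. \<theta> x * f x * indicator S x \<partial>M)" .
  qed
  finally show ?thesis by simp
qed

text \<open>
  For arbitrary \<open>f\<close> one inequality holds by the definition as a supremum; applied to the reciprocal
  factor it yields the other one.
\<close>

lemma nn_integral_cmult_nonmeasurable:
  fixes f :: "'a \<Rightarrow> ennreal" and c :: real
  assumes c: "c > 0"
  shows "(\<integral>\<^sup>+ x. ennreal c * f x \<partial>M) = ennreal c * (\<integral>\<^sup>+ x. f x \<partial>M)"
proof -
  have ge: "ennreal c * (\<integral>\<^sup>+ x. f x \<partial>M) \<le> (\<integral>\<^sup>+ x. ennreal c * f x \<partial>M)" for c :: real and f :: "'a \<Rightarrow> ennreal"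
  proof -
    have "ennreal c * (\<integral>\<^sup>+ x. f x \<partial>M) = (SUP s\<in>{s. simple_function M s \<and> s \<le> f}. ennreal c * integral\<^sup>S M s)"
      unfolding nn_integral_def by (rule SUP_mult_left_ennreal)
    also have "\<dots> \<le> (\<integral>\<^sup>+ x. ennreal c * f x \<partial>M)"
    proof (rule SUP_least)
      fix s assume "s \<in> {s. simple_function M s \<and> s \<le> f}"
      then have s: "simple_function M s" "\<And>x. s x \<le> f x" by (auto simp: le_fun_def)
      have "ennreal c * integral\<^sup>S M s = (\<integral>\<^sup>+ x. ennreal c * s x \<partial>M)"
        by (subst nn_integral_cmult)
           (simp_all add: nn_integral_eq_simple_integral[OF s(1)] borel_measurable_simple_function[OF s(1)])
      also have "\<dots> \<le> (\<integral>\<^sup>+ x. ennreal c * f x \<partial>M)"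
        by (intro nn_integral_mono mult_left_mono s(2)) simp
      finally show "ennreal c * integral\<^sup>S M s \<le> (\<integral>\<^sup>+ x. ennreal c * f x \<partial>M)" .
    qed
    finally show ?thesis .
  qed
  have inv: "ennreal (1 / c) * ennreal c = 1" "ennreal c * ennreal (1 / c) = 1"
    using c by (simp_all add: ennreal_mult[symmetric])
  have "ennreal (1 / c) * (\<integral>\<^sup>+ x. ennreal c * f x \<partial>M) \<le> (\<integral>\<^sup>+ x. f x \<partial>M)"
    using ge[of "1 / c" "\<lambda>x. ennreal c * f x"] by (simp add: mult.assoc[symmetric] inv)
  then have "ennreal c * (ennreal (1 / c) * (\<integral>\<^sup>+ x. ennreal c * f x \<partial>M)) \<le> ennreal c * (\<integral>\<^sup>+ x. f x \<partial>M)"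
    by (rule mult_left_mono) simp
  then have "(\<integral>\<^sup>+ x. ennreal c * f x \<partial>M) \<le> ennreal c * (\<integral>\<^sup>+ x. f x \<partial>M)"
    by (simp add: mult.assoc[symmetric] inv)
  then show ?thesis using ge by (rule antisym)
qed


section \<open>Change of metric on a submanifold\<close>

lemma riem_vol_eq_hausdorff_measure:
  fixes h :: "'a::euclidean_space \<Rightarrow> 'a \<Rightarrow> 'a \<Rightarrow> real"
  shows "riem_vol h m = hausdorff_measure (riem_dist h) m"
  by (simp add: riem_vol_def hausdorff_measure_def)

lemma sets_riem_vol [simp]:
  fixes h :: "'a::euclidean_space \<Rightarrow> 'a \<Rightarrow> 'a \<Rightarrow> real"
  shows "sets (riem_vol h m) = sets borel"
  by (simp add: riem_vol_eq_hausdorff_measure)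

lemma emeasure_riem_vol:
  fixes h :: "'a::euclidean_space \<Rightarrow> 'a \<Rightarrow> 'a \<Rightarrow> real"
  shows "riemannian_metric h \<Longrightarrow> A \<in> sets borel \<Longrightarrow> emeasure (riem_vol h m) A = hausdorff_outer (riem_dist h) m A"
  by (simp add: riem_vol_eq_hausdorff_measure emeasure_hausdorff_measure compactly_separating_riem_dist)

lemma C1_submanifold_chart:
  fixes S :: "'a::real_normed_vector set"
  assumes "C1_submanifold TYPE('p::finite) \<Omega> S" "x \<in> S"
  obtains U W and \<phi> :: "real ^ 'p \<Rightarrow> 'a" and \<psi> \<phi>' u0 where
    "open U" "open W" "u0 \<in> W" "\<phi> u0 = x" "x \<in> U" "homeomorphism W (S \<inter> U) \<phi> \<psi>"
    "\<And>u. u \<in> W \<Longrightarrow> (\<phi> has_derivative blinfun_apply (\<phi>' u)) (at u)"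
    "\<And>u. u \<in> W \<Longrightarrow> inj (blinfun_apply (\<phi>' u))" "continuous_on W \<phi>'"
proof -
  obtain U W and \<phi> :: "real ^ 'p \<Rightarrow> 'a" and \<psi> \<phi>' where
    *: "open U" "x \<in> U" "open W" "homeomorphism W (S \<inter> U) \<phi> \<psi>"
      "\<forall>u\<in>W. (\<phi> has_derivative blinfun_apply (\<phi>' u)) (at u) \<and> inj (blinfun_apply (\<phi>' u))"
      "continuous_on W \<phi>'"
    using assms unfolding C1_submanifold_def by metis
  have x: "x \<in> S \<inter> U" using assms(2) *(2) by simp
  have "\<psi> x \<in> W" using homeomorphism_image2[OF *(4)] x by (metis imageI)
  moreover have "\<phi> (\<psi> x) = x" by (rule homeomorphism_apply2[OF *(4) x])
  ultimately show thesis using that[OF *(1,3) _ _ *(2,4)] *(5,6) by metis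
qed

lemma borel_open_Int_continuous_vimage:
  fixes \<phi> :: "'a::euclidean_space \<Rightarrow> 'b::euclidean_space"
  assumes "continuous_on B \<phi>" "open B" "E \<in> sets borel"
  shows "B \<inter> \<phi> -` E \<in> sets borel"
proof -
  have "\<phi> \<in> borel_measurable (restrict_space borel B)"
    by (rule borel_measurable_continuous_on_restrict) fact
  then have "\<phi> -` E \<inter> space (restrict_space borel B) \<in> sets (restrict_space borel B)"
    using assms(3) by (rule measurable_sets)
  then show ?thesis
    using assms(2) by (auto simp: sets_restrict_space_iff space_restrict_space Int_commute)
qed

lemma borel_continuous_image_open:
  fixes \<phi> :: "'a::euclidean_space \<Rightarrow> 'b::euclidean_space"
  assumes W: "open W" and "continuous_on W \<phi>"
  shows "\<phi> ` W \<in> sets borel"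
proof -
  obtain C where C: "\<And>n::nat. compact (C n)" "\<And>n. C n \<subseteq> W" "\<Union>(range C) = W"
    using open_Union_compact_subsets[OF W] by metis
  have "compact (\<phi> ` C n)" for n
    by (intro compact_continuous_image C(1) continuous_on_subset[OF assms(2) C(2)])
  then have "(\<Union>n. \<phi> ` C n) \<in> sets borel" by (intro sets.countable_UN) (auto intro: borel_compact)
  moreover have "\<phi> ` W = (\<Union>n. \<phi> ` C n)" unfolding C(3)[symmetric] by (simp add: image_UN)
  ultimately show ?thesis by simp
qed

text \<open>
  Images of open sets under charts are countable unions of compact sets, and countably many of them
  make up \<open>S\<close>.
\<close>

lemma C1_submanifold_borel:
  fixes S :: "'a::euclidean_space set"
  assumes S: "C1_submanifold TYPE('p::finite) \<Omega> S"
  shows "S \<in> sets borel"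
proof -
  define \<U> where "\<U> = {U. open U \<and> S \<inter> U \<in> sets borel}"
  obtain \<C> where \<C>: "\<C> \<subseteq> \<U>" "countable \<C>" "\<Union>\<C> = \<Union>\<U>"
    by (rule Lindelof[of \<U>]) (auto simp: \<U>_def)
  have "S \<subseteq> \<Union>\<U>"
  proof
    fix x assume "x \<in> S"
    from S this show "x \<in> \<Union>\<U>"
    proof (rule C1_submanifold_chart)
      fix U W and \<phi> :: "real ^ 'p \<Rightarrow> 'a" and \<psi>
      assume *: "open U" "open W" "x \<in> U" "homeomorphism W (S \<inter> U) \<phi> \<psi>"
      have "\<phi> ` W \<in> sets borel"
        by (rule borel_continuous_image_open[OF *(2) homeomorphism_cont1[OF *(4)]])
      then have "U \<in> \<U>" using *(1) by (simp add: \<U>_def homeomorphism_image1[OF *(4)])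
      then show ?thesis using *(3) by blast
    qed
  qed
  then have "S = (\<Union>U\<in>\<C>. S \<inter> U)" using \<C>(3) by auto
  moreover have "(\<Union>U\<in>\<C>. S \<inter> U) \<in> sets borel"
    using \<C>(1,2) by (intro sets.countable_UN') (auto simp: \<U>_def)
  ultimately show ?thesis by simp
qed

text \<open>
  The orthonormal frame chosen in the definition of \<open>tangent_pvector\<close>.
\<close>

definition tangent_frame :: "('a::real_normed_vector \<Rightarrow> 'a \<Rightarrow> 'a \<Rightarrow> real) \<Rightarrow> 'a set \<Rightarrow> 'a \<Rightarrow> 'a ^ 'p::finite" where
  "tangent_frame h S x = (SOME t. orthonormal (h x) t \<and> span (range (\<lambda>a. t $ a)) = tangent_space S x)"

lemma tangent_pvector_eq_wedge:
  "(tangent_pvector h S x :: ('i::finite, 'p::finite) pvec) = wedge (tangent_frame h S x)"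
  by (simp add: tangent_pvector_def tangent_frame_def orthonormal_def)

lemma tangent_frame_chart:
  fixes S :: "(real ^ 'i::finite) set" and \<phi> :: "real ^ 'p::finite \<Rightarrow> real ^ 'i"
    and \<phi>' :: "real ^ 'p \<Rightarrow> (real ^ 'p) \<Rightarrow>\<^sub>L (real ^ 'i)"
  assumes h: "inner_product (h (\<phi> u))" and T: "tangent_space S (\<phi> u) = range (blinfun_apply (\<phi>' u))"
    and inj: "inj (blinfun_apply (\<phi>' u))"
  shows "orthonormal (h (\<phi> u)) (tangent_frame h S (\<phi> u) :: (real ^ 'i) ^ 'p)"
    and "span (range (\<lambda>a. (tangent_frame h S (\<phi> u) :: (real ^ 'i) ^ 'p) $ a)) = tangent_space S (\<phi> u)"
proof -
  have lin: "linear (blinfun_apply (\<phi>' u))"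
    by (rule bounded_linear.linear[OF blinfun.bounded_linear_right])
  have "subspace (tangent_space S (\<phi> u))"
    unfolding T by (intro linear_subspace_image[OF lin] subspace_UNIV)
  moreover have "dim (tangent_space S (\<phi> u)) = CARD('p)"
    unfolding T using dim_image_eq[OF lin, of UNIV] inj by (simp add: dim_UNIV)
  ultimately obtain t :: "(real ^ 'i) ^ 'p" where
    "orthonormal (h (\<phi> u)) t \<and> span (range (\<lambda>a. t $ a)) = tangent_space S (\<phi> u)"
    using orthonormal_basis_exists[OF h] by metis
  then have "orthonormal (h (\<phi> u)) (tangent_frame h S (\<phi> u) :: (real ^ 'i) ^ 'p) \<and>
     span (range (\<lambda>a. (tangent_frame h S (\<phi> u) :: (real ^ 'i) ^ 'p) $ a)) = tangent_space S (\<phi> u)"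
    unfolding tangent_frame_def by (rule someI)
  then show "orthonormal (h (\<phi> u)) (tangent_frame h S (\<phi> u) :: (real ^ 'i) ^ 'p)"
    and "span (range (\<lambda>a. (tangent_frame h S (\<phi> u) :: (real ^ 'i) ^ 'p) $ a)) = tangent_space S (\<phi> u)"
    by auto
qed

text \<open>
  Both Gram determinants pick up the same factor under a change of the frame, so the quotient of
  volumes on a subspace can be computed in any frame.
\<close>

lemma gram_ratio:
  fixes t b :: "'a::real_vector ^ 'p::finite"
  assumes h1: "inner_product h1" and h2: "inner_product h2" and t: "orthonormal h2 t"
    and b: "\<And>a. b $ a \<in> span (range (\<lambda>a. t $ a))"
  shows "sqrt (gram h1 b) = sqrt (gram h1 t) * sqrt (gram h2 b)"
proof -
  obtain M where M: "b = combine M t" using combine_orthonormal[OF h2 t b] by metis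
  show ?thesis
    unfolding M gram_combine[OF h1] gram_combine[OF h2] gram_orthonormal[OF t] by (simp add: real_sqrt_mult)
qed

lemma continuous_on_gram_chart:
  fixes \<phi> :: "real ^ 'p::finite \<Rightarrow> real ^ 'i::finite" and \<phi>' :: "real ^ 'p \<Rightarrow> (real ^ 'p) \<Rightarrow>\<^sub>L (real ^ 'i)"
  assumes h: "riemannian_metric h" and \<phi>: "continuous_on W \<phi>" "continuous_on W \<phi>'"
  shows "continuous_on W (\<lambda>u. sqrt (gram (h (\<phi> u)) (frame_image (\<phi>' u))))"
proof -
  have "continuous_on W (\<lambda>u. h (\<phi> u) (\<phi>' u (axis a 1)) (\<phi>' u (axis b 1)))" for a b
    by (intro riemannian_metric_continuous_on[OF h] \<phi>(1) continuous_intros \<phi>(2))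
  then show ?thesis
    unfolding gram_def det_def frame_image_def vec_lambda_beta
    by (intro continuous_intros)
qed

text \<open>
  The \<open>h1\<close>-norm of the \<open>h2\<close>-unit tangent \<open>p\<close>-vector of \<open>S\<close> at \<open>x\<close>: the density of the surface measure
  of \<open>h1\<close> with respect to that of \<open>h2\<close>.  The first argument fixes the dimension.
\<close>

definition area_ratio ::
    "'p::finite itself \<Rightarrow> (real ^ 'i::finite \<Rightarrow> real ^ 'i \<Rightarrow> real ^ 'i \<Rightarrow> real) \<Rightarrow>
     (real ^ 'i \<Rightarrow> real ^ 'i \<Rightarrow> real ^ 'i \<Rightarrow> real) \<Rightarrow> (real ^ 'i) set \<Rightarrow> real ^ 'i \<Rightarrow> real" where
  "area_ratio _ h1 h2 S x = sqrt (gram (h1 x) (tangent_frame h2 S x :: (real ^ 'i) ^ 'p))"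

lemma area_ratio_chart:
  fixes S :: "(real ^ 'i::finite) set" and \<phi> :: "real ^ 'p::finite \<Rightarrow> real ^ 'i"
    and \<phi>' :: "real ^ 'p \<Rightarrow> (real ^ 'p) \<Rightarrow>\<^sub>L (real ^ 'i)"
  assumes h1: "riemannian_metric h1" and h2: "riemannian_metric h2"
    and T: "tangent_space S (\<phi> u) = range (blinfun_apply (\<phi>' u))" and inj: "inj (blinfun_apply (\<phi>' u))"
  shows "sqrt (gram (h1 (\<phi> u)) (frame_image (\<phi>' u))) =
    area_ratio TYPE('p) h1 h2 S (\<phi> u) * sqrt (gram (h2 (\<phi> u)) (frame_image (\<phi>' u)))"
  unfolding area_ratio_def
proof (rule gram_ratio)
  note tf = tangent_frame_chart[where h = h2 and \<phi> = \<phi> and \<phi>' = \<phi>', OF riemannian_metric_inner_product[OF h2] T inj]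
  show "orthonormal (h2 (\<phi> u)) (tangent_frame h2 S (\<phi> u) :: (real ^ 'i) ^ 'p)" by (rule tf(1))
  show "frame_image (\<phi>' u) $ a \<in> span (range (\<lambda>a. (tangent_frame h2 S (\<phi> u) :: (real ^ 'i) ^ 'p) $ a))" for a
    unfolding tf(2) T by (simp add: frame_image_def)
qed (rule riemannian_metric_inner_product, fact)+

text \<open>
  Both Hausdorff measures are compared with the measure of the parameter set, which costs a factor
  \<open>\<eta>\<close> each; the area ratio is the quotient of the two Jacobians and therefore continuous.
\<close>

lemma hausdorff_locally_comparable:
  fixes S :: "(real ^ 'i::finite) set"
  assumes S: "C1_submanifold TYPE('p::finite) \<Omega> S" and x: "x \<in> S"
    and h1: "riemannian_metric h1" and h2: "riemannian_metric h2" and \<eta>: "\<eta> > 1"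
  defines "\<theta> \<equiv> area_ratio TYPE('p) h1 h2 S"
  obtains V where "open V" "x \<in> V" "continuous_on (S \<inter> V) \<theta>" "\<And>y. y \<in> S \<inter> V \<Longrightarrow> 0 < \<theta> y"
    "\<And>y. y \<in> S \<inter> V \<Longrightarrow> \<theta> x \<le> \<eta> * \<theta> y"
    "\<And>E. E \<in> sets borel \<Longrightarrow> E \<subseteq> S \<inter> V \<Longrightarrow>
       hausdorff_outer (riem_dist h1) CARD('p) E \<le> ennreal (\<eta>\<^sup>2 * \<theta> x) * hausdorff_outer (riem_dist h2) CARD('p) E"
proof -
  obtain U W and \<phi> :: "real ^ 'p \<Rightarrow> real ^ 'i" and \<psi> \<phi>' u0 where
    U: "open U" and W: "open W" "u0 \<in> W" and u0: "\<phi> u0 = x" and "x \<in> U"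
    and hom: "homeomorphism W (S \<inter> U) \<phi> \<psi>"
    and der: "\<And>u. u \<in> W \<Longrightarrow> (\<phi> has_derivative blinfun_apply (\<phi>' u)) (at u)"
    and inj: "\<And>u. u \<in> W \<Longrightarrow> inj (blinfun_apply (\<phi>' u))" and cont: "continuous_on W \<phi>'"
    by (rule C1_submanifold_chart[OF S x]) (rule that)
  define J1 where "J1 u = sqrt (gram (h1 (\<phi> u)) (frame_image (\<phi>' u)))" for u
  define J2 where "J2 u = sqrt (gram (h2 (\<phi> u)) (frame_image (\<phi>' u)))" for u
  have c\<phi>: "continuous_on W \<phi>" by (rule homeomorphism_cont1[OF hom])
  have inj_\<phi>: "inj_on \<phi> W" using homeomorphism_apply1[OF hom] by (metis inj_on_def)
  have cJ: "continuous_on W J1" "continuous_on W J2"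
    unfolding J1_def J2_def by (intro continuous_on_gram_chart h1 h2 c\<phi> cont)+
  have Jpos: "J1 u > 0" "J2 u > 0" if "u \<in> W" for u
    unfolding J1_def J2_def
    by (rule chart_hausdorff[OF h1 W(1) that der cont inj[OF that] inj_\<phi> \<eta>], simp_all)
       (rule chart_hausdorff[OF h2 W(1) that der cont inj[OF that] inj_\<phi> \<eta>], simp_all)
  have T: "tangent_space S (\<phi> u) = range (blinfun_apply (\<phi>' u))" if "u \<in> W" for u
    by (rule tangent_space_chart[OF U W(1) that hom der cont inj[OF that]])
  have J: "J1 u = \<theta> (\<phi> u) * J2 u" if "u \<in> W" for u
    unfolding J1_def J2_def \<theta>_def
    by (rule area_ratio_chart[where \<phi> = \<phi> and \<phi>' = \<phi>', OF h1 h2 T[OF that] inj[OF that]])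
  have \<theta>: "\<theta> (\<phi> u) = J1 u / J2 u" "\<theta> (\<phi> u) > 0" if "u \<in> W" for u
  proof -
    show "\<theta> (\<phi> u) = J1 u / J2 u" using J[OF that] Jpos(2)[OF that] by simp
    then show "\<theta> (\<phi> u) > 0" using Jpos[OF that] by simp
  qed
  have cq: "continuous_on W (\<lambda>u. J1 u / J2 u)"
    using Jpos(2) by (intro continuous_on_divide cJ) (metis less_irrefl)
  obtain r1 where r1: "r1 > 0" "ball u0 r1 \<subseteq> W"
    "\<And>F. F \<in> sets borel \<Longrightarrow> F \<subseteq> ball u0 r1 \<Longrightarrow>
       hausdorff_outer (riem_dist h1) CARD('p) (\<phi> ` F) \<le> ennreal (\<eta> * J1 u0) * hausdorff_cart F"
    by (rule chart_hausdorff[OF h1 W der cont inj[OF W(2)] inj_\<phi> \<eta>, folded J1_def]) (assumption, rule that)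
  obtain r2 where r2: "r2 > 0" "ball u0 r2 \<subseteq> W"
    "\<And>F. F \<in> sets borel \<Longrightarrow> F \<subseteq> ball u0 r2 \<Longrightarrow>
       ennreal (J2 u0) * hausdorff_cart F \<le> ennreal \<eta> * hausdorff_outer (riem_dist h2) CARD('p) (\<phi> ` F)"
    by (rule chart_hausdorff[OF h2 W der cont inj[OF W(2)] inj_\<phi> \<eta>, folded J2_def]) (assumption, rule that)
  have "isCont (\<lambda>u. J1 u / J2 u) u0" using cq W by (simp add: continuous_on_eq_continuous_at)
  then have "((\<lambda>u. J1 u / J2 u) \<longlongrightarrow> J1 u0 / J2 u0) (at u0)" by (simp add: isCont_def)
  moreover have "J1 u0 / J2 u0 / \<eta> < J1 u0 / J2 u0"
    using \<eta> Jpos[OF W(2)] by (simp add: divide_less_eq)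
  ultimately have "\<forall>\<^sub>F u in at u0. J1 u0 / J2 u0 / \<eta> < J1 u / J2 u"
    by (rule order_tendstoD)
  then obtain r3 where r3: "r3 > 0" "\<And>u. u \<noteq> u0 \<Longrightarrow> dist u u0 < r3 \<Longrightarrow> J1 u0 / J2 u0 / \<eta> < J1 u / J2 u"
    unfolding eventually_at by auto
  define r where "r = Min {r1, r2, r3}"
  have r: "r > 0" "r \<le> r1" "r \<le> r2" "r \<le> r3" using r1 r2 r3 by (auto simp: r_def)
  have rW: "ball u0 r \<subseteq> W" using r1(2) r(2) by auto
  obtain V where V: "open V" "\<phi> u0 \<in> V" "V \<subseteq> U" "S \<inter> V = \<phi> ` ball u0 r"
    using homeomorphism_small_image[OF U W(1) hom rW] centre_in_ball r(1) by metis
  show thesis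
  proof (rule that[OF V(1)])
    show "x \<in> V" using V(2) u0 by simp
    have "continuous_on (S \<inter> V) (\<lambda>y. J1 (\<psi> y) / J2 (\<psi> y))"
    proof (rule continuous_on_compose2[OF cq])
      show "continuous_on (S \<inter> V) \<psi>"
        using V(3) by (intro continuous_on_subset[OF homeomorphism_cont2[OF hom]]) auto
      show "\<psi> ` (S \<inter> V) \<subseteq> W" using homeomorphism_image2[OF hom] V(3) by blast
    qed
    moreover have "\<theta> y = J1 (\<psi> y) / J2 (\<psi> y)" if "y \<in> S \<inter> V" for y
    proof -
      have "y \<in> \<phi> ` ball u0 r" using that V(4) by simp
      then obtain u where u: "u \<in> ball u0 r" "y = \<phi> u" by blast
      then have uW: "u \<in> W" using rW by blast
      show ?thesis unfolding u(2) homeomorphism_apply1[OF hom uW] by (rule \<theta>(1)[OF uW])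
    qed
    ultimately show "continuous_on (S \<inter> V) \<theta>"
      by (simp only: continuous_on_cong[of "S \<inter> V" "S \<inter> V" \<theta>])
  next
    fix y assume "y \<in> S \<inter> V"
    then have "y \<in> \<phi> ` ball u0 r" using V(4) by simp
    then obtain u where u: "u \<in> ball u0 r" "y = \<phi> u" by blast
    then have uW: "u \<in> W" using rW by blast
    show "0 < \<theta> y" unfolding u(2) by (rule \<theta>(2)[OF uW])
    show "\<theta> x \<le> \<eta> * \<theta> y"
    proof (cases "u = u0")
      case True
      then show ?thesis using \<theta>(2)[OF W(2)] \<eta> u u0 by simp
    next
      case False
      then have "J1 u0 / J2 u0 / \<eta> < J1 u / J2 u" using r3(2)[OF False] u(1) r(4) by (simp add: dist_commute)
      then have "\<theta> (\<phi> u0) / \<eta> < \<theta> (\<phi> u)" unfolding \<theta>(1)[OF uW] \<theta>(1)[OF W(2)] .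
      then show ?thesis using \<eta> unfolding u(2) u0 by (simp add: pos_divide_less_eq mult.commute less_imp_le)
    qed
  next
    fix E :: "(real ^ 'i) set" assume E: "E \<in> sets borel" "E \<subseteq> S \<inter> V"
    let ?H1 = "hausdorff_outer (riem_dist h1) CARD('p)" and ?H2 = "hausdorff_outer (riem_dist h2) CARD('p)"
    define F where "F = ball u0 r \<inter> \<phi> -` E"
    have F: "F \<in> sets borel"
      unfolding F_def by (intro borel_open_Int_continuous_vimage continuous_on_subset[OF c\<phi> rW] E) simp
    have \<phi>F: "\<phi> ` F = E"
    proof
      show "E \<subseteq> \<phi> ` F"
      proof
        fix y assume y: "y \<in> E"
        then have "y \<in> \<phi> ` ball u0 r" using E(2) V(4) by blast
        then show "y \<in> \<phi> ` F" using y by (auto simp: F_def)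
      qed
    qed (auto simp: F_def)
    have F1: "F \<subseteq> ball u0 r1" and F2: "F \<subseteq> ball u0 r2" using r by (auto simp: F_def)
    have j: "J1 u0 = \<theta> x * J2 u0" using J[OF W(2)] u0 by simp
    have \<theta>x: "\<theta> x > 0" using \<theta>(2)[OF W(2)] u0 by simp
    have "?H1 E \<le> ennreal (\<eta> * J1 u0) * hausdorff_cart F" using r1(3)[OF F F1] by (simp only: \<phi>F)
    also have "\<dots> = ennreal (\<eta> * \<theta> x) * (ennreal (J2 u0) * hausdorff_cart F)"
      using \<eta> \<theta>x Jpos(2)[OF W(2)] by (simp add: j ennreal_mult mult.assoc)
    also have "\<dots> \<le> ennreal (\<eta> * \<theta> x) * (ennreal \<eta> * ?H2 E)"
      using r2(3)[OF F F2] by (intro mult_left_mono) (simp_all only: \<phi>F zero_le)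
    also have "\<dots> = ennreal (\<eta>\<^sup>2 * \<theta> x) * ?H2 E"
      using \<eta> \<theta>x by (simp add: power2_eq_square ennreal_mult mult_ac)
    finally show "?H1 E \<le> ennreal (\<eta>\<^sup>2 * \<theta> x) * ?H2 E" .
  qed
qed

lemma area_ratio_borel_measurable:
  fixes S :: "(real ^ 'i::finite) set"
  assumes S: "C1_submanifold TYPE('p::finite) \<Omega> S"
    and h1: "riemannian_metric h1" and h2: "riemannian_metric h2"
  defines "\<theta> \<equiv> area_ratio TYPE('p) h1 h2 S"
  shows "(\<lambda>x. ennreal (\<theta> x) * indicator S x) \<in> borel_measurable borel"
proof -
  have "continuous_on S \<theta>"
    unfolding continuous_on_eq_continuous_within
  proof
    fix x assume x: "x \<in> S"
    obtain V where V: "open V" "x \<in> V" "continuous_on (S \<inter> V) \<theta>"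
      using hausdorff_locally_comparable[OF S x h1 h2, of 2] unfolding \<theta>_def by (metis one_less_numeral_iff semiring_norm(76))
    have "continuous (at x within S \<inter> V) \<theta>"
      using V x by (simp add: continuous_on_eq_continuous_within)
    moreover have "at x within S \<inter> V = at x within S"
      using V by (intro at_within_nhd[of x V]) auto
    ultimately show "continuous (at x within S) \<theta>" by simp
  qed
  then have "(\<lambda>x. indicator S x *\<^sub>R \<theta> x) \<in> borel_measurable borel"
    by (intro borel_measurable_continuous_on_indicator C1_submanifold_borel[OF S])
  then have "(\<lambda>x. ennreal (indicator S x *\<^sub>R \<theta> x)) \<in> borel_measurable borel" by simp
  moreover have "(\<lambda>x. ennreal (indicator S x *\<^sub>R \<theta> x)) = (\<lambda>x. ennreal (\<theta> x) * indicator S x)"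
    by (auto simp: indicator_def)
  ultimately show ?thesis by simp
qed

text \<open>
  Locally the estimate loses a factor three times, twice in the comparison of the Hausdorff measures
  and once because the ratio varies; the cube root of \<open>\<eta>\<close> accounts for this.
\<close>

lemma riem_vol_le_density:
  fixes S :: "(real ^ 'i::finite) set"
  assumes S: "C1_submanifold TYPE('p::finite) \<Omega> S"
    and h1: "riemannian_metric h1" and h2: "riemannian_metric h2"
    and E: "E \<in> sets borel" "E \<subseteq> S"
  defines "\<theta> \<equiv> area_ratio TYPE('p) h1 h2 S"
  shows "emeasure (riem_vol h1 CARD('p)) E \<le>
    emeasure (density (riem_vol h2 CARD('p)) (\<lambda>x. ennreal (\<theta> x) * indicator S x)) E"
proof (rule measure_le_of_locally_le)
  let ?D = "density (riem_vol h2 CARD('p)) (\<lambda>x. ennreal (\<theta> x) * indicator S x)"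
  have meas: "(\<lambda>x. ennreal (\<theta> x) * indicator S x) \<in> borel_measurable (riem_vol h2 CARD('p))"
    using area_ratio_borel_measurable[OF S h1 h2] unfolding \<theta>_def
    by (simp add: measurable_cong_sets[OF sets_riem_vol])
  show "sets (riem_vol h1 CARD('p)) = sets (borel :: (real ^ 'i) measure)" by simp
  show "sets ?D = sets borel" by simp
  show "E \<in> sets borel" by fact
  fix x and \<eta> :: real assume x: "x \<in> E" and \<eta>: "\<eta> > 1"
  define \<zeta> where "\<zeta> = root 3 \<eta>"
  have \<zeta>: "\<zeta> > 1" "\<zeta> ^ 3 = \<eta>" using \<eta> by (auto simp: \<zeta>_def)
  have xS: "x \<in> S" using x E by auto
  obtain V where V: "open V" "x \<in> V" "\<And>y. y \<in> S \<inter> V \<Longrightarrow> 0 < \<theta> y"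
    "\<And>y. y \<in> S \<inter> V \<Longrightarrow> \<theta> x \<le> \<zeta> * \<theta> y"
    "\<And>E. E \<in> sets borel \<Longrightarrow> E \<subseteq> S \<inter> V \<Longrightarrow>
       hausdorff_outer (riem_dist h1) CARD('p) E \<le> ennreal (\<zeta>\<^sup>2 * \<theta> x) * hausdorff_outer (riem_dist h2) CARD('p) E"
    by (rule hausdorff_locally_comparable[OF S xS h1 h2 \<zeta>(1), folded \<theta>_def]) (rule that)
  show "\<exists>U. open U \<and> x \<in> U \<and> (\<forall>A\<in>sets borel. A \<subseteq> E \<inter> U \<longrightarrow>
      emeasure (riem_vol h1 CARD('p)) A \<le> ennreal \<eta> * emeasure ?D A)"
  proof (intro exI[of _ V] conjI V(1,2) ballI impI)
    fix A :: "(real ^ 'i) set" assume A: "A \<in> sets borel" "A \<subseteq> E \<inter> V"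
    then have AS: "A \<subseteq> S \<inter> V" using E by auto
    have "ennreal (\<theta> x) * emeasure (riem_vol h2 CARD('p)) A = (\<integral>\<^sup>+ y. ennreal (\<theta> x) * indicator A y \<partial>riem_vol h2 CARD('p))"
      using A by (subst nn_integral_cmult_indicator) auto
    also have "\<dots> \<le> (\<integral>\<^sup>+ y. ennreal \<zeta> * ((ennreal (\<theta> y) * indicator S y) * indicator A y) \<partial>riem_vol h2 CARD('p))"
    proof (rule nn_integral_mono)
      fix y
      show "ennreal (\<theta> x) * indicator A y \<le> ennreal \<zeta> * ((ennreal (\<theta> y) * indicator S y) * indicator A y)"
      proof (cases "y \<in> A")
        case True
        then have "y \<in> S \<inter> V" using AS by auto
        then show ?thesis using True V(4)[of y] V(3)[of y] \<zeta> by (simp add: ennreal_mult[symmetric] ennreal_leI)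
      qed simp
    qed
    also have "\<dots> = ennreal \<zeta> * emeasure ?D A"
    proof -
      have "(\<lambda>y. (ennreal (\<theta> y) * indicator S y) * indicator A y) \<in> borel_measurable (riem_vol h2 CARD('p))"
        using A(1) by (intro borel_measurable_times_ennreal[OF meas] borel_measurable_indicator) simp
      then show ?thesis using A(1) by (simp only: nn_integral_cmult emeasure_density[OF meas] sets_riem_vol)
    qed
    finally have le: "ennreal (\<theta> x) * emeasure (riem_vol h2 CARD('p)) A \<le> ennreal \<zeta> * emeasure ?D A" .
    have "emeasure (riem_vol h1 CARD('p)) A \<le> ennreal (\<zeta>\<^sup>2 * \<theta> x) * emeasure (riem_vol h2 CARD('p)) A"
      using V(5)[OF A(1) AS] A(1) by (simp add: emeasure_riem_vol h1 h2)
    also have "\<dots> = ennreal (\<zeta>\<^sup>2) * (ennreal (\<theta> x) * emeasure (riem_vol h2 CARD('p)) A)"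
      using V(3)[of x] xS V(2) by (simp add: ennreal_mult mult.assoc)
    also have "\<dots> \<le> ennreal (\<zeta>\<^sup>2) * (ennreal \<zeta> * emeasure ?D A)" by (intro mult_left_mono le) simp
    also have "\<dots> = ennreal \<eta> * emeasure ?D A"
      using \<zeta> by (simp add: mult.assoc[symmetric] ennreal_mult[symmetric] power2_eq_square power3_eq_cube)
    finally show "emeasure (riem_vol h1 CARD('p)) A \<le> ennreal \<eta> * emeasure ?D A" .
  qed
qed

lemma tangent_frame:
  fixes S :: "(real ^ 'i::finite) set"
  assumes S: "C1_submanifold TYPE('p::finite) \<Omega> S" and x: "x \<in> S" and h: "inner_product (h x)"
  shows "orthonormal (h x) (tangent_frame h S x :: (real ^ 'i) ^ 'p)"
    and "span (range (\<lambda>a. (tangent_frame h S x :: (real ^ 'i) ^ 'p) $ a)) = tangent_space S x"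
proof -
  obtain U W and \<phi> :: "real ^ 'p \<Rightarrow> real ^ 'i" and \<psi> \<phi>' u0 where
    U: "open U" and W: "open W" "u0 \<in> W" and u0: "\<phi> u0 = x" and "x \<in> U"
    and hom: "homeomorphism W (S \<inter> U) \<phi> \<psi>"
    and der: "\<And>u. u \<in> W \<Longrightarrow> (\<phi> has_derivative blinfun_apply (\<phi>' u)) (at u)"
    and inj: "\<And>u. u \<in> W \<Longrightarrow> inj (blinfun_apply (\<phi>' u))" and cont: "continuous_on W \<phi>'"
    by (rule C1_submanifold_chart[OF S x]) (rule that)
  have "tangent_space S (\<phi> u0) = range (blinfun_apply (\<phi>' u0))"
    by (rule tangent_space_chart[OF U W hom der cont inj[OF W(2)]])
  note tangent_frame_chart[where h = h and \<phi> = \<phi> and \<phi>' = \<phi>', OF h[folded u0] this inj[OF W(2)], unfolded u0]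
  then show "orthonormal (h x) (tangent_frame h S x :: (real ^ 'i) ^ 'p)"
    and "span (range (\<lambda>a. (tangent_frame h S x :: (real ^ 'i) ^ 'p) $ a)) = tangent_space S x"
    by auto
qed

text \<open>
  Each frame has Gram determinant \<open>1\<close> for its own scalar product, and the transition matrix between the
  frames multiplies every Gram determinant by \<open>(det M)\<^sup>2\<close>.
\<close>

lemma tangent_frame_combine:
  fixes S :: "(real ^ 'i::finite) set"
  assumes S: "C1_submanifold TYPE('p::finite) \<Omega> S" and x: "x \<in> S"
    and h1: "inner_product (h1 x)" and h2: "inner_product (h2 x)"
  obtains M where "(tangent_frame h1 S x :: (real ^ 'i) ^ 'p) = combine M (tangent_frame h2 S x)"
    "\<bar>det M\<bar> * area_ratio TYPE('p) h1 h2 S x = 1"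
    "area_ratio TYPE('p) h2 h1 S x = \<bar>det M\<bar>"
proof -
  let ?t1 = "tangent_frame h1 S x :: (real ^ 'i) ^ 'p" and ?t2 = "tangent_frame h2 S x :: (real ^ 'i) ^ 'p"
  note t1 = tangent_frame[where h = h1, OF S x h1] and t2 = tangent_frame[where h = h2, OF S x h2]
  have "?t1 $ a \<in> span (range (\<lambda>a. ?t2 $ a))" for a
    unfolding t2(2) t1(2)[symmetric] by (intro span_base) auto
  then obtain M where M: "?t1 = combine M ?t2" using combine_orthonormal[OF h2 t2(1)] by metis
  have "gram (h1 x) ?t1 = (det M)\<^sup>2 * gram (h1 x) ?t2" unfolding M by (rule gram_combine[OF h1])
  then have "sqrt ((det M)\<^sup>2 * gram (h1 x) ?t2) = 1" by (simp add: gram_orthonormal[OF t1(1)])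
  moreover have "gram (h2 x) ?t1 = (det M)\<^sup>2 * gram (h2 x) ?t2" unfolding M by (rule gram_combine[OF h2])
  ultimately show thesis
    by (intro that[OF M]) (simp_all add: area_ratio_def real_sqrt_mult gram_orthonormal[OF t2(1)])
qed

text \<open>
  The inequality for measures holds for both orders of the metrics, and the two area ratios are
  reciprocal to each other.
\<close>

lemma nn_integral_riem_vol_change_metric:
  fixes S :: "(real ^ 'i::finite) set" and f :: "real ^ 'i \<Rightarrow> ennreal"
  assumes S: "C1_submanifold TYPE('p::finite) \<Omega> S"
    and h1: "riemannian_metric h1" and h2: "riemannian_metric h2"
  shows "(\<integral>\<^sup>+ x\<in>S. f x \<partial>riem_vol h1 CARD('p)) =
    (\<integral>\<^sup>+ x\<in>S. ennreal (area_ratio TYPE('p) h1 h2 S x) * f x \<partial>riem_vol h2 CARD('p))"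
proof (rule antisym)
  have le: "(\<integral>\<^sup>+ x\<in>S. f x \<partial>riem_vol h1 CARD('p)) \<le>
    (\<integral>\<^sup>+ x\<in>S. ennreal (area_ratio TYPE('p) h1 h2 S x) * f x \<partial>riem_vol h2 CARD('p))"
    if "riemannian_metric h1" "riemannian_metric h2" for h1 h2 and f :: "real ^ 'i \<Rightarrow> ennreal"
    by (rule set_nn_integral_le_of_measure_le[OF sets_riem_vol sets_riem_vol
          area_ratio_borel_measurable[OF S that] riem_vol_le_density[OF S that]])
  show "(\<integral>\<^sup>+ x\<in>S. f x \<partial>riem_vol h1 CARD('p)) \<le>
    (\<integral>\<^sup>+ x\<in>S. ennreal (area_ratio TYPE('p) h1 h2 S x) * f x \<partial>riem_vol h2 CARD('p))"
    by (rule le[OF h1 h2])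
  have "ennreal (area_ratio TYPE('p) h2 h1 S x) *
      (ennreal (area_ratio TYPE('p) h1 h2 S x) * f x) * indicator S x = f x * indicator S x" for x
  proof (cases "x \<in> S")
    case True
    obtain M where "(tangent_frame h1 S x :: (real ^ 'i) ^ 'p) = combine M (tangent_frame h2 S x)"
      and M: "\<bar>det M\<bar> * area_ratio TYPE('p) h1 h2 S x = 1"
      "area_ratio TYPE('p) h2 h1 S x = \<bar>det M\<bar>"
      by (rule tangent_frame_combine[where ?h1.0 = h1 and ?h2.0 = h2, OF S True
            riemannian_metric_inner_product[OF h1] riemannian_metric_inner_product[OF h2]]) (rule that)
    have "ennreal \<bar>det M\<bar> * ennreal (area_ratio TYPE('p) h1 h2 S x) = 1"
      using M(1) by (simp flip: ennreal_mult')
    then show ?thesis unfolding M(2) by (simp add: mult.assoc[symmetric])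
  qed simp
  then show "(\<integral>\<^sup>+ x\<in>S. ennreal (area_ratio TYPE('p) h1 h2 S x) * f x \<partial>riem_vol h2 CARD('p))
      \<le> (\<integral>\<^sup>+ x\<in>S. f x \<partial>riem_vol h1 CARD('p))"
    using le[OF h2 h1, of "\<lambda>x. ennreal (area_ratio TYPE('p) h1 h2 S x) * f x"]
    by (simp only:)
qed

text \<open>
  This makes the volume of the whole space a case of the surface measure.
\<close>

lemma C1_submanifold_UNIV: "C1_submanifold TYPE('i::finite) UNIV (UNIV :: (real ^ 'i) set)"
  unfolding C1_submanifold_def
proof (intro conjI ballI)
  fix x :: "real ^ 'i"
  show "\<exists>U W (\<phi> :: real ^ 'i \<Rightarrow> real ^ 'i) \<psi> \<phi>'.
        open U \<and> x \<in> U \<and> open W \<and> homeomorphism W (UNIV \<inter> U) \<phi> \<psi> \<and>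
        (\<forall>u\<in>W. (\<phi> has_derivative blinfun_apply (\<phi>' u)) (at u) \<and> inj (blinfun_apply (\<phi>' u))) \<and>
        continuous_on W \<phi>'"
    by (intro exI[of _ UNIV] exI[of _ "\<lambda>u. u"] exI[of _ "\<lambda>_. id_blinfun"])
       (auto simp: homeomorphism_def id_blinfun.rep_eq)
qed simp


section \<open>Vertical projection of simple multivectors\<close>

text \<open>
  Riesz representation: in terms of \<open>L\<close> with \<open>h v w = L v \<bullet> L w\<close>, the linear map
  \<open>adjoint L \<circ> L\<close> is injective and therefore onto.
\<close>

lemma inner_product_dual:
  fixes h :: "real ^ 'i::finite \<Rightarrow> real ^ 'i \<Rightarrow> real"
  assumes h: "inner_product h" and f: "linear f"
  obtains w where "\<And>v. h v w = f v"
proof -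
  obtain L :: "real ^ 'i \<Rightarrow> real ^ 'i" where L: "linear L" "inj L" "\<And>v w. h v w = L v \<bullet> L w"
    using inner_product_isometry[OF h] by metis
  let ?A = "adjoint L \<circ> L"
  have "linear ?A" using L(1) adjoint_linear by (intro linear_compose) auto
  moreover have "inj ?A"
  proof (rule linear_injective_0[OF \<open>linear ?A\<close>, THEN iffD2], intro allI impI)
    fix v assume "?A v = 0"
    then have "v \<bullet> ?A v = 0" by simp
    then have "L v \<bullet> L v = 0" using adjoint_works[OF L(1), of v "L v"] by simp
    then show "v = 0" using L(1,2) by (simp add: linear_injective_0)
  qed
  ultimately have "surj ?A" by (rule linear_injective_imp_surjective) simp
  obtain u where u: "\<And>v. v \<bullet> u = f v"
  proof -
    have "v \<bullet> (\<chi> i. f (axis i 1)) = f v" for v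
    proof -
      have "f v = f (\<Sum>i\<in>UNIV. v $ i *\<^sub>R axis i 1)"
        using basis_expansion[of v] by (simp add: scalar_mult_eq_scaleR)
      then show ?thesis by (simp add: linear_sum[OF f] linear_scale[OF f] inner_vec_def)
    qed
    then show thesis by (rule that)
  qed
  obtain w where w: "?A w = u" using \<open>surj ?A\<close> by (metis surjD)
  have "h v w = f v" for v
    using adjoint_works[OF L(1), of v "L w"] w u[of v] by (simp add: L(3))
  then show thesis by (rule that)
qed

text \<open>
  The induced form is nondegenerate on multivectors.  If \<open>d i\<close> represents the \<open>i\<close>-th coordinate with
  respect to \<open>h\<close>, then pairing with the wedge product of the \<open>d (I $ b)\<close> is the coordinate with
  multi-index \<open>I\<close>.
\<close>

lemma pvec_inner_pvectors_zero:
  fixes \<delta> :: "('i::finite, 'p::finite) pvec"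
  assumes h: "inner_product h" and \<delta>: "\<delta> \<in> pvectors UNIV"
    and 0: "\<And>\<eta>. \<eta> \<in> pvectors UNIV \<Longrightarrow> pvec_inner h \<delta> \<eta> = 0"
  shows "\<delta> = 0"
proof -
  have bil: "bilinear h" using h by (simp add: inner_product_def)
  have "\<exists>w. \<forall>v. h v w = v $ i" for i
    using inner_product_dual[OF h, of "\<lambda>v. v $ i"] by (metis bounded_linear.linear bounded_linear_vec_nth)
  then obtain d where d: "\<And>i v. h v (d i) = v $ i" by metis
  have "\<delta> $ I = 0" for I
  proof -
    let ?w = "wedge (\<chi> b. d (I $ b))"
    have lin: "linear (\<lambda>\<xi>. pvec_inner h \<xi> ?w - \<xi> $ I)"
      using bilinear_pvec_inner[OF bil] unfolding bilinear_def
      by (intro linear_compose_sub) (auto simp: bounded_linear.linear bounded_linear_vec_nth)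
    have "pvec_inner h \<delta> ?w - \<delta> $ I = 0"
    proof (rule linear_eq_0_on_span[OF lin])
      fix x :: "('i, 'p) pvec" assume "x \<in> {wedge v | v. \<forall>a. v $ a \<in> UNIV}"
      then obtain v where "x = wedge v" by auto
      moreover have "pvec_inner h (wedge v) ?w = wedge v $ I"
        by (simp only: pvec_inner_wedge[OF bil] vec_lambda_beta d) (simp add: wedge_def)
      ultimately show "pvec_inner h x ?w - x $ I = 0" by simp
    qed (use \<delta> in \<open>simp add: pvectors_def\<close>)
    moreover have "?w \<in> pvectors UNIV" unfolding pvectors_def by (intro span_base) auto
    ultimately show ?thesis using 0 by simp
  qed
  then show ?thesis by (simp add: vec_eq_iff)
qed

definition unit_normal :: "('a::real_vector \<Rightarrow> 'a \<Rightarrow> real) \<Rightarrow> 'a set \<Rightarrow> 'a \<Rightarrow> bool" where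
  "unit_normal h H e \<longleftrightarrow> h e e = 1 \<and> (\<forall>v. v \<in> H \<longleftrightarrow> h v e = 0)"

text \<open>
  The orthogonal projection of all vectors of the frame to the hyperplane with unit normal \<open>e\<close>.
\<close>

definition project_frame :: "('a::real_vector \<Rightarrow> 'a \<Rightarrow> real) \<Rightarrow> 'a \<Rightarrow> 'a ^ 'p \<Rightarrow> 'a ^ 'p::finite" where
  "project_frame h e t = (\<chi> a. t $ a - h (t $ a) e *\<^sub>R e)"

lemma project_frame_in:
  assumes "inner_product h" "unit_normal h H e"
  shows "project_frame h e t $ a \<in> H"
  using assms(2) by (simp add: project_frame_def unit_normal_def inner_product_simps[OF assms(1)])

lemma project_frame_inner:
  assumes "inner_product h" "unit_normal h H e" "v \<in> H"
  shows "h (project_frame h e t $ a) v = h (t $ a) v"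
proof -
  have "h e v = 0" using assms by (metis inner_product_def unit_normal_def)
  then show ?thesis by (simp add: project_frame_def inner_product_simps[OF assms(1)])
qed

lemma wedge_mem_pvectors: "(\<And>a. t $ a \<in> W) \<Longrightarrow> wedge t \<in> pvectors W"
  unfolding pvectors_def by (intro span_base) auto

text \<open>
  Against horizontal vectors, \<open>t $ a\<close> and its projection have the same scalar products, and these are
  the entries of the determinants that define the form.
\<close>

lemma wedge_diff_project_vertical:
  fixes t :: "real ^ 'i::finite ^ 'p::finite"
  assumes h: "inner_product h" and e: "unit_normal h H e"
  shows "wedge t - wedge (project_frame h e t) \<in> vertical_pvectors h H"
  unfolding vertical_pvectors_def
proof (intro CollectI conjI ballI)
  have bil: "bilinear h" using h by (simp add: inner_product_def)
  note bilp = bilinear_pvec_inner[OF bil, where ?'p = 'p]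
  show "wedge t - wedge (project_frame h e t) \<in> pvectors UNIV"
    using wedge_mem_pvectors[of _ UNIV] unfolding pvectors_def by (intro span_diff) auto
  fix \<eta> :: "('i, 'p) pvec" assume "\<eta> \<in> pvectors H"
  then have "\<eta> \<in> span {wedge v | v. \<forall>a. v $ a \<in> H}" by (simp add: pvectors_def)
  moreover have "linear (pvec_inner h (wedge t - wedge (project_frame h e t)))"
    using bilp by (simp add: bilinear_def)
  ultimately show "pvec_inner h (wedge t - wedge (project_frame h e t)) \<eta> = 0"
  proof (rule linear_eq_0_on_span[rotated 2])
    fix x :: "('i, 'p) pvec" assume "x \<in> {wedge v | v. \<forall>a. v $ a \<in> H}"
    then obtain v where v: "x = wedge v" "\<And>a. v $ a \<in> H" by auto
    then show "pvec_inner h (wedge t - wedge (project_frame h e t)) x = 0"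
      by (simp add: bilinear_lsub[OF bilp] pvec_inner_wedge[OF bil] project_frame_inner[OF h e])
  qed
qed

lemma subspace_vertical_pvectors:
  assumes "inner_product h"
  shows "subspace (vertical_pvectors h H :: ('i::finite, 'p::finite) pvec set)"
proof -
  have bil: "bilinear h" using assms by (simp add: inner_product_def)
  note bilp = bilinear_pvec_inner[OF bil, where ?'p = 'p]
  show ?thesis
    unfolding subspace_def vertical_pvectors_def pvectors_def
    by (auto simp: bilinear_ladd[OF bilp] bilinear_lmul[OF bilp] bilinear_lzero[OF bilp] span_zero span_add span_scale)
qed

text \<open>
  The candidate is vertical and differs from the given multivector by a horizontal one.  Two such
  candidates differ by a vertical multivector that is orthogonal to all vertical and all horizontal
  multivectors, hence to everything, because every simple multivector is a sum of one of each kind.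
\<close>

lemma vertical_projection_scale_wedge:
  fixes t :: "real ^ 'i::finite ^ 'p::finite"
  assumes h: "inner_product h" and e: "unit_normal h H e"
  shows "vertical_projection h H (c *\<^sub>R wedge t) = c *\<^sub>R (wedge t - wedge (project_frame h e t))"
    (is "_ = ?\<zeta>")
proof -
  have bil: "bilinear h" using h by (simp add: inner_product_def)
  note bilp = bilinear_pvec_inner[OF bil, where ?'p = 'p]
  note sub = subspace_vertical_pvectors[OF h, of H, where ?'p = 'p]
  have sym: "pvec_inner h \<xi> \<eta> = pvec_inner h \<eta> \<xi>"
    if "\<xi> \<in> pvectors UNIV" "\<eta> \<in> pvectors UNIV" for \<xi> \<eta> :: "('i, 'p) pvec"
  proof -
    have hs: "h v w = h w v" for v w using h by (simp add: inner_product_def)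
    have swap: "det (\<chi> a b. h (v $ a) (w $ b)) = det (\<chi> a b. h (w $ a) (v $ b))" for v w :: "real ^ 'i ^ 'p"
      using det_transpose[of "\<chi> a b. h (w $ a) (v $ b)"] by (simp add: transpose_def hs)
    show ?thesis
    proof (rule bilinear_eq[where f = "pvec_inner h" and g = "\<lambda>\<xi> \<eta>. pvec_inner h \<eta> \<xi>"])
      show "bilinear (pvec_inner h :: ('i, 'p) pvec \<Rightarrow> _)" by (rule bilp)
      show "bilinear (\<lambda>\<xi> \<eta>. pvec_inner h \<eta> (\<xi> :: ('i, 'p) pvec))"
        using bilp by (auto simp: bilinear_def)
      show "pvectors UNIV \<subseteq> span {wedge v | v :: real ^ 'i ^ 'p. True}" by (simp add: pvectors_def)
      show "pvectors UNIV \<subseteq> span {wedge v | v :: real ^ 'i ^ 'p. True}" by (simp add: pvectors_def)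
      show "\<xi> \<in> pvectors UNIV" "\<eta> \<in> pvectors UNIV" by fact+
      fix x y :: "('i, 'p) pvec" assume "x \<in> {wedge v | v. True}" "y \<in> {wedge v | v. True}"
      then show "pvec_inner h x y = pvec_inner h y x"
        using swap by (auto simp: pvec_inner_wedge[OF bil])
    qed
  qed
  have vert: "?\<zeta> \<in> vertical_pvectors h H"
    by (intro subspace_scale[OF sub] wedge_diff_project_vertical[OF h e])
  have orth: "pvec_inner h (c *\<^sub>R wedge t - ?\<zeta>) \<eta> = 0" if "\<eta> \<in> vertical_pvectors h H" for \<eta>
  proof -
    have "wedge (project_frame h e t) \<in> pvectors H" by (intro wedge_mem_pvectors project_frame_in[OF h e])
    then have "pvec_inner h \<eta> (wedge (project_frame h e t)) = 0" using that by (auto simp: vertical_pvectors_def)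
    then have "pvec_inner h (wedge (project_frame h e t)) \<eta> = 0"
      using that sym[of \<eta> "wedge (project_frame h e t)"] by (auto simp: vertical_pvectors_def wedge_mem_pvectors)
    moreover have "c *\<^sub>R wedge t - ?\<zeta> = c *\<^sub>R wedge (project_frame h e t)" by (simp add: scaleR_diff_right)
    ultimately show ?thesis by (simp add: bilinear_lmul[OF bilp])
  qed
  show ?thesis
    unfolding vertical_projection_def
  proof (rule the_equality)
    show "?\<zeta> \<in> vertical_pvectors h H \<and> (\<forall>\<eta>\<in>vertical_pvectors h H. pvec_inner h (c *\<^sub>R wedge t - ?\<zeta>) \<eta> = 0)"
      using vert orth by blast
    fix \<zeta> assume *: "\<zeta> \<in> vertical_pvectors h H \<and> (\<forall>\<eta>\<in>vertical_pvectors h H. pvec_inner h (c *\<^sub>R wedge t - \<zeta>) \<eta> = 0)"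
    let ?\<delta> = "\<zeta> - ?\<zeta>"
    have \<delta>: "?\<delta> \<in> vertical_pvectors h H" using * vert by (intro subspace_diff[OF sub]) auto
    have \<delta>0: "pvec_inner h ?\<delta> \<eta> = 0" if "\<eta> \<in> vertical_pvectors h H" for \<eta>
      using * orth[OF that] that by (auto simp: bilinear_lsub[OF bilp])
    have "?\<delta> = 0"
    proof (rule pvec_inner_pvectors_zero[OF h])
      show "?\<delta> \<in> pvectors UNIV" using \<delta> by (simp add: vertical_pvectors_def)
      fix \<eta> :: "('i, 'p) pvec" assume "\<eta> \<in> pvectors UNIV"
      then have "\<eta> \<in> span {wedge v | v. \<forall>a. v $ a \<in> UNIV}" by (simp add: pvectors_def)
      moreover have "linear (pvec_inner h ?\<delta>)" using bilp by (simp add: bilinear_def)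
      ultimately show "pvec_inner h ?\<delta> \<eta> = 0"
      proof (rule linear_eq_0_on_span[rotated 2])
        fix x :: "('i, 'p) pvec" assume "x \<in> {wedge v | v. \<forall>a. v $ a \<in> UNIV}"
        then obtain v where v: "x = wedge v" by auto
        have "pvec_inner h ?\<delta> (wedge (project_frame h e v)) = 0"
          using \<delta> wedge_mem_pvectors[OF project_frame_in[OF h e]] by (auto simp: vertical_pvectors_def)
        moreover have "pvec_inner h ?\<delta> (wedge v - wedge (project_frame h e v)) = 0"
          by (rule \<delta>0[OF wedge_diff_project_vertical[OF h e]])
        ultimately show "pvec_inner h ?\<delta> x = 0" by (simp add: v bilinear_rsub[OF bilp])
      qed
    qed
    then show "\<zeta> = ?\<zeta>" by simp
  qed
qed

lemma pvec_norm_scale: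
  assumes "inner_product h"
  shows "pvec_norm h (c *\<^sub>R \<xi>) = \<bar>c\<bar> * pvec_norm h (\<xi> :: ('i::finite, 'p::finite) pvec)"
proof -
  have bil: "bilinear h" using assms by (simp add: inner_product_def)
  note bilp = bilinear_pvec_inner[OF bil, where ?'p = 'p]
  show ?thesis
    by (simp add: pvec_norm_def bilinear_lmul[OF bilp] bilinear_rmul[OF bilp] real_sqrt_mult mult.assoc[symmetric])
qed


section \<open>Two scalar products that agree on a hyperplane\<close>

lemma wedge_update_add:
  fixes t :: "real ^ 'i::finite ^ 'p::finite"
  shows "wedge (\<chi> a. if a = k then x + y else t $ a) =
    wedge (\<chi> a. if a = k then x else t $ a) + wedge (\<chi> a. if a = k then y else t $ a)"
proof -
  have *: "(\<chi> a b. (\<chi> a. if a = k then z else t $ a) $ a $ (I $ b)) =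
      (\<chi> a. if a = k then (\<chi> b. z $ (I $ b)) else (\<chi> b. t $ a $ (I $ b)))" for z and I :: "'i ^ 'p"
    by (simp add: vec_eq_iff)
  have "(\<chi> b. (x + y) $ (I $ b)) = (\<chi> b. x $ (I $ b)) + (\<chi> b. y $ (I $ b))" for I :: "'i ^ 'p"
    by (simp add: vec_eq_iff)
  then have "wedge (\<chi> a. if a = k then x + y else t $ a) $ I =
    wedge (\<chi> a. if a = k then x else t $ a) $ I + wedge (\<chi> a. if a = k then y else t $ a) $ I" for I
    unfolding wedge_def vec_lambda_beta[of _ I] * by (simp only: det_row_add)
  then show ?thesis unfolding vec_eq_iff by simp
qed

text \<open>
  If all but the \<open>k\<close>-th vector are horizontal, then the vertical part replaces the \<open>k\<close>-th vector by
  its component along the normal, and the Gram matrix of the result is block diagonal.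
\<close>

lemma vertical_norm_adapted:
  fixes t :: "real ^ 'i::finite ^ 'p::finite"
  assumes h: "inner_product h" and e: "unit_normal h H e" and t: "\<And>a. a \<noteq> k \<Longrightarrow> t $ a \<in> H"
  shows "pvec_norm h (wedge t - wedge (project_frame h e t)) =
    \<bar>h (t $ k) e\<bar> * sqrt (det (\<chi> a b. if a = k \<or> b = k then if a = b then 1 else 0 else h (t $ a) (t $ b)))"
proof -
  have bil: "bilinear h" using h by (simp add: inner_product_def)
  have sym: "h v w = h w v" for v w using h by (simp add: inner_product_def)
  have ee: "h e e = 1" and He: "v \<in> H \<Longrightarrow> h v e = 0" for v using e by (auto simp: unit_normal_def)
  have eH: "h e v = 0" if "v \<in> H" for v using He[OF that] sym[of e v] by simp
  define \<mu> where "\<mu> = h (t $ k) e"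
  define s where "s = (\<chi> a. if a = k then \<mu> *\<^sub>R e else t $ a)"
  have flat: "project_frame h e t = (\<chi> a. if a = k then t $ k - \<mu> *\<^sub>R e else t $ a)"
    using t He by (auto simp: vec_eq_iff project_frame_def \<mu>_def)
  have "t = (\<chi> a. if a = k then (t $ k - \<mu> *\<^sub>R e) + \<mu> *\<^sub>R e else t $ a)"
    by (simp add: vec_eq_iff)
  then have "wedge t = wedge (\<chi> a. if a = k then (t $ k - \<mu> *\<^sub>R e) + \<mu> *\<^sub>R e else t $ a)"
    by (rule arg_cong)
  also have "\<dots> = wedge (project_frame h e t) + wedge s"
    unfolding flat s_def by (rule wedge_update_add)
  finally have "wedge t = wedge (project_frame h e t) + wedge s" .
  then have "wedge t - wedge (project_frame h e t) = wedge s" by simp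
  then have "pvec_norm h (wedge t - wedge (project_frame h e t)) = sqrt (det (\<chi> a b. h (s $ a) (s $ b)))"
    by (simp add: pvec_norm_def pvec_inner_wedge[OF bil])
  also have "(\<chi> a b. h (s $ a) (s $ b)) = (\<chi> a. if a = k then \<mu>\<^sup>2 *s axis k 1
      else (\<chi> b. if b = k then 0 else h (t $ a) (t $ b)))"
  proof -
    have "h (s $ a) (s $ b) = (\<chi> a. if a = k then \<mu>\<^sup>2 *s axis k 1
      else (\<chi> b. if b = k then 0 else h (t $ a) (t $ b))) $ a $ b" for a b
      using He[OF t[of a]] eH[OF t[of b]]
      by (cases "a = k"; cases "b = k") (simp_all add: s_def axis_def inner_product_simps[OF h] ee power2_eq_square)
    then show ?thesis by (simp add: vec_eq_iff)
  qed
  also have "det \<dots> = \<mu>\<^sup>2 * det (\<chi> a. if a = k then axis k 1 else (\<chi> b. if b = k then 0 else h (t $ a) (t $ b)))"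
    by (rule det_row_mul)
  also have "(\<chi> a. if a = k then axis k 1 else (\<chi> b. if b = k then 0 else h (t $ a) (t $ b))) =
      (\<chi> a b. if a = k \<or> b = k then if a = b then 1 else 0 else h (t $ a) (t $ b))"
    by (auto simp: vec_eq_iff axis_def)
  finally show ?thesis by (simp add: real_sqrt_mult \<mu>_def)
qed

text \<open>
  Subtract from every other vector the multiple of \<open>t $ k\<close> that brings \<open>f\<close> to zero.  The transition
  matrix is \<open>mat 1 - C\<close> with \<open>C ** C = 0\<close>, so it has the inverse \<open>mat 1 + C\<close>.
\<close>

lemma adapted_frame_exists:
  fixes t :: "'a::real_vector ^ 'p::finite"
  assumes f: "linear f" and k: "f (t $ k) \<noteq> (0::real)"
  obtains M where "det M \<noteq> 0" "\<And>a. a \<noteq> k \<Longrightarrow> f (combine M t $ a) = 0"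
proof -
  define \<gamma> where "\<gamma> a = (if a = k then 0 else f (t $ a) / f (t $ k))" for a
  define C :: "real ^ 'p ^ 'p" where "C = (\<chi> a b. if b = k then \<gamma> a else 0)"
  have "C ** C = 0"
  proof -
    have "(C ** C) $ a $ b = 0" for a b
      by (simp add: matrix_matrix_mult_def C_def \<gamma>_def if_distrib[of "\<lambda>c. c * _"] cong: if_cong)
    then show ?thesis by (simp add: vec_eq_iff)
  qed
  then have "C *v (C *v x) = 0" for x by (simp add: matrix_vector_mul_assoc)
  then have "(mat 1 - C) ** (mat 1 + C) = mat 1"
    by (simp add: matrix_eq matrix_vector_mult_diff_rdistrib matrix_vector_mult_add_rdistrib matrix_vector_right_distrib
        flip: matrix_vector_mul_assoc)
  then have "det (mat 1 - C) * det (mat 1 + C) = 1" by (metis det_I det_mul)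
  then have nz: "det (mat 1 - C) \<noteq> 0" by auto
  have "combine (mat 1 - C) t $ a = t $ a - \<gamma> a *\<^sub>R t $ k" for a
  proof -
    have "combine (mat 1 - C) t $ a = (\<Sum>b\<in>UNIV. (if b = a then t $ b else 0) - (if b = k then \<gamma> a *\<^sub>R t $ k else 0))"
      unfolding combine_def vec_lambda_beta by (rule sum.cong) (auto simp: mat_def C_def scaleR_diff_left)
    then show ?thesis by (simp add: sum_subtractf)
  qed
  then have "f (combine (mat 1 - C) t $ a) = 0" if "a \<noteq> k" for a
    using that k by (simp add: linear_diff[OF f] linear_scale[OF f] \<gamma>_def)
  then show thesis using that nz by blast
qed

text \<open>
  If some vector of the frame is not horizontal, the frame can be adapted at the cost of a scalar,
  which is the same for both metrics.  The block that describes the horizontal vectors is then common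
  to both, and the normal components differ by the factor \<open>c\<close>.
\<close>

lemma vertical_norm_ratio:
  fixes t :: "real ^ 'i::finite ^ 'p::finite"
  assumes h1: "inner_product h1" and e1: "unit_normal h1 H e1"
    and h2: "inner_product h2" and e2: "unit_normal h2 H e2"
    and agree: "\<And>v w. v \<in> H \<Longrightarrow> w \<in> H \<Longrightarrow> h1 v w = h2 v w"
    and c: "c > 0" "\<And>v. h1 v e1 = c * h2 v e2"
  shows "pvec_norm h1 (vertical_projection h1 H (wedge t)) = c * pvec_norm h2 (vertical_projection h2 H (wedge t))"
proof (cases "\<forall>a. t $ a \<in> H")
  case True
  then have "project_frame h1 e1 t = t" "project_frame h2 e2 t = t"
    using e1 e2 by (auto simp: project_frame_def vec_eq_iff unit_normal_def)
  then have "vertical_projection h1 H (wedge t) = 0 *\<^sub>R 0" "vertical_projection h2 H (wedge t) = 0 *\<^sub>R 0"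
    using vertical_projection_scale_wedge[OF h1 e1, of 1 t] vertical_projection_scale_wedge[OF h2 e2, of 1 t] by auto
  then show ?thesis by (simp only: pvec_norm_scale[OF h1] pvec_norm_scale[OF h2] abs_zero mult_zero_left mult_zero_right)
next
  case False
  then obtain k where "t $ k \<notin> H" by auto
  then have k: "h2 (t $ k) e2 \<noteq> 0" using e2 by (simp add: unit_normal_def)
  have "linear (\<lambda>v. h2 v e2)" using h2 by (simp add: inner_product_def bilinear_def)
  then obtain M where M: "det M \<noteq> 0" "\<And>a. a \<noteq> k \<Longrightarrow> h2 (combine M t $ a) e2 = 0"
    using adapted_frame_exists[of "\<lambda>v. h2 v e2" t k, OF _ k] by metis
  define s where "s = combine M t"
  have sH: "s $ a \<in> H" if "a \<noteq> k" for a using M(2)[OF that] e2 by (simp add: s_def unit_normal_def)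
  have t: "wedge t = (1 / det M) *\<^sub>R wedge s" using M(1) by (simp add: s_def wedge_combine)
  have block: "(\<chi> a b. if a = k \<or> b = k then if a = b then 1 else 0 else h1 (s $ a) (s $ b)) =
        (\<chi> a b. if a = k \<or> b = k then if a = b then 1 else 0 else h2 (s $ a) (s $ b))"
    using agree sH by (simp add: vec_eq_iff)
  have "pvec_norm h1 (wedge s - wedge (project_frame h1 e1 s)) = c * pvec_norm h2 (wedge s - wedge (project_frame h2 e2 s))"
    unfolding vertical_norm_adapted[OF h1 e1, of k s, OF sH, simplified]
      vertical_norm_adapted[OF h2 e2, of k s, OF sH, simplified] block[simplified] c(2)
    using c(1) by (simp add: abs_mult)
  then show ?thesis
    unfolding t vertical_projection_scale_wedge[OF h1 e1] vertical_projection_scale_wedge[OF h2 e2]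
      pvec_norm_scale[OF h1] pvec_norm_scale[OF h2]
    by simp
qed

text \<open>
  The rows of a square matrix that all lie in one hyperplane are linearly dependent.
\<close>

lemma wedge_project_frame_top:
  fixes t :: "real ^ 'i::finite ^ 'i"
  assumes h: "inner_product h" and e: "unit_normal h H e"
  shows "wedge (project_frame h e t) = 0"
proof -
  define s where "s = project_frame h e t"
  define f where "f = (\<chi> i. h (axis i 1) e)"
  have hf: "h v e = v \<bullet> f" for v
  proof -
    have "h v e = h (\<Sum>i\<in>UNIV. v $ i *\<^sub>R axis i 1) e"
      using basis_expansion[of v] by (simp add: scalar_mult_eq_scaleR)
    then show ?thesis
      by (simp add: inner_product_sum[OF h] inner_product_simps[OF h] f_def inner_vec_def)
  qed
  have "f \<noteq> 0" using hf[of e] e by (auto simp: unit_normal_def)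
  moreover have "s *v f = 0"
    using project_frame_in[OF h e, of t] e
    by (simp add: vec_eq_iff s_def matrix_mult_dot unit_normal_def hf)
  ultimately have "det s = 0"
    using invertible_det_nz[of s] unfolding invertible_left_inverse matrix_left_invertible_ker by blast
  moreover have "wedge s = det s *\<^sub>R wedge (mat 1)"
  proof -
    have "s = combine s (mat 1)"
    proof -
      have "combine s (mat 1) $ a $ i = s $ a $ i" for a i
      proof -
        have "combine s (mat 1) $ a $ i = (\<Sum>b\<in>UNIV. if b = i then s $ a $ i else 0)"
          unfolding combine_def vec_lambda_beta sum_component by (rule sum.cong) (auto simp: mat_def)
        then show ?thesis by simp
      qed
      then show ?thesis by (simp add: vec_eq_iff)
    qed
    then show ?thesis using wedge_combine[of s "mat 1"] by simp
  qed
  ultimately show ?thesis by (simp add: s_def)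
qed

text \<open>
  In top dimension there are no nonzero horizontal multivectors, so every multivector is its own
  vertical part and the ratio of vertical norms is the ratio of volumes.
\<close>

lemma gram_ratio_top:
  fixes t :: "real ^ 'i::finite ^ 'i"
  assumes h1: "inner_product h1" and e1: "unit_normal h1 H e1"
    and h2: "inner_product h2" and e2: "unit_normal h2 H e2"
    and agree: "\<And>v w. v \<in> H \<Longrightarrow> w \<in> H \<Longrightarrow> h1 v w = h2 v w"
    and c: "c > 0" "\<And>v. h1 v e1 = c * h2 v e2"
  shows "sqrt (gram h1 t) = c * sqrt (gram h2 t)"
proof -
  have "pvec_norm h (vertical_projection h H (wedge t)) = sqrt (gram h t)"
    if h: "inner_product h" and e: "unit_normal h H e" for h e
  proof -
    have "bilinear h" using h by (simp add: inner_product_def)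
    then show ?thesis
      using vertical_projection_scale_wedge[OF h e, of 1 t]
      by (simp add: wedge_project_frame_top[OF h e] pvec_norm_def pvec_inner_wedge gram_def)
  qed
  then show ?thesis using vertical_norm_ratio[OF assms, of t] h1 e1 h2 e2 by simp
qed


section \<open>The contact form and left invariant metrics\<close>

lemma linear_heis_dL: "linear (heis_dL x y)"
  by (rule linearI)
     (auto simp: heis_dL_eq vec_eq_iff algebra_simps sum.distrib sum_subtractf sum_distrib_left)

lemma heis_dL_inverse: "heis_dL x 0 (heis_dL (- x) x v) = v"
  by (auto simp: heis_dL_eq vec_eq_iff algebra_simps sum.distrib sum_subtractf)

lemma heis_dL_inverse': "heis_dL (- x) x (heis_dL x 0 v) = v"
  by (auto simp: heis_dL_eq vec_eq_iff algebra_simps sum.distrib sum_subtractf)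

lemma heis_prod_0 [simp]: "heis_prod x 0 = x"
  by (simp add: heis_prod_def vec_eq_iff)

lemma heis_prod_inverse [simp]: "heis_prod (- x) x = 0"
  by (simp add: heis_prod_def vec_eq_iff mult.commute)

text \<open>
  The coefficient of \<open>Z\<close> when \<open>v\<close> is written in the left invariant frame at \<open>x\<close>.
\<close>

definition contact_form :: "'n::finite heis \<Rightarrow> 'n heis \<Rightarrow> real" where
  "contact_form x v = heis_dL (- x) x v $ vert_idx"

lemma linear_contact_form: "linear (contact_form x)"
  unfolding contact_form_def
  by (rule linearI) (simp_all add: linear_add[OF linear_heis_dL] linear_scale[OF linear_heis_dL])

lemma heis_dL_frame: "heis_dL (- x) x (heis_frame i x) = axis i 1"
  by (simp add: heis_frame_def heis_dL_inverse')

lemma horizontal_eq_kernel: "v \<in> horizontal x \<longleftrightarrow> contact_form x v = 0"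
proof
  assume "v \<in> horizontal x"
  then have "v \<in> span {heis_frame i x | i. i \<noteq> vert_idx}" by (simp add: horizontal_def)
  then show "contact_form x v = 0"
    by (rule linear_eq_0_on_span[OF linear_contact_form, rotated])
       (auto simp: contact_form_def heis_dL_frame axis_def)
next
  assume v: "contact_form x v = 0"
  let ?w = "heis_dL (- x) x v"
  have "?w = (\<Sum>i\<in>UNIV. ?w $ i *\<^sub>R axis i 1)"
    using basis_expansion[of ?w] by (simp add: scalar_mult_eq_scaleR)
  then have "heis_dL x 0 ?w = (\<Sum>i\<in>UNIV. ?w $ i *\<^sub>R heis_frame i x)"
    unfolding heis_frame_def
    by (metis (no_types, lifting) linear_sum[OF linear_heis_dL] linear_scale[OF linear_heis_dL] sum.cong)
  then have "v = (\<Sum>i\<in>UNIV. ?w $ i *\<^sub>R heis_frame i x)" by (simp only: heis_dL_inverse)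
  also have "\<dots> \<in> horizontal x"
    unfolding horizontal_def
  proof (rule span_sum)
    fix i
    show "?w $ i *\<^sub>R heis_frame i x \<in> span {heis_frame i x | i. i \<noteq> vert_idx}"
    proof (cases "i = vert_idx")
      case True
      then show ?thesis using v by (simp add: contact_form_def span_zero)
    next
      case False
      then show ?thesis by (intro span_scale span_base) auto
    qed
  qed
  finally show "v \<in> horizontal x" .
qed

lemma left_invariant_inner_product:
  "left_invariant_metric h \<Longrightarrow> inner_product (h x)"
  by (simp add: left_invariant_metric_def inner_product_def)

lemma left_invariant_at_0:
  assumes "left_invariant_metric h"
  shows "h x v w = h 0 (heis_dL (- x) x v) (heis_dL (- x) x w)"
  using assms unfolding left_invariant_metric_def by (metis heis_prod_inverse)

lemma left_invariant_dL:
  assumes "left_invariant_metric h"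
  shows "h x (heis_dL x 0 v) (heis_dL x 0 w) = h 0 v w"
  using assms unfolding left_invariant_metric_def by (metis heis_prod_0)

text \<open>
  A left invariant metric is determined by its value at the unit through the differentials of the left
  translations, whose coordinates are polynomials.
\<close>

lemma left_invariant_riemannian:
  fixes h :: "'n::finite heis \<Rightarrow> 'n heis \<Rightarrow> 'n heis \<Rightarrow> real"
  assumes h: "left_invariant_metric h"
  shows "riemannian_metric h"
  unfolding riemannian_metric_def
proof (intro conjI allI)
  show "inner_product (h x)" for x by (rule left_invariant_inner_product[OF h])
  obtain L :: "'n heis \<Rightarrow> 'n heis" where L: "linear L" "\<And>v w. h 0 v w = L v \<bullet> L w"
    using inner_product_isometry[OF left_invariant_inner_product[OF h]] by metis
  have c: "continuous_on UNIV (\<lambda>z. heis_dL (- f z) (f z) (g z))"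
    if "continuous_on UNIV f" "continuous_on UNIV g" for f g :: "'b::topological_space \<Rightarrow> 'n heis"
  proof -
    have "continuous_on UNIV (\<lambda>z. heis_dL (- f z) (f z) (g z) $ i)" for i
      unfolding heis_dL_eq vec_lambda_beta using that by (cases "i = vert_idx") (auto intro!: continuous_intros)
    then have "continuous_on UNIV (\<lambda>z. \<chi> i. heis_dL (- f z) (f z) (g z) $ i)"
      by (rule continuous_on_vec_lambda)
    then show ?thesis by simp
  qed
  have cL: "continuous_on UNIV (\<lambda>z. L (heis_dL (- f z) (f z) (g z)))"
    if "continuous_on UNIV f" "continuous_on UNIV g" for f g :: "'b::topological_space \<Rightarrow> 'n heis"
    using L(1) by (intro bounded_linear.continuous_on[of L] c that) (simp add: linear_conv_bounded_linear)
  show "continuous_on UNIV (\<lambda>z. h (fst z) (fst (snd z)) (snd (snd z)))"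
    by (simp only: left_invariant_at_0[OF h, of "fst _"] L(2)) (intro continuous_intros cL)
qed

text \<open>
  At the unit the normal represents a multiple of the functional \<open>v \<mapsto> v $ vert_idx\<close>.  Left translation
  carries it to every other point, so the factor \<open>c\<close> is the same everywhere.
\<close>

lemma left_invariant_unit_normal:
  fixes h :: "'n::finite heis \<Rightarrow> 'n heis \<Rightarrow> 'n heis \<Rightarrow> real"
  assumes h: "left_invariant_metric h"
  obtains c e where "c > 0" "\<And>x. unit_normal (h x) (horizontal x) (e x)"
    "\<And>x v. h x v (e x) = c * contact_form x v"
proof -
  have ip: "inner_product (h 0)" by (rule left_invariant_inner_product[OF h])
  have "linear (\<lambda>v :: 'n heis. v $ vert_idx)" by (rule linearI) simp_all
  then obtain w where w: "\<And>v. h 0 v w = v $ vert_idx"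
    using inner_product_dual[OF ip] by metis
  have "w \<noteq> 0"
  proof
    assume "w = 0"
    then show False using w[of "axis vert_idx 1"] by (simp add: inner_product_simps[OF ip])
  qed
  then have ww: "h 0 w w > 0" using ip by (simp add: inner_product_def)
  define c where "c = 1 / sqrt (h 0 w w)"
  define e where "e x = heis_dL x 0 (c *\<^sub>R w)" for x
  have he: "h x v (e x) = c * contact_form x v" for x v
  proof -
    have "h x v (e x) = h x (heis_dL x 0 (heis_dL (- x) x v)) (heis_dL x 0 (c *\<^sub>R w))"
      by (simp only: heis_dL_inverse e_def)
    also have "\<dots> = c * contact_form x v"
      unfolding left_invariant_dL[OF h] by (simp add: inner_product_simps[OF ip] w contact_form_def)
    finally show ?thesis .
  qed
  have c: "c > 0" using ww by (simp add: c_def)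
  have "h x (e x) (e x) = 1" for x
    unfolding e_def left_invariant_dL[OF h] using ww by (simp add: inner_product_simps[OF ip] c_def)
  then have "unit_normal (h x) (horizontal x) (e x)" for x
    unfolding unit_normal_def horizontal_eq_kernel he using c by auto
  then show thesis by (rule that[OF c _ he])
qed


section \<open>The change of metric in the Heisenberg group\<close>

text \<open>
  The tangent \<open>p\<close>-vectors of the two metrics differ by the determinant of the transition matrix, and
  the area ratio is the reciprocal of its absolute value.  What remains is the ratio of the vertical
  norms of one and the same \<open>p\<close>-vector.
\<close>

lemma vertical_tangent_ratio:
  fixes S :: "'n::finite heis set"
  assumes S: "C1_submanifold TYPE('p::finite) \<Omega> S" and x: "x \<in> S"
    and h1: "inner_product (h1 x)" and e1: "unit_normal (h1 x) (horizontal x) e1"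
    and h2: "inner_product (h2 x)" and e2: "unit_normal (h2 x) (horizontal x) e2"
    and agree: "\<And>v w. v \<in> horizontal x \<Longrightarrow> w \<in> horizontal x \<Longrightarrow> h1 x v w = h2 x v w"
    and c: "c > 0" "\<And>v. h1 x v e1 = c * h2 x v e2"
  shows "area_ratio TYPE('p) h1 h2 S x *
      pvec_norm (h1 x) (vertical_tangent h1 S x :: ('n + 'n + unit, 'p) pvec) =
    c * pvec_norm (h2 x) (vertical_tangent h2 S x :: ('n + 'n + unit, 'p) pvec)"
proof -
  let ?t2 = "tangent_frame h2 S x :: ('n heis) ^ 'p" and ?V = "\<lambda>h. vertical_projection h (horizontal x)"
  obtain M where M: "(tangent_frame h1 S x :: ('n heis) ^ 'p) = combine M ?t2"
    "\<bar>det M\<bar> * area_ratio TYPE('p) h1 h2 S x = 1"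
    by (rule tangent_frame_combine[where ?h1.0 = h1 and ?h2.0 = h2, OF S x h1 h2]) (rule that)
  have "(vertical_tangent h1 S x :: ('n + 'n + unit, 'p) pvec) = ?V (h1 x) (det M *\<^sub>R wedge ?t2)"
    by (simp add: vertical_tangent_def tangent_pvector_eq_wedge M(1) wedge_combine)
  also have "\<dots> = det M *\<^sub>R ?V (h1 x) (wedge ?t2)"
    using vertical_projection_scale_wedge[OF h1 e1, of 1 ?t2]
    by (simp add: vertical_projection_scale_wedge[OF h1 e1])
  finally have "pvec_norm (h1 x) (vertical_tangent h1 S x :: ('n + 'n + unit, 'p) pvec) =
      \<bar>det M\<bar> * (c * pvec_norm (h2 x) (?V (h2 x) (wedge ?t2)))"
    by (simp add: pvec_norm_scale[OF h1] vertical_norm_ratio[OF h1 e1 h2 e2 agree c])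
  then show ?thesis
    using M(2) by (simp add: vertical_tangent_def tangent_pvector_eq_wedge mult.assoc[symmetric] mult.commute[of "area_ratio _ _ _ _ _"])
qed

text \<open>
  For the group itself the area ratio is the constant \<open>c\<close>.
\<close>

lemma riem_vol_top_ratio:
  fixes h1 h2 :: "'n::finite heis \<Rightarrow> 'n heis \<Rightarrow> 'n heis \<Rightarrow> real"
  assumes h1: "riemannian_metric h1" and e1: "\<And>x. unit_normal (h1 x) (horizontal x) (e1 x)"
    and h2: "riemannian_metric h2" and e2: "\<And>x. unit_normal (h2 x) (horizontal x) (e2 x)"
    and agree: "\<And>x v w. v \<in> horizontal x \<Longrightarrow> w \<in> horizontal x \<Longrightarrow> h1 x v w = h2 x v w"
    and c: "c > 0" "\<And>x v. h1 x v (e1 x) = c * h2 x v (e2 x)"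
  shows "emeasure (riem_vol h1 (2 * CARD('n) + 1)) A = ennreal c * emeasure (riem_vol h2 (2 * CARD('n) + 1)) A"
proof (cases "A \<in> sets borel")
  case True
  have card: "2 * CARD('n) + 1 = CARD('n + 'n + unit)" by simp
  note ip1 = riemannian_metric_inner_product[OF h1] and ip2 = riemannian_metric_inner_product[OF h2]
  have ratio: "area_ratio TYPE('n + 'n + unit) h1 h2 UNIV x = c" for x
    using gram_ratio_top[where t = "tangent_frame h2 UNIV x", OF ip1 e1 ip2 e2 agree c]
      gram_orthonormal[OF tangent_frame(1)[where h = h2, OF C1_submanifold_UNIV UNIV_I ip2]]
    by (simp add: area_ratio_def)
  have "emeasure (riem_vol h1 CARD('n + 'n + unit)) A = (\<integral>\<^sup>+ x\<in>UNIV. indicator A x \<partial>riem_vol h1 CARD('n + 'n + unit))"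
    using True by simp
  also have "\<dots> = (\<integral>\<^sup>+ x\<in>UNIV. ennreal c * indicator A x \<partial>riem_vol h2 CARD('n + 'n + unit))"
    unfolding nn_integral_riem_vol_change_metric[OF C1_submanifold_UNIV h1 h2] ratio ..
  also have "\<dots> = ennreal c * emeasure (riem_vol h2 CARD('n + 'n + unit)) A"
    using True by (simp add: nn_integral_cmult_indicator)
  finally show ?thesis unfolding card .
next
  case False
  then show ?thesis by (simp add: emeasure_notin_sets)
qed

lemma ennreal_ratio_cancel:
  fixes V I :: ennreal and c :: real
  assumes "c > 0"
  shows "1 / (ennreal c * V) * (ennreal c * I) = 1 / V * I"
proof -
  have c: "0 < ennreal c" "ennreal c < top" using assms by auto
  have "inverse (ennreal c * V) = inverse (ennreal c) * inverse V"
    using c by (intro ennreal_inverse_mult') auto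
  moreover have "inverse (ennreal c) * ennreal c = 1"
    using assms by (simp add: inverse_ennreal ennreal_mult[symmetric])
  ultimately show ?thesis
    by (simp add: divide_ennreal_def mult_ac)
qed

theorem theorem4p9:
  fixes \<Omega> S :: "'n::finite heis set"
    and \<rho> :: "'n heis \<Rightarrow> 'n heis \<Rightarrow> real"
    and gt :: "'n heis \<Rightarrow> 'n heis \<Rightarrow> 'n heis \<Rightarrow> real"
  assumes "open \<Omega>"
    and "C1_submanifold TYPE('p::finite) \<Omega> S"
    and "homogeneous_distance \<rho>"
    and "left_invariant_metric gt"
    and "\<And>x v w. v \<in> horizontal x \<Longrightarrow> w \<in> horizontal x \<Longrightarrow> gt x v w = heis_metric x v w"
  shows "1 / emeasure (riem_vol gt (2 * CARD('n) + 1)) (Metric_space.mball UNIV \<rho> 0 1) *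
      (\<integral>\<^sup>+ x \<in> S. ennreal (pvec_norm (gt x)
          (vertical_tangent gt S x :: ('n + 'n + unit, 'p) pvec)) \<partial>riem_vol gt CARD('p)) =
    1 / emeasure (riem_vol heis_metric (2 * CARD('n) + 1)) (Metric_space.mball UNIV \<rho> 0 1) *
      (\<integral>\<^sup>+ x \<in> S. ennreal (pvec_norm (heis_metric x)
          (vertical_tangent heis_metric S x :: ('n + 'n + unit, 'p) pvec)) \<partial>riem_vol heis_metric CARD('p))"
proof -
  note S = assms(2) and gt = assms(4) and agree = assms(5)
  let ?g = "heis_metric :: 'n heis \<Rightarrow> 'n heis \<Rightarrow> 'n heis \<Rightarrow> real"
  have g: "left_invariant_metric ?g" by (rule left_invariant_heis_metric)
  note rgt = left_invariant_riemannian[OF gt] and rg = left_invariant_riemannian[OF g]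
  note igt = left_invariant_inner_product[OF gt] and ig = left_invariant_inner_product[OF g]
  obtain c1 e1 where c1: "c1 > 0" and e1: "\<And>x. unit_normal (gt x) (horizontal x) (e1 x)"
    and f1: "\<And>x v. gt x v (e1 x) = c1 * contact_form x v"
    using left_invariant_unit_normal[OF gt] by metis
  obtain c2 e2 where c2: "c2 > 0" and e2: "\<And>x. unit_normal (?g x) (horizontal x) (e2 x)"
    and f2: "\<And>x v. ?g x v (e2 x) = c2 * contact_form x v"
    using left_invariant_unit_normal[OF g] by metis
  define c where "c = c1 / c2"
  have c: "c > 0" "\<And>x v. gt x v (e1 x) = c * ?g x v (e2 x)"
    using c1 c2 by (simp_all add: c_def f1 f2)
  let ?f = "\<lambda>h x. ennreal (pvec_norm (h x) (vertical_tangent h S x :: ('n + 'n + unit, 'p) pvec))"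
  have "(\<integral>\<^sup>+ x\<in>S. ?f gt x \<partial>riem_vol gt CARD('p)) =
    (\<integral>\<^sup>+ x\<in>S. ennreal (area_ratio TYPE('p) gt ?g S x) * ?f gt x \<partial>riem_vol ?g CARD('p))"
    by (rule nn_integral_riem_vol_change_metric[OF S rgt rg])
  also have "\<dots> = (\<integral>\<^sup>+ x. ennreal c * (?f ?g x * indicator S x) \<partial>riem_vol ?g CARD('p))"
  proof (rule nn_integral_cong)
    fix x
    show "ennreal (area_ratio TYPE('p) gt ?g S x) * ?f gt x * indicator S x =
      ennreal c * (?f ?g x * indicator S x)"
    proof (cases "x \<in> S")
      case True
      have "area_ratio TYPE('p) gt ?g S x *
          pvec_norm (gt x) (vertical_tangent gt S x :: ('n + 'n + unit, 'p) pvec) =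
        c * pvec_norm (?g x) (vertical_tangent ?g S x :: ('n + 'n + unit, 'p) pvec)"
        by (rule vertical_tangent_ratio[where ?h1.0 = gt and ?h2.0 = ?g, OF S True igt e1 ig e2 agree c])
      moreover have "0 \<le> area_ratio TYPE('p) gt ?g S x"
      proof (rule tangent_frame_combine[where ?h1.0 = gt and ?h2.0 = ?g, OF S True igt ig])
        fix M :: "real ^ 'p ^ 'p"
        let ?r = "area_ratio TYPE('p) gt ?g S x"
        assume M: "\<bar>det M\<bar> * ?r = 1"
        show "0 \<le> ?r"
        proof (rule ccontr)
          assume "\<not> 0 \<le> ?r"
          then have "\<bar>det M\<bar> * ?r \<le> 0" by (intro mult_nonneg_nonpos) auto
          with M show False by simp
        qed
      qed
      ultimately show ?thesis using c(1) by (simp add: True ennreal_mult' [symmetric])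
    qed simp
  qed
  also have "\<dots> = ennreal c * (\<integral>\<^sup>+ x\<in>S. ?f ?g x \<partial>riem_vol ?g CARD('p))"
    by (rule nn_integral_cmult_nonmeasurable[OF c(1)])
  finally have int: "(\<integral>\<^sup>+ x\<in>S. ?f gt x \<partial>riem_vol gt CARD('p)) = ennreal c * (\<integral>\<^sup>+ x\<in>S. ?f ?g x \<partial>riem_vol ?g CARD('p))" .
  have vol: "emeasure (riem_vol gt (2 * CARD('n) + 1)) A = ennreal c * emeasure (riem_vol ?g (2 * CARD('n) + 1)) A" for A
    by (rule riem_vol_top_ratio[OF rgt e1 rg e2 agree c])
  show ?thesis
    unfolding int vol by (rule ennreal_ratio_cancel[OF c(1)])
qed

end
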